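(* Let $\Gamma$ be a discrete group with the approximation property (AP), and let $\mathcal{A}$ be a unital $\Gamma$-$C^*$-algebra. Suppose that the kernel of the action $\Gamma \curvearrowright \mathcal{A}$ contains a plump subgroup of $\Gamma$. Then every intermediate $C^*$-subalgebra $\mathcal{B}$, $C_{\lambda}^*(\Gamma) \subseteq \mathcal{B} \subseteq \mathcal{A}\rtimes_{r}\Gamma$, is of the form $\mathcal{A}_1\rtimes_{r}\Gamma$ for some unital $\Gamma$-$C^*$-subalgebra $\mathcal{A}_1$ of $\mathcal{A}$.
   Context: A $\Gamma$-$C^*$-algebra is a $C^*$-algebra with an action of $\Gamma$ by $*$-automorphisms; a $\Gamma$-$C^*$-subalgebra is a $\Gamma$-invariant $C^*$-subalgebra (unital: containing the unit of $\mathcal{A}$). The kernel of the action is the set of $g\in\Gamma$ acting as the identity on $\mathcal{A}$. $\mathcal{A}\rtimes_r\Gamma$ is the reduced crossed product, generated by $\mathcal{A}$ and the canonical unitaries $\lambda_s$, $s\in\Gamma$, which implement the action. $C^*_\lambda(\Gamma)$ is the reduced group $C^*$-algebra, identified with the $C^*$-subalgebra of $\mathcal{A}\rtimes_r\Gamma$ generated by $\{\lambda_s : s\in\Gamma\}$. For a unital $\Gamma$-$C^*$-subalgebra $\mathcal{A}_1\subseteq\mathcal{A}$, $\mathcal{A}_1\rtimes_r\Gamma$ is identified with the $C^*$-subalgebra of $\mathcal{A}\rtimes_r\Gamma$ generated by $\mathcal{A}_1$ and $\{\lambda_s: s\in\Gamma\}$. Plump subgroup: a non-trivial subgroup $\Lambda\le\Gamma$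 is plump in $\Gamma$ if for every $\epsilon>0$ and every finite subset $F\subset\Gamma\setminus\{e\}$ there exist $s_1,\ldots,s_m\in\Lambda$ such that $\left\|\frac1m\sum_{j=1}^m\lambda_{s_j}\lambda_t\lambda_{s_j^{-1}}\right\|<\epsilon$ for all $t\in F$, where $\lambda$ is the left regular representation of $\Gamma$ and the norm is the operator norm on $\ell^2(\Gamma)$. Approximation property (AP), in the sense of Haagerup and Kraus: there is a net of finitely supported functions on $\Gamma$ converging to the constant function $1$ in the weak* topology of the space $M_0A(\Gamma)$ of completely bounded (Herz–Schur) multipliers, viewed as the dual of its canonical predual (the completion of $\ell^1(\Gamma)$ in the norm dual to the completely bounded multiplier norm). *)

theory Defs
  imports "HOL-Analysis.Analysis"
begin

section \<open>Complex Hilbert spaces and unital \<open>C\<^sup>*\<close>-algebras\<close>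

class complex_vector = real_vector +
  fixes scaleC :: "complex \<Rightarrow> 'a \<Rightarrow> 'a"  (infixr \<open>*\<^sub>C\<close> 75)
  assumes scaleC_add_right: "c *\<^sub>C (x + y) = c *\<^sub>C x + c *\<^sub>C y"
    and scaleC_add_left: "(c + d) *\<^sub>C x = c *\<^sub>C x + d *\<^sub>C x"
    and scaleC_scaleC: "c *\<^sub>C d *\<^sub>C x = (c * d) *\<^sub>C x"
    and scaleR_scaleC: "r *\<^sub>R x = complex_of_real r *\<^sub>C x"

lemma scaleC_one [simp]: "1 *\<^sub>C x = x" for x :: "'a::complex_vector"
  using scaleR_scaleC[of 1 x] by simp

lemma scaleC_zero_right [simp]: "c *\<^sub>C 0 = (0 :: 'a::complex_vector)"
  using scaleC_add_right[of c 0 "0::'a"] by simp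

text \<open>The inner product is conjugate linear in its first argument. The real inner product of
  the class \<^class>\<open>real_inner\<close>, which determines the norm, is its real part.\<close>

class complex_hilbert_space = complex_vector + real_inner + complete_space +
  fixes cinner :: "'a \<Rightarrow> 'a \<Rightarrow> complex"
  assumes cinner_commute: "cinner x y = cnj (cinner y x)"
    and cinner_add_right: "cinner x (y + z) = cinner x y + cinner x z"
    and cinner_scaleC_right: "cinner x (c *\<^sub>C y) = c * cinner x y"
    and inner_eq_Re_cinner: "inner x y = Re (cinner x y)"
    and nonzero_space: "\<exists>x. x \<noteq> 0"

text \<open>As usual, unital algebras are nonzero: \<^class>\<open>real_normed_algebra_1\<close> contains
  \<open>0 \<noteq> 1\<close>.\<close>

class cstar_algebra = complex_vector + real_normed_algebra_1 + complete_space +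
  fixes star :: "'a \<Rightarrow> 'a"
  assumes mult_scaleC_left: "(c *\<^sub>C x) * y = c *\<^sub>C (x * y)"
    and mult_scaleC_right: "x * (c *\<^sub>C y) = c *\<^sub>C (x * y)"
    and norm_scaleC: "norm (c *\<^sub>C x) = cmod c * norm x"
    and star_add: "star (x + y) = star x + star y"
    and star_scaleC: "star (c *\<^sub>C x) = cnj c *\<^sub>C star x"
    and star_mult: "star (x * y) = star y * star x"
    and star_star: "star (star x) = x"
    and cstar_identity: "norm (star x * x) = (norm x)\<^sup>2"

instance complex_hilbert_space \<subseteq> banach ..

instance cstar_algebra \<subseteq> banach ..

instantiation complex :: complex_hilbert_space
begin

definition scaleC_complex :: "complex \<Rightarrow> complex \<Rightarrow> complex"
  where "scaleC_complex c x = c * x"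

definition cinner_complex :: "complex \<Rightarrow> complex \<Rightarrow> complex"
  where "cinner_complex x y = cnj x * y"

instance
proof
  show "\<exists>x::complex. x \<noteq> 0"
    by (rule exI[of _ 1]) simp
qed (auto simp: scaleC_complex_def cinner_complex_def algebra_simps scaleR_conv_of_real
    inner_complex_def)

end

lemma cinner_add_left: "cinner (x + y) z = cinner x z + cinner y z"
  by (metis cinner_commute cinner_add_right complex_cnj_add)

lemma cinner_scaleC_left: "cinner (c *\<^sub>C x) y = cnj c * cinner x y"
  by (metis cinner_commute cinner_scaleC_right complex_cnj_mult)

lemma Im_cinner: "Im (cinner x y) = inner (\<i> *\<^sub>C x) y"
  by (simp add: inner_eq_Re_cinner cinner_scaleC_left)

lemma cinner_eqI: "(\<And>x y. inner (f x) (g y) = inner (f' x) (g' y)) \<Longrightarrow> 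
   (\<And>x. f (\<i> *\<^sub>C x) = \<i> *\<^sub>C f x) \<Longrightarrow> (\<And>x. f' (\<i> *\<^sub>C x) = \<i> *\<^sub>C f' x) \<Longrightarrow>
   cinner (f x) (g y) = cinner (f' x) (g' y)"
  by (rule complex_eqI) (metis inner_eq_Re_cinner, metis Im_cinner)

lemma norm_scaleC_hilbert: "norm (c *\<^sub>C x) = cmod c * norm x"
  for x :: "'a::complex_hilbert_space"
proof -
  have x: "cinner x x = complex_of_real (inner x x)"
    by (rule complex_eqI) (use cinner_commute[of x x] in \<open>auto simp: inner_eq_Re_cinner complex_eq_iff\<close>)
  have "cinner (c *\<^sub>C x) (c *\<^sub>C x) = complex_of_real ((cmod c)\<^sup>2 * inner x x)"
    using complex_norm_square[of c]
    by (simp add: cinner_scaleC_left cinner_scaleC_right x mult_ac)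
  hence "inner (c *\<^sub>C x) (c *\<^sub>C x) = (cmod c)\<^sup>2 * inner x x"
    by (simp add: inner_eq_Re_cinner)
  thus ?thesis
    by (simp add: norm_eq_sqrt_inner real_sqrt_mult)
qed

lemma cinner_ext: "(\<And>y. inner x y = inner x' y) \<Longrightarrow> x = x'"
  for x :: "'a::complex_hilbert_space"
  by (metis inner_eq_zero_iff right_minus_eq inner_diff_left)

lemma Riesz_inner:
  fixes f :: "'h::complex_hilbert_space \<Rightarrow> real"
  assumes "bounded_linear f"
  shows "\<exists>z. \<forall>x. f x = inner z x"
proof -
  interpret f: bounded_linear f by fact
  define J where "J x = (norm x)\<^sup>2 - 2 * f x" for x
  obtain K where K: "\<And>x. norm (f x) \<le> norm x * K" using f.bounded by blast
  have lb: "J x \<ge> - K\<^sup>2" for x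
  proof -
    have "2 * f x \<le> 2 * (norm x * K)" using K[of x] by simp
    moreover have "0 \<le> (norm x - K)\<^sup>2" by simp
    ultimately show ?thesis by (simp add: J_def power2_diff)
  qed
  define m where "m = (INF x. J x)"
  have bdd: "bdd_below (range J)" using lb by (auto intro!: bdd_belowI)
  have m: "m \<le> J x" for x unfolding m_def by (rule cINF_lower[OF bdd]) simp
  have "\<exists>x. J x < m + 1 / real (Suc n)" for n
    using cINF_less_iff[OF _ bdd, of "m + 1 / real (Suc n)"] by (auto simp: m_def)
  then obtain X where X: "\<And>n. J (X n) < m + 1 / real (Suc n)" by metis
  have mid: "(norm (x - y))\<^sup>2 = 2 * J x + 2 * J y - 4 * J ((1/2) *\<^sub>R (x + y))" for x y
    unfolding J_def
    by (simp add: f.add f.scaleR f.diff power2_norm_eq_inner inner_add_left inner_add_right 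
        inner_diff_left inner_diff_right inner_commute algebra_simps)
  have dist: "(norm (X n - X k))\<^sup>2 \<le> 2 / real (Suc n) + 2 / real (Suc k)" for n k
  proof -
    have "2 / real (Suc n) = 2 * (1 / real (Suc n))" "2 / real (Suc k) = 2 * (1 / real (Suc k))"
      by simp_all
    thus ?thesis
      using X[of n] X[of k] m[of "(1/2) *\<^sub>R (X n + X k)"] unfolding mid by linarith
  qed
  have "Cauchy X"
  proof (rule CauchyI)
    fix e :: real assume e: "e > 0"
    then obtain M where M: "4 / e\<^sup>2 < real M" using reals_Archimedean2 by blast
    show "\<exists>M. \<forall>n\<ge>M. \<forall>k\<ge>M. norm (X n - X k) < e"
    proof (intro exI[of _ M] allI impI)
      fix n k assume nk: "M \<le> n" "M \<le> k"
      have "0 < 4 / e\<^sup>2" using e by simp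
      hence M0: "0 < real M" using M by linarith
      have "2 / real (Suc n) \<le> 2 / real M" "2 / real (Suc k) \<le> 2 / real M"
        using nk M0 by (auto intro!: divide_left_mono)
      moreover have "4 / real M < e\<^sup>2"
        using M M0 e by (simp add: field_simps)
      ultimately have "(norm (X n - X k))\<^sup>2 < e\<^sup>2" using dist[of n k] by linarith
      thus "norm (X n - X k) < e" using e by (simp add: power_less_imp_less_base)
    qed
  qed
  then obtain z where z: "X \<longlonglongrightarrow> z" by (metis Cauchy_convergent convergent_def)
  have Jz: "(\<lambda>n. J (X n)) \<longlonglongrightarrow> J z"
    unfolding J_def by (intro tendsto_intros z f.tendsto)
  have "(\<lambda>n. m + 1 / real (Suc n)) \<longlonglongrightarrow> m + 0"
    by (intro tendsto_add tendsto_const LIMSEQ_inverse_real_of_nat[unfolded inverse_eq_divide])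
  hence "J z \<le> m + 0" by (rule LIMSEQ_le[OF Jz]) (use X in \<open>auto intro!: less_imp_le\<close>)
  hence min: "J z \<le> J x" for x using m[of x] by simp
  have "f x = inner z x" for x
  proof -
    define d where "d = inner z x - f x"
    have *: "0 \<le> 2 * t * d + t\<^sup>2 * (norm x)\<^sup>2" for t
      using min[of "z + t *\<^sub>R x"] unfolding J_def d_def power2_norm_eq_inner
      by (simp add: f.add f.scaleR inner_add_left inner_add_right 
        inner_commute[of x z] algebra_simps power2_eq_square)
    have "d = 0"
    proof (rule ccontr)
      assume d: "d \<noteq> 0"
      define N where "N = (norm x)\<^sup>2 + 1"
      have N: "N > 0" "N > (norm x)\<^sup>2" by (auto simp: N_def add_nonneg_pos)
      have "0 \<le> 2 * (- d / N) * d + (- d / N)\<^sup>2 * (norm x)\<^sup>2" by (rule *)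
      also have "\<dots> \<le> 2 * (- d / N) * d + (- d / N)\<^sup>2 * N"
        using N by (intro add_left_mono mult_left_mono) auto
      also have "\<dots> = - (d\<^sup>2 / N)" using N by (simp add: field_simps power2_eq_square)
      also have "\<dots> < 0" using N d by simp
      finally show False by simp
    qed
    thus ?thesis by (simp add: d_def)
  qed
  thus ?thesis by blast
qed

section \<open>The \<open>C\<^sup>*\<close>-algebra of bounded operators on a Hilbert space\<close>

typedef (overloaded) 'h bop =
  "{T :: 'h::complex_hilbert_space \<Rightarrow>\<^sub>L 'h. \<forall>c x. blinfun_apply T (c *\<^sub>C x) = c *\<^sub>C blinfun_apply T x}"
  by (rule exI[of _ 0]) simp

setup_lifting type_definition_bop

lift_definition bop_apply :: "'h::complex_hilbert_space bop \<Rightarrow> 'h \<Rightarrow> 'h"  (infixr \<open>\<bullet>\<^sub>O\<close> 80)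
  is blinfun_apply .

text \<open>Used only for bounded complex linear maps \<open>f\<close>.\<close>

definition Bop :: "('h \<Rightarrow> 'h) \<Rightarrow> 'h::complex_hilbert_space bop"
  where "Bop f = Abs_bop (Blinfun f)"

lemma bop_apply_Bop:
  assumes "bounded_linear f" and "\<And>c x. f (c *\<^sub>C x) = c *\<^sub>C f x"
  shows "Bop f \<bullet>\<^sub>O x = f x"
  using assms by (simp add: Bop_def bop_apply.rep_eq Abs_bop_inverse bounded_linear_Blinfun_apply)

lemma bop_eqI: "(\<And>x. S \<bullet>\<^sub>O x = T \<bullet>\<^sub>O x) \<Longrightarrow> S = T"
  by transfer (rule blinfun_eqI)

lemma bounded_linear_bop_apply: "bounded_linear (bop_apply T)"
  by transfer (rule blinfun.bounded_linear_right)

lemma bop_apply_scaleC: "T \<bullet>\<^sub>O (c *\<^sub>C x) = c *\<^sub>C T \<bullet>\<^sub>O x"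
  by transfer simp

lemma bop_adjoint_exists:
  "\<exists>S. \<forall>x y. cinner (S \<bullet>\<^sub>O x) y = cinner x (T \<bullet>\<^sub>O y)"
proof -
  interpret T: bounded_linear "bop_apply T" by (rule bounded_linear_bop_apply)
  obtain K where K: "\<And>x. norm (T \<bullet>\<^sub>O x) \<le> norm x * K" using T.bounded by blast
  have "\<forall>y. \<exists>z. \<forall>x. inner y (T \<bullet>\<^sub>O x) = inner z x"
    by (intro allI Riesz_inner)
      (rule bounded_linear_compose[OF bounded_linear_inner_right bounded_linear_bop_apply])
  then obtain S where S: "\<And>y x. inner (S y) x = inner y (T \<bullet>\<^sub>O x)"
    by metis
  have lin: "S (x + y) = S x + S y" "S (r *\<^sub>R x) = r *\<^sub>R S x" for x y r
    by (rule cinner_ext, simp add: S inner_add_left)+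
  have iadj: "inner (c *\<^sub>C x) y = inner x (cnj c *\<^sub>C y)" for c and x y :: 'a
    by (simp add: inner_eq_Re_cinner cinner_scaleC_left cinner_scaleC_right)
  have C: "S (c *\<^sub>C x) = c *\<^sub>C S x" for c x
    by (rule cinner_ext) (simp add: S iadj bop_apply_scaleC)
  have bd: "norm (S x) \<le> norm x * K" for x
  proof (cases "S x = 0")
    case True
    have "0 \<le> norm (T \<bullet>\<^sub>O x)" by simp
    hence "0 \<le> norm x * K" using K[of x] by linarith
    with True show ?thesis by simp
  next
    case False
    have "norm (S x) * norm (S x) = inner (S x) (S x)" 
      by (simp add: power2_norm_eq_inner[symmetric] power2_eq_square)
    also have "\<dots> = inner x (T \<bullet>\<^sub>O S x)" by (rule S)
    also have "\<dots> \<le> norm x * norm (T \<bullet>\<^sub>O S x)" by (rule norm_cauchy_schwarz)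
    also have "\<dots> \<le> norm x * (norm (S x) * K)" by (intro mult_left_mono K) auto
    finally show ?thesis using False by (simp add: mult_ac)
  qed
  have bl: "bounded_linear S" by (rule bounded_linear_intro[OF lin bd])
  have "cinner (S x) y = cinner x (T \<bullet>\<^sub>O y)" for x y
    using cinner_eqI[of S "\<lambda>y. y" "\<lambda>x. x" "bop_apply T"] by (simp add: S C)
  thus ?thesis using bop_apply_Bop[OF bl C] by (intro exI[of _ "Bop S"]) simp
qed

instantiation bop :: (complex_hilbert_space) "{complex_vector, real_normed_algebra_1}"
begin

lift_definition zero_bop :: "'a bop" is 0 by simp
lift_definition one_bop :: "'a bop" is id_blinfun by simp
lift_definition plus_bop :: "'a bop \<Rightarrow> 'a bop \<Rightarrow> 'a bop" is "(+)"
  by (simp add: blinfun.add_left scaleC_add_right)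
lift_definition uminus_bop :: "'a bop \<Rightarrow> 'a bop" is uminus
  by (simp add: blinfun.minus_left) (metis add_eq_0_iff scaleC_add_right scaleC_zero_right)
lift_definition minus_bop :: "'a bop \<Rightarrow> 'a bop \<Rightarrow> 'a bop" is "(-)"
  by (simp add: blinfun.diff_left) (metis diff_add_cancel add_diff_cancel_right' scaleC_add_right)
lift_definition times_bop :: "'a bop \<Rightarrow> 'a bop \<Rightarrow> 'a bop" is "(o\<^sub>L)"
  by simp
lift_definition scaleR_bop :: "real \<Rightarrow> 'a bop \<Rightarrow> 'a bop" is "(*\<^sub>R)"
  by (simp add: blinfun.scaleR_left scaleR_scaleC scaleC_scaleC mult.commute)
lift_definition norm_bop :: "'a bop \<Rightarrow> real" is norm .

definition scaleC_bop :: "complex \<Rightarrow> 'a bop \<Rightarrow> 'a bop"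
  where "scaleC_bop c T = Bop (\<lambda>x. c *\<^sub>C T \<bullet>\<^sub>O x)"
definition dist_bop :: "'a bop \<Rightarrow> 'a bop \<Rightarrow> real"
  where "dist_bop S T = norm (S - T)"
definition sgn_bop :: "'a bop \<Rightarrow> 'a bop"
  where "sgn_bop T = inverse (norm T) *\<^sub>R T"
definition uniformity_bop :: "('a bop \<times> 'a bop) filter"
  where "uniformity_bop = (INF e\<in>{0 <..}. principal {(x, y). dist x y < e})"
definition open_bop :: "'a bop set \<Rightarrow> bool"
  where "open_bop U = (\<forall>x\<in>U. \<forall>\<^sub>F (x', y) in uniformity. x' = x \<longrightarrow> y \<in> U)"

lemma bop_apply_simps:
  "(0 :: 'a bop) \<bullet>\<^sub>O x = 0" "(1 :: 'a bop) \<bullet>\<^sub>O x = x"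
  "(S + T) \<bullet>\<^sub>O x = S \<bullet>\<^sub>O x + T \<bullet>\<^sub>O x" "(S - T) \<bullet>\<^sub>O x = S \<bullet>\<^sub>O x - T \<bullet>\<^sub>O x"
  "(- T) \<bullet>\<^sub>O x = - (T \<bullet>\<^sub>O x)" "(S * T) \<bullet>\<^sub>O x = S \<bullet>\<^sub>O T \<bullet>\<^sub>O x"
  "(r *\<^sub>R T) \<bullet>\<^sub>O x = r *\<^sub>R T \<bullet>\<^sub>O x" "(c *\<^sub>C T) \<bullet>\<^sub>O x = c *\<^sub>C T \<bullet>\<^sub>O x"
proof -
  show "(c *\<^sub>C T) \<bullet>\<^sub>O x = c *\<^sub>C T \<bullet>\<^sub>O x"
    unfolding scaleC_bop_def
  proof (rule bop_apply_Bop)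
    interpret T: bounded_linear "bop_apply T" by (rule bounded_linear_bop_apply)
    show "bounded_linear (\<lambda>x. c *\<^sub>C T \<bullet>\<^sub>O x)"
    proof (rule bounded_linear_compose[OF _ bounded_linear_bop_apply], 
        rule bounded_linear_intro[where K = "cmod c"])
      show "norm (c *\<^sub>C x) \<le> norm x * cmod c" for x :: 'a
        by (simp add: norm_scaleC_hilbert)
    qed (auto simp: scaleC_add_right scaleR_scaleC scaleC_scaleC mult.commute)
  qed (simp add: bop_apply_scaleC scaleC_scaleC mult.commute)
qed (transfer; simp add: blinfun.add_left blinfun.diff_left blinfun.minus_left blinfun.scaleR_left)+

lemma norm_bop_apply: "norm (T \<bullet>\<^sub>O x) \<le> norm T * norm x" for T :: "'a bop"
  by transfer (rule norm_blinfun)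

lemma norm_bop_bound: "0 \<le> b \<Longrightarrow> (\<And>x. norm (T \<bullet>\<^sub>O x) \<le> b * norm x) \<Longrightarrow> norm T \<le> b"
  for T :: "'a bop"
  by transfer (rule norm_blinfun_bound)

lemma norm_mult_bop_le: "norm (S * T) \<le> norm S * norm T" for T :: "'a bop"
  by transfer (rule norm_blinfun_compose)

instance
proof
  fix x y z :: "'a bop" and r s :: real and c d :: complex
  show "x + y + z = x + (y + z)" by transfer simp
  show "x + y = y + x" by transfer simp
  show "0 + x = x" by transfer simp
  show "- x + x = 0" by transfer simp
  show "x - y = x + - y" by transfer simp
  show "r *\<^sub>R (x + y) = r *\<^sub>R x + r *\<^sub>R y" by transfer (rule scaleR_right_distrib)
  show "(r + s) *\<^sub>R x = r *\<^sub>R x + s *\<^sub>R x" by transfer (rule scaleR_left_distrib)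
  show "r *\<^sub>R s *\<^sub>R x = (r * s) *\<^sub>R x" by transfer simp
  show "1 *\<^sub>R x = x" by transfer simp
  show "c *\<^sub>C (x + y) = c *\<^sub>C x + c *\<^sub>C y"
    by (rule bop_eqI) (simp add: bop_apply_simps scaleC_add_right)
  show "(c + d) *\<^sub>C x = c *\<^sub>C x + d *\<^sub>C x"
    by (rule bop_eqI) (simp add: bop_apply_simps scaleC_add_left)
  show "c *\<^sub>C d *\<^sub>C x = (c * d) *\<^sub>C x"
    by (rule bop_eqI) (simp add: bop_apply_simps scaleC_scaleC)
  show "r *\<^sub>R x = complex_of_real r *\<^sub>C x"
    by (rule bop_eqI) (simp add: bop_apply_simps scaleR_scaleC)
  show "x * y * z = x * (y * z)" by (rule bop_eqI) (simp add: bop_apply_simps)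
  show "(x + y) * z = x * z + y * z" by (rule bop_eqI) (simp add: bop_apply_simps)
  show "x * (y + z) = x * y + x * z"
    by transfer (rule blinfun_eqI, simp add: blinfun.add_right blinfun.add_left)
  show "(r *\<^sub>R x) * y = r *\<^sub>R (x * y)" by (rule bop_eqI) (simp add: bop_apply_simps)
  show "x * (r *\<^sub>R y) = r *\<^sub>R (x * y)"
    by transfer (rule blinfun_eqI, simp add: blinfun.scaleR_left blinfun.scaleR_right)
  show "1 * x = x" "x * 1 = x" by (rule bop_eqI, simp add: bop_apply_simps)+
  obtain v :: 'a where v: "v \<noteq> 0" using nonzero_space by blast
  show "(0 :: 'a bop) \<noteq> 1" using v bop_apply_simps(1,2)[of v] by metis
  show "norm (1 :: 'a bop) = 1"
  proof (rule antisym)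
    show "norm (1 :: 'a bop) \<le> 1" by (rule norm_bop_bound) (auto simp: bop_apply_simps)
    show "1 \<le> norm (1 :: 'a bop)" using norm_bop_apply[of 1 v] v by (simp add: bop_apply_simps)
  qed
  show "dist x y = norm (x - y)" by (rule dist_bop_def)
  show "sgn x = inverse (norm x) *\<^sub>R x" by (rule sgn_bop_def)
  show "uniformity = (INF e\<in>{0 <..}. principal {(x :: 'a bop, y). dist x y < e})"
    by (rule uniformity_bop_def)
  show "open U = (\<forall>x\<in>U. \<forall>\<^sub>F (x', y) in uniformity. x' = x \<longrightarrow> y \<in> U)" for U :: "'a bop set"
    by (rule open_bop_def)
  show "(norm x = 0) = (x = 0)" by transfer simp
  show "norm (x + y) \<le> norm x + norm y" by transfer (rule norm_triangle_ineq)
  show "norm (r *\<^sub>R x) = \<bar>r\<bar> * norm x" by transfer simp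
  show "norm (x * y) \<le> norm x * norm y" by (rule norm_mult_bop_le)
qed

end

instantiation bop :: (complex_hilbert_space) cstar_algebra
begin

definition star_bop :: "'a bop \<Rightarrow> 'a bop"
  where "star_bop T = (THE S. \<forall>x y. cinner (S \<bullet>\<^sub>O x) y = cinner x (T \<bullet>\<^sub>O y))"

lemma cinner_star_bop: "cinner (star T \<bullet>\<^sub>O x) y = cinner x (T \<bullet>\<^sub>O y)" for T :: "'a bop"
proof -
  have ex: "\<exists>!S. \<forall>x y. cinner (S \<bullet>\<^sub>O x) y = cinner x (T \<bullet>\<^sub>O y)"
  proof (rule ex_ex1I[OF bop_adjoint_exists])
    fix S S' assume "\<forall>x y. cinner (S \<bullet>\<^sub>O x) y = cinner x (T \<bullet>\<^sub>O y)"
      "\<forall>x y. cinner (S' \<bullet>\<^sub>O x) y = cinner x (T \<bullet>\<^sub>O y)"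
    thus "S = S'" by (intro bop_eqI cinner_ext) (simp add: inner_eq_Re_cinner)
  qed
  have "\<forall>x y. cinner (star T \<bullet>\<^sub>O x) y = cinner x (T \<bullet>\<^sub>O y)"
    unfolding star_bop_def by (rule theI'[OF ex])
  thus ?thesis by (elim allE)
qed

lemma cinner_star_bop': "cinner x (star T \<bullet>\<^sub>O y) = cinner (T \<bullet>\<^sub>O x) y" for T :: "'a bop"
  using cinner_star_bop[of T y x] cinner_commute[of x "star T \<bullet>\<^sub>O y"]
    cinner_commute[of "T \<bullet>\<^sub>O x" y] by simp

lemma star_bop_eqI:
  fixes T :: "'a bop"
  assumes "\<And>x y. cinner (S \<bullet>\<^sub>O x) y = cinner x (T \<bullet>\<^sub>O y)"
  shows "star T = S"
proof (rule bop_eqI, rule cinner_ext)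
  show "inner (star T \<bullet>\<^sub>O x) y = inner (S \<bullet>\<^sub>O x) y" for x y
    unfolding inner_eq_Re_cinner cinner_star_bop assms ..
qed

lemma norm_star_bop_le: "norm (star T) \<le> norm T" for T :: "'a bop"
proof (rule norm_bop_bound)
  show "0 \<le> norm T" by simp
  fix x :: 'a
  have "(norm (star T \<bullet>\<^sub>O x))\<^sup>2 = inner x (T \<bullet>\<^sub>O star T \<bullet>\<^sub>O x)"
    by (simp add: power2_norm_eq_inner inner_eq_Re_cinner cinner_star_bop)
  also have "\<dots> \<le> norm x * norm (T \<bullet>\<^sub>O star T \<bullet>\<^sub>O x)" by (rule norm_cauchy_schwarz)
  also have "\<dots> \<le> norm x * (norm T * norm (star T \<bullet>\<^sub>O x))"
    by (intro mult_left_mono norm_bop_apply) auto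
  finally have *: "norm (star T \<bullet>\<^sub>O x) * norm (star T \<bullet>\<^sub>O x) \<le> (norm T * norm x) * norm (star T \<bullet>\<^sub>O x)" 
    by (simp add: power2_eq_square mult_ac)
  show "norm (star T \<bullet>\<^sub>O x) \<le> norm T * norm x"
  proof (cases "norm (star T \<bullet>\<^sub>O x) = 0")
    case True
    with True show ?thesis by simp
  next
    case False
    hence "norm (star T \<bullet>\<^sub>O x) > 0" by simp
    from mult_right_le_imp_le[OF * this] show ?thesis .
  qed
qed

instance
proof
  fix x y z :: "'a bop" and c d :: complex
  show "(c *\<^sub>C x) * y = c *\<^sub>C (x * y)" by (rule bop_eqI) (simp add: bop_apply_simps)
  show "x * (c *\<^sub>C y) = c *\<^sub>C (x * y)"
    by (rule bop_eqI) (simp add: bop_apply_simps bop_apply_scaleC)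
  have nC: "norm (c *\<^sub>C x) \<le> cmod c * norm x" for c and x :: "'a bop"
  proof (rule norm_bop_bound)
    show "0 \<le> cmod c * norm x" by simp
    show "norm ((c *\<^sub>C x) \<bullet>\<^sub>O y) \<le> cmod c * norm x * norm y" for y
      using mult_left_mono[OF norm_bop_apply[of x y], of "cmod c"]
      by (simp add: bop_apply_simps norm_scaleC_hilbert mult.assoc)
  qed
  show "norm (c *\<^sub>C x) = cmod c * norm x"
  proof (cases "c = 0")
    case True
    from True show ?thesis using nC[of c x] by simp
  next
    case False
    have "inverse c *\<^sub>C c *\<^sub>C x = x" using False
      by (intro bop_eqI) (simp add: bop_apply_simps scaleC_scaleC)
    hence "norm x \<le> cmod (inverse c) * norm (c *\<^sub>C x)" using nC[of "inverse c" "c *\<^sub>C x"] by simp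
    hence "cmod c * norm x \<le> norm (c *\<^sub>C x)"
      using False by (simp only: norm_inverse) (simp add: field_simps)
    thus ?thesis using nC[of c x] by simp
  qed
  show "star (x + y) = star x + star y"
    by (rule star_bop_eqI)
      (simp add: bop_apply_simps cinner_add_left cinner_add_right cinner_star_bop)
  show "star (c *\<^sub>C x) = cnj c *\<^sub>C star x"
    by (rule star_bop_eqI)
      (simp add: bop_apply_simps cinner_scaleC_left cinner_scaleC_right cinner_star_bop)
  show "star (x * y) = star y * star x"
    by (rule star_bop_eqI) (simp add: bop_apply_simps cinner_star_bop)
  show ss: "star (star x) = x" for x :: "'a bop"
    by (rule star_bop_eqI) (simp add: cinner_star_bop')
  have "norm (star x) = norm x"
    using norm_star_bop_le[of x] norm_star_bop_le[of "star x"] by (simp add: ss)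
  hence "norm (star x * x) \<le> (norm x)\<^sup>2"
    using norm_mult_ineq[of "star x" x] by (simp add: power2_eq_square)
  moreover have "(norm x)\<^sup>2 \<le> norm (star x * x)"
  proof -
    have "norm x \<le> sqrt (norm (star x * x))"
    proof (rule norm_bop_bound)
      fix v :: 'a
      have "(norm (x \<bullet>\<^sub>O v))\<^sup>2 = inner v ((star x * x) \<bullet>\<^sub>O v)"
        by (simp add: power2_norm_eq_inner inner_eq_Re_cinner cinner_star_bop' bop_apply_simps)
      also have "\<dots> \<le> norm v * norm ((star x * x) \<bullet>\<^sub>O v)" by (rule norm_cauchy_schwarz)
      also have "\<dots> \<le> norm v * (norm (star x * x) * norm v)"
        by (intro mult_left_mono norm_bop_apply) auto
      also have "\<dots> = (sqrt (norm (star x * x)) * norm v)\<^sup>2"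
        by (simp add: power_mult_distrib power2_eq_square)
      finally show "norm (x \<bullet>\<^sub>O v) \<le> sqrt (norm (star x * x)) * norm v"
        by (rule power2_le_imp_le) simp
    qed simp
    from power_mono[OF this norm_ge_zero, of 2] show ?thesis by simp
  qed
  ultimately show "norm (star x * x) = (norm x)\<^sup>2" by simp
  show "convergent X" if X: "Cauchy X" for X :: "nat \<Rightarrow> 'a bop"
  proof -
    have d: "dist (Rep_bop S) (Rep_bop T) = dist S T" for S T :: "'a bop"
      by (simp add: dist_norm norm_bop.rep_eq minus_bop.rep_eq)
    have "Cauchy (\<lambda>n. Rep_bop (X n))" using X unfolding Cauchy_def d .
    then obtain L where L: "(\<lambda>n. Rep_bop (X n)) \<longlonglongrightarrow> L"
      by (auto simp: Cauchy_convergent_iff convergent_def)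
    have ap: "(\<lambda>n. X n \<bullet>\<^sub>O v) \<longlonglongrightarrow> blinfun_apply L v" for v
      using blinfun.tendsto[OF L tendsto_const[of v]] by (simp add: bop_apply.rep_eq)
    have sc: "bounded_linear (\<lambda>x :: 'a. c *\<^sub>C x)" for c
      by (rule bounded_linear_intro[where K = "cmod c"])
        (auto simp: norm_scaleC_hilbert scaleC_add_right scaleR_scaleC scaleC_scaleC mult.commute)
    have "blinfun_apply L (c *\<^sub>C v) = c *\<^sub>C blinfun_apply L v" for c v
    proof (rule LIMSEQ_unique[OF ap])
      show "(\<lambda>n. X n \<bullet>\<^sub>O (c *\<^sub>C v)) \<longlonglongrightarrow> c *\<^sub>C blinfun_apply L v"
        unfolding bop_apply_scaleC by (rule bounded_linear.tendsto[OF sc ap])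
    qed
    hence R: "Rep_bop (Abs_bop L) = L" by (intro Abs_bop_inverse) simp
    show ?thesis
    proof (rule convergentI[of _ "Abs_bop L"])
      show "X \<longlonglongrightarrow> Abs_bop L"
        using L unfolding tendsto_iff d[symmetric] R .
    qed
  qed
qed

end

section \<open>Square-summable families\<close>

typedef (overloaded) ('g, 'h) ell2 =
  "{\<xi> :: 'g \<Rightarrow> 'h::complex_hilbert_space. (\<lambda>t. (norm (\<xi> t))\<^sup>2) summable_on UNIV}"
  by (rule exI[of _ "\<lambda>_. 0"]) simp

setup_lifting type_definition_ell2

lemma ell2_add_closed:
  fixes \<xi> \<eta> :: "'g \<Rightarrow> 'h::complex_hilbert_space"
  assumes "(\<lambda>t. (norm (\<xi> t))\<^sup>2) summable_on UNIV" "(\<lambda>t. (norm (\<eta> t))\<^sup>2) summable_on UNIV"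
  shows "(\<lambda>t. (norm (\<xi> t + \<eta> t))\<^sup>2) summable_on UNIV"
proof (rule summable_on_comparison_test)
  show "(\<lambda>t. 2 * (norm (\<xi> t))\<^sup>2 + 2 * (norm (\<eta> t))\<^sup>2) summable_on UNIV"
    by (intro summable_on_add summable_on_cmult_right assms)
  fix t
  have "(norm (\<xi> t + \<eta> t))\<^sup>2 \<le> (norm (\<xi> t) + norm (\<eta> t))\<^sup>2"
    by (intro power_mono norm_triangle_ineq) simp
  also have "\<dots> \<le> 2 * (norm (\<xi> t))\<^sup>2 + 2 * (norm (\<eta> t))\<^sup>2"
    using sum_squares_bound[of "norm (\<xi> t)" "norm (\<eta> t)"] by (simp add: power2_sum)
  finally show "(norm (\<xi> t + \<eta> t))\<^sup>2 \<le> 2 * (norm (\<xi> t))\<^sup>2 + 2 * (norm (\<eta> t))\<^sup>2" .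
qed simp

lemma cinner_Cauchy_Schwarz: "cmod (cinner x y) \<le> norm x * norm y"
  for x y :: "'h::complex_hilbert_space"
proof (cases "cinner x y = 0")
  case False
  define c where "c = cnj (sgn (cinner x y))"
  have c: "cmod c = 1" using False by (simp add: c_def norm_sgn)
  have "c * cinner x y = complex_of_real (cmod (cinner x y))"
    using False complex_norm_square[of "cinner x y"]
    by (simp add: c_def sgn_eq power2_eq_square field_simps)
  hence "cmod (cinner x y) = inner x (c *\<^sub>C y)"
    by (simp add: inner_eq_Re_cinner cinner_scaleC_right)
  also have "\<dots> \<le> norm x * norm (c *\<^sub>C y)" by (rule norm_cauchy_schwarz)
  finally show ?thesis by (simp add: norm_scaleC_hilbert c)
qed simp

lemma ell2_cinner_summable:
  fixes \<xi> \<eta> :: "'g \<Rightarrow> 'h::complex_hilbert_space"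
  assumes "(\<lambda>t. (norm (\<xi> t))\<^sup>2) summable_on UNIV" "(\<lambda>t. (norm (\<eta> t))\<^sup>2) summable_on UNIV"
  shows "(\<lambda>t. cinner (\<xi> t) (\<eta> t)) summable_on UNIV"
proof (rule Infinite_Sum.abs_summable_summable, rule Infinite_Sum.abs_summable_on_comparison_test')
  show "(\<lambda>t. (norm (\<xi> t))\<^sup>2 + (norm (\<eta> t))\<^sup>2) summable_on UNIV"
    by (intro summable_on_add assms)
  fix t
  have "cmod (cinner (\<xi> t) (\<eta> t)) \<le> norm (\<xi> t) * norm (\<eta> t)" by (rule cinner_Cauchy_Schwarz)
  also have "\<dots> \<le> (norm (\<xi> t))\<^sup>2 + (norm (\<eta> t))\<^sup>2"
  proof -
    have "0 \<le> norm (\<xi> t) * norm (\<eta> t)" by simp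
    thus ?thesis using sum_squares_bound[of "norm (\<xi> t)" "norm (\<eta> t)"] by linarith
  qed
  finally show "cmod (cinner (\<xi> t) (\<eta> t)) \<le> (norm (\<xi> t))\<^sup>2 + (norm (\<eta> t))\<^sup>2" .
qed

lemma has_sum_Re: "(f has_sum c) A \<Longrightarrow> ((\<lambda>t. Re (f t)) has_sum Re c) A"
  by (rule has_sum_bounded_linear[OF bounded_linear_Re, unfolded o_def])

lemma ell2_inner_has_sum:
  fixes \<xi> \<eta> :: "'g \<Rightarrow> 'h::complex_hilbert_space"
  assumes "(\<lambda>t. (norm (\<xi> t))\<^sup>2) summable_on UNIV" "(\<lambda>t. (norm (\<eta> t))\<^sup>2) summable_on UNIV"
  shows "((\<lambda>t. inner (\<xi> t) (\<eta> t)) has_sum Re (\<Sum>\<^sub>\<infinity>t. cinner (\<xi> t) (\<eta> t))) UNIV"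
  unfolding inner_eq_Re_cinner
  by (intro has_sum_Re has_sum_infsum ell2_cinner_summable assms)

instantiation ell2 :: (type, complex_hilbert_space) "{complex_vector, real_inner}"
begin

lift_definition zero_ell2 :: "('a, 'b) ell2" is "\<lambda>_. 0" by simp
lift_definition plus_ell2 :: "('a, 'b) ell2 \<Rightarrow> ('a, 'b) ell2 \<Rightarrow> ('a, 'b) ell2"
  is "\<lambda>\<xi> \<eta> t. \<xi> t + \<eta> t" by (rule ell2_add_closed)
lift_definition uminus_ell2 :: "('a, 'b) ell2 \<Rightarrow> ('a, 'b) ell2" is "\<lambda>\<xi> t. - \<xi> t" by simp
lift_definition minus_ell2 :: "('a, 'b) ell2 \<Rightarrow> ('a, 'b) ell2 \<Rightarrow> ('a, 'b) ell2"
  is "\<lambda>\<xi> \<eta> t. \<xi> t - \<eta> t"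
  using ell2_add_closed[of _ "\<lambda>t. - _ t"] by simp
lift_definition scaleC_ell2 :: "complex \<Rightarrow> ('a, 'b) ell2 \<Rightarrow> ('a, 'b) ell2"
  is "\<lambda>c \<xi> t. c *\<^sub>C \<xi> t"
  by (simp add: norm_scaleC_hilbert power_mult_distrib summable_on_cmult_right)
lift_definition scaleR_ell2 :: "real \<Rightarrow> ('a, 'b) ell2 \<Rightarrow> ('a, 'b) ell2"
  is "\<lambda>r \<xi> t. r *\<^sub>R \<xi> t"
  by (simp add: power_mult_distrib summable_on_cmult_right)
lift_definition inner_ell2 :: "('a, 'b) ell2 \<Rightarrow> ('a, 'b) ell2 \<Rightarrow> real"
  is "\<lambda>\<xi> \<eta>. \<Sum>\<^sub>\<infinity>t. inner (\<xi> t) (\<eta> t)" .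

definition norm_ell2 :: "('a, 'b) ell2 \<Rightarrow> real"
  where "norm_ell2 \<xi> = sqrt (inner \<xi> \<xi>)"
definition dist_ell2 :: "('a, 'b) ell2 \<Rightarrow> ('a, 'b) ell2 \<Rightarrow> real"
  where "dist_ell2 \<xi> \<eta> = norm (\<xi> - \<eta>)"
definition sgn_ell2 :: "('a, 'b) ell2 \<Rightarrow> ('a, 'b) ell2"
  where "sgn_ell2 \<xi> = inverse (norm \<xi>) *\<^sub>R \<xi>"
definition uniformity_ell2 :: "(('a, 'b) ell2 \<times> ('a, 'b) ell2) filter"
  where "uniformity_ell2 = (INF e\<in>{0 <..}. principal {(x, y). dist x y < e})"
definition open_ell2 :: "('a, 'b) ell2 set \<Rightarrow> bool"
  where "open_ell2 U = (\<forall>x\<in>U. \<forall>\<^sub>F (x', y) in uniformity. x' = x \<longrightarrow> y \<in> U)"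

lemma ell2_norm_has_sum:
  "((\<lambda>t. (norm (Rep_ell2 \<xi> t))\<^sup>2) has_sum inner \<xi> \<xi>) UNIV" for \<xi> :: "('a, 'b) ell2"
  unfolding inner_ell2.rep_eq power2_norm_eq_inner[symmetric]
  using Rep_ell2[of \<xi>] by (intro has_sum_infsum) simp

lemma ell2_inner_nonneg: "0 \<le> inner \<xi> \<xi>" for \<xi> :: "('a, 'b) ell2"
  by (rule has_sum_nonneg[OF ell2_norm_has_sum]) simp

lemma ell2_norm_power2: "((\<lambda>t. (norm (Rep_ell2 \<xi> t))\<^sup>2) has_sum (norm \<xi>)\<^sup>2) UNIV"
  for \<xi> :: "('a, 'b) ell2"
  using ell2_norm_has_sum[of \<xi>] by (simp add: norm_ell2_def ell2_inner_nonneg)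

lemma ell2_sum_le: "finite F \<Longrightarrow> (\<Sum>t\<in>F. (norm (Rep_ell2 \<xi> t))\<^sup>2) \<le> (norm \<xi>)\<^sup>2"
  for \<xi> :: "('a, 'b) ell2"
  by (rule has_sum_mono2[OF has_sum_finite ell2_norm_power2]) auto

lemma ell2_norm_bound:
  fixes \<xi> :: "('a, 'b) ell2"
  assumes "0 \<le> b" "\<And>F. finite F \<Longrightarrow> (\<Sum>t\<in>F. (norm (Rep_ell2 \<xi> t))\<^sup>2) \<le> b\<^sup>2"
  shows "norm \<xi> \<le> b"
proof -
  have "(norm \<xi>)\<^sup>2 \<le> b\<^sup>2"
    using ell2_norm_power2[of \<xi>, unfolded has_sum_def] 
    by (rule tendsto_upperbound)
      (auto intro!: eventually_finite_subsets_at_top_weakI assms(2))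
  thus ?thesis using assms(1) by (rule power2_le_imp_le)
qed

instance
proof
  fix x y z :: "('a, 'b) ell2" and r s :: real and c d :: complex
  show "x + y + z = x + (y + z)" by transfer (simp add: add.assoc)
  show "x + y = y + x" by transfer (simp add: add.commute)
  show "0 + x = x" by transfer simp
  show "- x + x = 0" by transfer simp
  show "x - y = x + - y" by transfer simp
  show "r *\<^sub>R (x + y) = r *\<^sub>R x + r *\<^sub>R y" by transfer (simp add: scaleR_right_distrib)
  show "(r + s) *\<^sub>R x = r *\<^sub>R x + s *\<^sub>R x" by transfer (simp add: scaleR_left_distrib)
  show "r *\<^sub>R s *\<^sub>R x = (r * s) *\<^sub>R x" by transfer simp
  show "1 *\<^sub>R x = x" by transfer simp
  show "c *\<^sub>C (x + y) = c *\<^sub>C x + c *\<^sub>C y" by transfer (simp add: scaleC_add_right)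
  show "(c + d) *\<^sub>C x = c *\<^sub>C x + d *\<^sub>C x" by transfer (simp add: scaleC_add_left)
  show "c *\<^sub>C d *\<^sub>C x = (c * d) *\<^sub>C x" by transfer (simp add: scaleC_scaleC)
  show "r *\<^sub>R x = complex_of_real r *\<^sub>C x" by transfer (simp add: scaleR_scaleC)
  show "dist x y = norm (x - y)" by (rule dist_ell2_def)
  show "sgn x = inverse (norm x) *\<^sub>R x" by (rule sgn_ell2_def)
  show "uniformity = (INF e\<in>{0 <..}. principal {(x :: ('a, 'b) ell2, y). dist x y < e})"
    by (rule uniformity_ell2_def)
  show "open U = (\<forall>x\<in>U. \<forall>\<^sub>F (x', y) in uniformity. x' = x \<longrightarrow> y \<in> U)"
    for U :: "('a, 'b) ell2 set"
    by (rule open_ell2_def)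
  note sums = has_sum_imp_summable[OF ell2_inner_has_sum]
  show "inner x y = inner y x" by transfer (simp add: inner_commute)
  show "inner (x + y) z = inner x z + inner y z"
    by transfer (simp add: inner_add_left infsum_add sums)
  show "inner (r *\<^sub>R x) y = r * inner x y"
    by transfer (simp add: infsum_cmult_right')
  show "0 \<le> inner x x" by (rule ell2_inner_nonneg)
  show "norm x = sqrt (inner x x)" by (rule norm_ell2_def)
  show "(inner x x = 0) = (x = 0)"
  proof
    assume 0: "inner x x = 0"
    have "Rep_ell2 x t = 0" for t
      using ell2_sum_le[of "{t}" x] 0 by (simp add: norm_ell2_def)
    thus "x = 0" by (intro Rep_ell2_inject[THEN iffD1] ext) (simp add: zero_ell2.rep_eq)
  next
    assume "x = 0"
    thus "inner x x = 0" by simp (transfer, simp)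
  qed
qed

end

instantiation ell2 :: (type, complex_hilbert_space) complex_hilbert_space
begin

lift_definition cinner_ell2 :: "('a, 'b) ell2 \<Rightarrow> ('a, 'b) ell2 \<Rightarrow> complex"
  is "\<lambda>\<xi> \<eta>. \<Sum>\<^sub>\<infinity>t. cinner (\<xi> t) (\<eta> t)" .

instance
proof
  fix x y z :: "('a, 'b) ell2" and c :: complex
  show "cinner x y = cnj (cinner y x)"
    by transfer (subst cinner_commute, simp)
  show "cinner x (y + z) = cinner x y + cinner x z"
    by transfer (simp add: cinner_add_right infsum_add ell2_cinner_summable)
  show "cinner x (c *\<^sub>C y) = c * cinner x y"
    by transfer (simp add: cinner_scaleC_right infsum_cmult_right')
  show "inner x y = Re (cinner x y)"
    by transfer (rule infsumI, rule ell2_inner_has_sum)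
  obtain v :: 'b where v: "v \<noteq> 0" using nonzero_space by blast
  define f :: "'a \<Rightarrow> 'b" where "f = (\<lambda>t. if t = undefined then v else 0)"
  have "(\<lambda>t. (norm (f t))\<^sup>2) summable_on UNIV"
    using summable_on_cong_neutral[of UNIV "{undefined}" "\<lambda>t. (norm (f t))\<^sup>2" "\<lambda>t. (norm (f t))\<^sup>2"]
    by (simp add: f_def)
  hence R: "Rep_ell2 (Abs_ell2 f) = f" by (intro Abs_ell2_inverse) simp
  have "Abs_ell2 f \<noteq> 0"
  proof
    assume "Abs_ell2 f = 0"
    hence "f = (\<lambda>_. 0)" using R by (simp add: zero_ell2.rep_eq)
    hence "f undefined = 0" by (rule fun_cong)
    thus False using v by (simp add: f_def)
  qed
  thus "\<exists>x :: ('a, 'b) ell2. x \<noteq> 0" ..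
  show "convergent X" if X: "Cauchy X" for X :: "nat \<Rightarrow> ('a, 'b) ell2"
  proof -
    have le: "norm (Rep_ell2 x t) \<le> norm x" for x :: "('a, 'b) ell2" and t
      using ell2_sum_le[of "{t}" x] by (auto intro: power2_le_imp_le)
    have C: "\<exists>M. \<forall>m\<ge>M. \<forall>n\<ge>M. norm (X m - X n) < e" if "e > 0" for e
      using X that unfolding Cauchy_def dist_norm by blast
    have "Cauchy (\<lambda>n. Rep_ell2 (X n) t)" for t
    proof (rule CauchyI)
      fix e :: real assume "e > 0"
      from C[OF this] obtain M where "\<forall>m\<ge>M. \<forall>n\<ge>M. norm (X m - X n) < e" by blast
      thus "\<exists>M. \<forall>m\<ge>M. \<forall>n\<ge>M. norm (Rep_ell2 (X m) t - Rep_ell2 (X n) t) < e"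
        using le[of "X _ - X _" t, unfolded minus_ell2.rep_eq]
        by (intro exI[of _ M]) (blast intro: le_less_trans)
    qed
    hence "\<forall>t. \<exists>l. (\<lambda>n. Rep_ell2 (X n) t) \<longlonglongrightarrow> l" by (metis Cauchy_convergent convergent_def)
    then obtain l where l: "\<And>t. (\<lambda>n. Rep_ell2 (X n) t) \<longlonglongrightarrow> l t" by metis
    have fin: "(\<Sum>t\<in>F. (norm (Rep_ell2 (X m) t - l t))\<^sup>2) \<le> e\<^sup>2"
      if M: "\<forall>m\<ge>M. \<forall>n\<ge>M. norm (X m - X n) < e" and "m \<ge> M" "finite F" for M m e F
    proof (rule LIMSEQ_le_const2)
      show "(\<lambda>n. \<Sum>t\<in>F. (norm (Rep_ell2 (X m) t - Rep_ell2 (X n) t))\<^sup>2)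
        \<longlonglongrightarrow> (\<Sum>t\<in>F. (norm (Rep_ell2 (X m) t - l t))\<^sup>2)"
        by (intro tendsto_intros l)
      show "\<exists>N. \<forall>n\<ge>N. (\<Sum>t\<in>F. (norm (Rep_ell2 (X m) t - Rep_ell2 (X n) t))\<^sup>2) \<le> e\<^sup>2"
      proof (intro exI[of _ M] allI impI)
        fix n assume "n \<ge> M"
        hence "norm (X m - X n) < e" using M \<open>m \<ge> M\<close> by blast
        hence "(norm (X m - X n))\<^sup>2 \<le> e\<^sup>2" by (intro power_mono) auto
        with ell2_sum_le[OF \<open>finite F\<close>, of "X m - X n"]
        show "(\<Sum>t\<in>F. (norm (Rep_ell2 (X m) t - Rep_ell2 (X n) t))\<^sup>2) \<le> e\<^sup>2"
          by (simp add: minus_ell2.rep_eq)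
      qed
    qed
    obtain M where M: "\<forall>m\<ge>M. \<forall>n\<ge>M. norm (X m - X n) < 1" using C[of 1] by auto
    have "(\<lambda>t. (norm (Rep_ell2 (X M) t - l t))\<^sup>2) summable_on UNIV"
      using fin[OF M order.refl] by (intro nonneg_bdd_above_summable_on bdd_aboveI2[of _ _ "1\<^sup>2"]) auto
    from ell2_add_closed[OF Rep_ell2[of "X M", simplified], of "\<lambda>t. - (Rep_ell2 (X M) t - l t)"] this
    have "(\<lambda>t. (norm (l t))\<^sup>2) summable_on UNIV" by (simp add: norm_minus_commute)
    hence R: "Rep_ell2 (Abs_ell2 l) = l" by (intro Abs_ell2_inverse) simp
    show ?thesis
    proof (rule convergentI[of _ "Abs_ell2 l"], unfold tendsto_iff, intro allI impI)
      fix e :: real assume e: "e > 0"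
      obtain M where M: "\<forall>m\<ge>M. \<forall>n\<ge>M. norm (X m - X n) < e / 2" using C[of "e / 2"] e by auto
      have "dist (X m) (Abs_ell2 l) < e" if "m \<ge> M" for m
      proof -
        have "norm (X m - Abs_ell2 l) \<le> e / 2"
          by (rule ell2_norm_bound) (use e fin[OF M that] in \<open>auto simp: minus_ell2.rep_eq R\<close>)
        thus ?thesis using e by (simp add: dist_norm)
      qed
      thus "\<forall>\<^sub>F m in sequentially. dist (X m) (Abs_ell2 l) < e"
        using eventually_sequentially by blast
    qed
  qed
qed

end

section \<open>\<open>C\<^sup>*\<close>-subalgebras, homomorphisms and actions\<close>

definition cstar_subalgebra :: "'a::cstar_algebra set \<Rightarrow> bool"
  where "cstar_subalgebra S \<longleftrightarrow> 0 \<in> S \<and> (\<forall>x\<in>S. \<forall>y\<in>S. x + y \<in> S \<and> x * y \<in> S) \<and>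
    (\<forall>x\<in>S. star x \<in> S \<and> (\<forall>c. c *\<^sub>C x \<in> S)) \<and> closed S"

definition star_hom :: "('a::cstar_algebra \<Rightarrow> 'b::cstar_algebra) \<Rightarrow> bool"
  where "star_hom \<phi> \<longleftrightarrow> (\<forall>x y. \<phi> (x + y) = \<phi> x + \<phi> y \<and> \<phi> (x * y) = \<phi> x * \<phi> y) \<and>
    (\<forall>c x. \<phi> (c *\<^sub>C x) = c *\<^sub>C \<phi> x) \<and> (\<forall>x. \<phi> (star x) = star (\<phi> x))"

definition faithful_rep :: "('a::cstar_algebra \<Rightarrow> 'h::complex_hilbert_space bop) \<Rightarrow> bool"
  where "faithful_rep \<rho> \<longleftrightarrow> star_hom \<rho> \<and> \<rho> 1 = 1 \<and> inj \<rho>"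

text \<open>Groups are types of class \<^class>\<open>group_add\<close>. The group law is written additively but is
  not assumed to be commutative: \<open>0\<close> is the neutral element, \<open>- s\<close> the inverse of \<open>s\<close>.\<close>

definition cstar_action :: "('g::group_add \<Rightarrow> 'a::cstar_algebra \<Rightarrow> 'a) \<Rightarrow> bool"
  where "cstar_action \<alpha> \<longleftrightarrow> (\<forall>s. star_hom (\<alpha> s) \<and> bij (\<alpha> s)) \<and>
    \<alpha> 0 = id \<and> (\<forall>s t. \<alpha> (s + t) = \<alpha> s \<circ> \<alpha> t)"

definition action_kernel :: "('g::group_add \<Rightarrow> 'a::cstar_algebra \<Rightarrow> 'a) \<Rightarrow> 'g set"
  where "action_kernel \<alpha> = {s. \<alpha> s = id}"

definition subgroup_add :: "'g::group_add set \<Rightarrow> bool"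
  where "subgroup_add \<Lambda> \<longleftrightarrow> 0 \<in> \<Lambda> \<and> (\<forall>s\<in>\<Lambda>. \<forall>t\<in>\<Lambda>. s + t \<in> \<Lambda>) \<and> (\<forall>s\<in>\<Lambda>. - s \<in> \<Lambda>)"

section \<open>Reduced crossed products\<close>

text \<open>\<open>(\<lambda>\<^sub>s \<xi>)(t) = \<xi>(s\<inverse> t)\<close> on \<open>\<ell>\<^sup>2(\<Gamma>, H)\<close>. For \<open>H = \<complex>\<close> this is the left regular
  representation.\<close>

lift_definition translate_ell2 ::
    "'g::group_add \<Rightarrow> ('g, 'h::complex_hilbert_space) ell2 \<Rightarrow> ('g, 'h) ell2"
  is "\<lambda>s \<xi> t. \<xi> (- s + t)"
  by (subst summable_on_reindex_bij_betw[where B = UNIV])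
    (auto intro!: bij_betwI[where g = "(+) _"] simp: add.assoc[symmetric])

definition regular_unitary :: "'g::group_add \<Rightarrow> ('g, 'h::complex_hilbert_space) ell2 bop"
  where "regular_unitary s = Bop (translate_ell2 s)"

lemma Rep_regular_unitary: "Rep_ell2 (regular_unitary s \<bullet>\<^sub>O \<xi>) t = Rep_ell2 \<xi> (- s + t)"
proof -
  have "regular_unitary s \<bullet>\<^sub>O \<xi> = translate_ell2 s \<xi>"
    unfolding regular_unitary_def
  proof (rule bop_apply_Bop, rule bounded_linear_intro[where K = 1])
    fix \<xi> :: "('b, 'a) ell2"
    have b: "bij ((+) (- s))"
      by (intro bij_betwI[where g = "(+) s"]) (auto simp: add.assoc[symmetric])
    have "inner (translate_ell2 s \<xi>) (translate_ell2 s \<xi>) = inner \<xi> \<xi>"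
      using infsum_reindex_bij_betw[OF b, of "\<lambda>t. inner (Rep_ell2 \<xi> t) (Rep_ell2 \<xi> t)"]
      by (simp add: inner_ell2.rep_eq translate_ell2.rep_eq)
    thus "norm (translate_ell2 s \<xi>) \<le> norm \<xi> * 1" by (simp add: norm_eq_sqrt_inner)
  qed (transfer, simp)+
  thus ?thesis by (simp add: translate_ell2.rep_eq)
qed

text \<open>\<open>(\<pi>(a) \<xi>)(t) = \<rho>(\<alpha>\<^bsub>t\<inverse>\<^esub>(a)) \<xi>(t)\<close>, where \<open>\<rho>\<close> is a faithful representation of the
  \<open>C\<^sup>*\<close>-algebra. The boundedness hypothesis of the lemma below always holds in this situation
  because \<open>*\<close>-homomorphisms are contractive.\<close>

definition covariant_rep :: "('a::cstar_algebra \<Rightarrow> 'h::complex_hilbert_space bop) \<Rightarrow>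
    ('g::group_add \<Rightarrow> 'a \<Rightarrow> 'a) \<Rightarrow> 'a \<Rightarrow> ('g, 'h) ell2 bop"
  where "covariant_rep \<rho> \<alpha> a = Bop (\<lambda>\<xi>. Abs_ell2 (\<lambda>t. \<rho> (\<alpha> (- t) a) \<bullet>\<^sub>O Rep_ell2 \<xi> t))"

lemma Rep_covariant_rep:
  fixes \<rho> :: "'a::cstar_algebra \<Rightarrow> 'h::complex_hilbert_space bop"
  assumes K: "\<And>t. norm (\<rho> (\<alpha> (- t) a)) \<le> K"
  shows "Rep_ell2 (covariant_rep \<rho> \<alpha> a \<bullet>\<^sub>O \<xi>) t = \<rho> (\<alpha> (- t) a) \<bullet>\<^sub>O Rep_ell2 \<xi> t"
proof -
  define f where "f \<xi> = Abs_ell2 (\<lambda>t. \<rho> (\<alpha> (- t) a) \<bullet>\<^sub>O Rep_ell2 \<xi> t)" for \<xi> :: "(_, 'h) ell2"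
  have "0 \<le> norm (\<rho> (\<alpha> (- 0) a))" by simp
  hence K0: "0 \<le> K" using K order_trans by blast
  have pt: "(norm (\<rho> (\<alpha> (- t) a) \<bullet>\<^sub>O Rep_ell2 \<xi> t))\<^sup>2 \<le> K\<^sup>2 * (norm (Rep_ell2 \<xi> t))\<^sup>2" for \<xi> t
  proof -
    have "norm (\<rho> (\<alpha> (- t) a) \<bullet>\<^sub>O Rep_ell2 \<xi> t) \<le> K * norm (Rep_ell2 \<xi> t)"
      using norm_bop_apply mult_right_mono[OF K norm_ge_zero] by (rule order_trans)
    from power_mono[OF this norm_ge_zero, of 2] show ?thesis by (simp add: power_mult_distrib)
  qed
  have R: "Rep_ell2 (f \<xi>) t = \<rho> (\<alpha> (- t) a) \<bullet>\<^sub>O Rep_ell2 \<xi> t" for \<xi> t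
  proof -
    have "(\<lambda>t. (norm (\<rho> (\<alpha> (- t) a) \<bullet>\<^sub>O Rep_ell2 \<xi> t))\<^sup>2) summable_on UNIV"
      by (rule summable_on_comparison_test[OF summable_on_cmult_right pt])
        (use Rep_ell2[of \<xi>] in auto)
    thus ?thesis unfolding f_def by (subst Abs_ell2_inverse) auto
  qed
  have "Bop f \<bullet>\<^sub>O \<xi> = f \<xi>"
  proof (rule bop_apply_Bop, rule bounded_linear_intro[where K = K])
    note inj = Rep_ell2_inject[THEN iffD1, OF ext]
    have ap: "T \<bullet>\<^sub>O (x + y) = T \<bullet>\<^sub>O x + T \<bullet>\<^sub>O y" "T \<bullet>\<^sub>O (r *\<^sub>R x) = r *\<^sub>R (T \<bullet>\<^sub>O x)"
      for T :: "'h bop" and x y r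
      by (simp_all add: linear_simps[OF bounded_linear_bop_apply])
    show "f (x + y) = f x + f y" for x y by (rule inj) (simp add: R plus_ell2.rep_eq ap)
    show "f (r *\<^sub>R x) = r *\<^sub>R f x" for r x by (rule inj) (simp add: R scaleR_ell2.rep_eq ap)
    show "f (c *\<^sub>C x) = c *\<^sub>C f x" for c x
      by (rule inj) (simp add: R scaleC_ell2.rep_eq bop_apply_scaleC)
    show "norm (f x) \<le> norm x * K" for x
    proof (rule ell2_norm_bound)
      fix F :: "'b set" assume F: "finite F"
      have "(\<Sum>t\<in>F. (norm (Rep_ell2 (f x) t))\<^sup>2) \<le> K\<^sup>2 * (\<Sum>t\<in>F. (norm (Rep_ell2 x t))\<^sup>2)"
        unfolding sum_distrib_left R by (intro sum_mono pt)
      also have "\<dots> \<le> K\<^sup>2 * (norm x)\<^sup>2" by (intro mult_left_mono ell2_sum_le F) simp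
      finally show "(\<Sum>t\<in>F. (norm (Rep_ell2 (f x) t))\<^sup>2) \<le> (norm x * K)\<^sup>2"
        by (simp add: power_mult_distrib mult.commute)
    qed (use K0 in simp)
  qed
  thus ?thesis using R unfolding covariant_rep_def f_def by simp
qed

text \<open>\<open>A\<^sub>1 \<rtimes>\<^sub>r \<Gamma>\<close> for an invariant unital subalgebra \<open>A\<^sub>1\<close> of \<open>A\<close>, as a subalgebra of
  \<open>A \<rtimes>\<^sub>r \<Gamma>\<close>. The whole crossed product is the case \<open>A\<^sub>1 = UNIV\<close>.\<close>

definition reduced_crossed_product :: "('a::cstar_algebra \<Rightarrow> 'h::complex_hilbert_space bop) \<Rightarrow>
    ('g::group_add \<Rightarrow> 'a \<Rightarrow> 'a) \<Rightarrow> 'a set \<Rightarrow> ('g, 'h) ell2 bop set"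
  where "reduced_crossed_product \<rho> \<alpha> A\<^sub>1 =
    cstar_subalgebra hull (covariant_rep \<rho> \<alpha> ` A\<^sub>1 \<union> range regular_unitary)"

text \<open>For \<open>H = \<complex>\<close> this is the usual reduced group algebra; for general \<open>H\<close> it is its copy in
  a crossed product.\<close>

definition reduced_group_algebra :: "('g::group_add, 'h::complex_hilbert_space) ell2 bop set"
  where "reduced_group_algebra = cstar_subalgebra hull range regular_unitary"

section \<open>Plump subgroups\<close>

definition plump :: "'g::group_add set \<Rightarrow> bool"
  where "plump \<Lambda> \<longleftrightarrow> subgroup_add \<Lambda> \<and> \<Lambda> \<noteq> {0} \<and>
    (\<forall>\<epsilon>>0. \<forall>F. finite F \<and> 0 \<notin> F \<longrightarrow> (\<exists>ss. ss \<noteq> [] \<and> set ss \<subseteq> \<Lambda> \<and>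
      (\<forall>t\<in>F. norm ((1 / real (length ss)) *\<^sub>R (\<Sum>s\<leftarrow>ss.
        regular_unitary s * regular_unitary t * regular_unitary (- s) :: ('g, complex) ell2 bop))
        < \<epsilon>)))"

section \<open>Completely bounded multipliers and the approximation property\<close>

text \<open>The norm of a matrix in \<open>M\<^sub>n(B(H)) = B(H\<^sup>n)\<close>.\<close>

definition matrix_norm :: "nat \<Rightarrow> (nat \<Rightarrow> nat \<Rightarrow> 'h::complex_hilbert_space bop) \<Rightarrow> real"
  where "matrix_norm n T = (SUP x\<in>{x :: nat \<Rightarrow> 'h. (\<Sum>j<n. (norm (x j))\<^sup>2) \<le> 1}.
    sqrt (\<Sum>i<n. (norm (\<Sum>j<n. T i j \<bullet>\<^sub>O x j))\<^sup>2))"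

text \<open>\<open>\<Phi>\<close> is linear on the subspace \<open>S\<close> of \<open>B(H)\<close> and completely bounded there, with
  \<open>\<parallel>\<Phi>\<parallel>\<^bsub>cb\<^esub> \<le> C\<close>.\<close>

definition cb_bounded_on ::
    "'h::complex_hilbert_space bop set \<Rightarrow> ('h bop \<Rightarrow> 'h bop) \<Rightarrow> real \<Rightarrow> bool"
  where "cb_bounded_on S \<Phi> C \<longleftrightarrow>
    (\<forall>x\<in>S. (\<forall>y\<in>S. \<Phi> (x + y) = \<Phi> x + \<Phi> y) \<and> (\<forall>c. \<Phi> (c *\<^sub>C x) = c *\<^sub>C \<Phi> x)) \<and> 0 \<le> C \<and>
    (\<forall>n T. (\<forall>i<n. \<forall>j<n. T i j \<in> S) \<longrightarrow>
      matrix_norm n (\<lambda>i j. \<Phi> (T i j)) \<le> C * matrix_norm n T)"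

text \<open>\<open>u\<close> is a completely bounded multiplier if \<open>\<lambda>\<^sub>s \<mapsto> u(s) \<lambda>\<^sub>s\<close> extends to a completely bounded map
  on the reduced group algebra; its multiplier norm is the completely bounded norm of that map.\<close>

definition cb_multiplier_bound :: "('g::group_add \<Rightarrow> complex) \<Rightarrow> real \<Rightarrow> bool"
  where "cb_multiplier_bound u C \<longleftrightarrow>
    (\<exists>\<Phi> :: ('g, complex) ell2 bop \<Rightarrow> ('g, complex) ell2 bop.
      (\<forall>s. \<Phi> (regular_unitary s) = u s *\<^sub>C regular_unitary s) \<and>
      cb_bounded_on reduced_group_algebra \<Phi> C)"

definition M0A :: "('g::group_add \<Rightarrow> complex) set"
  where "M0A = {u. \<exists>C. cb_multiplier_bound u C}"

definition norm_M0A :: "('g::group_add \<Rightarrow> complex) \<Rightarrow> real"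
  where "norm_M0A u = Inf {C. cb_multiplier_bound u C}"

definition ell1 :: "('g \<Rightarrow> complex) set"
  where "ell1 = {f. (\<lambda>s. norm (f s)) summable_on UNIV}"

definition pairing :: "('g \<Rightarrow> complex) \<Rightarrow> ('g \<Rightarrow> complex) \<Rightarrow> complex"
  where "pairing f u = (\<Sum>\<^sub>\<infinity>s. f s * u s)"

definition predual_norm :: "('g::group_add \<Rightarrow> complex) \<Rightarrow> real"
  where "predual_norm f = (SUP u\<in>{u \<in> M0A. norm_M0A u \<le> 1}. norm (pairing f u))"

text \<open>The completion of \<open>\<ell>\<^sup>1\<close> in the norm \<^const>\<open>predual_norm\<close>. Its elements are represented by
  the functionals that they define on \<^const>\<open>M0A\<close> (only the values there matter): the limits of
  the functionals of a Cauchy sequence in \<open>\<ell>\<^sup>1\<close>.\<close>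

definition M0A_predual :: "(('g::group_add \<Rightarrow> complex) \<Rightarrow> complex) set"
  where "M0A_predual = {q. \<exists>f :: nat \<Rightarrow> 'g \<Rightarrow> complex. (\<forall>n. f n \<in> ell1) \<and>
    (\<forall>\<epsilon>>0. \<exists>N. \<forall>m\<ge>N. \<forall>n\<ge>N. predual_norm (\<lambda>s. f m s - f n s) < \<epsilon>) \<and>
    (\<forall>u\<in>M0A. (\<lambda>n. pairing (f n) u) \<longlonglongrightarrow> q u)}"

definition M0A_weak_star :: "('g::group_add \<Rightarrow> complex) topology"
  where "M0A_weak_star = topology_generated_by
    {{u \<in> M0A. q u \<in> U} | q U. q \<in> M0A_predual \<and> open U}"

text \<open>Nets are rendered by proper filters.\<close>

definition approximation_property :: "'g::group_add itself \<Rightarrow> bool"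
  where "approximation_property _ \<longleftrightarrow> (\<exists>F :: ('g \<Rightarrow> complex) filter. F \<noteq> bot \<and>
    (\<forall>\<^sub>F u in F. finite {s. u s \<noteq> 0}) \<and> limitin M0A_weak_star (\<lambda>u. u) (\<lambda>_. 1) F)"

end

theory Submission
  imports Defs
begin

text \<open>Write \<open>\<lambda>\<^sub>s\<close> for the canonical unitaries, \<open>\<pi>\<close> for the embedding of \<open>A\<close> into the crossed product, and
  \<open>a\<^sub>s\<close> for the Fourier coefficients of an element \<open>b\<close>, which formally is \<open>\<Sum>\<^sub>s \<pi>(a\<^sub>s) \<lambda>\<^sub>s\<close>. The comments
  write the group multiplicatively. For an
  intermediate algebra \<open>B\<close> the only candidate is \<open>A\<^sub>1 = {a. \<pi>(a) \<in> B}\<close>. It is an invariant unital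
  \<open>C\<^sup>*\<close>-subalgebra and \<open>A\<^sub>1 \<rtimes>\<^sub>r \<Gamma> \<subseteq> B\<close>. The reverse inclusion needs two facts.

  All Fourier coefficients of an element \<open>b\<close> of \<open>B\<close> lie in \<open>A\<^sub>1\<close>. Since \<open>\<Lambda>\<close> acts trivially, its unitaries
  commute with \<open>\<pi>(A)\<close>, so averaging \<open>\<pi>(a) \<lambda>\<^sub>t\<close> over conjugations by elements of \<open>\<Lambda>\<close> only averages
  \<open>\<lambda>\<^sub>t\<close>; by plumpness this can be made small for finitely many \<open>t \<noteq> e\<close> simultaneously. Applied to
  \<open>b \<lambda>\<^sub>s\<^sup>*\<close>, the averages stay in \<open>B\<close> and approach \<open>\<pi>(a\<^sub>s)\<close>. Plumpness speaks about
  \<open>\<ell>\<^sup>2(\<Gamma>)\<close>, and \<open>scalar_matrix_amplification\<close> carries the estimate over to \<open>\<ell>\<^sup>2(\<Gamma>, H)\<close>. This is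
  \<open>fourier_coeff_in_subalgebra\<close>.

  The element \<open>b\<close> lies in every \<open>C\<^sup>*\<close>-subalgebra \<open>R\<close> that contains all the monomials \<open>\<pi>(a\<^sub>s) \<lambda>\<^sub>s\<close>. Otherwise a
  bounded functional \<open>\<phi>\<close> vanishes on \<open>R\<close> but not at \<open>b\<close> (\<open>complex_functional_separation\<close>). A
  multiplier \<open>u\<close> acts on the crossed product by \<open>\<Sum> \<pi>(a\<^sub>s) \<lambda>\<^sub>s \<mapsto> \<Sum> u(s) \<pi>(a\<^sub>s) \<lambda>\<^sub>s\<close> with norm at most its
  multiplier norm (\<open>norm_multiplier_le\<close>), hence \<open>u \<mapsto> \<phi>(u \<cdot> b)\<close> belongs to the predual of the space of
  multipliers (\<open>slice_in_predual\<close>). It vanishes at every finitely supported \<open>u\<close>, because then \<open>u \<cdot> b\<close>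
  is a finite sum of elements of \<open>R\<close>, so by the approximation property it vanishes at the constant
  \<open>1\<close>; but there its value is \<open>\<phi>(b)\<close>. This is \<open>fourier_synthesis\<close>.

  That the coefficients exist in \<open>A\<close> itself rests on the fact that faithful representations are
  isometric, which is derived from a polynomial functional calculus for selfadjoint elements.\<close>

section \<open>Separating a point from a closed subspace\<close>

definition sublinear :: "('a::real_vector \<Rightarrow> real) \<Rightarrow> bool"
  where "sublinear p \<longleftrightarrow> (\<forall>x y. p (x + y) \<le> p x + p y) \<and> (\<forall>t\<ge>0. \<forall>x. p (t *\<^sub>R x) = t * p x)"

lemma sublinearI:
  assumes add: "\<And>x y. p (x + y) \<le> p x + p y" and zero: "p 0 = 0"
    and scale: "\<And>t x. 0 < t \<Longrightarrow> p (t *\<^sub>R x) \<le> t * p x"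
  shows "sublinear p"
proof -
  have "p (t *\<^sub>R x) = t * p x" if t: "0 \<le> t" for t x
  proof (cases "t = 0")
    case False
    hence t: "0 < t" using t by simp
    have "p ((1 / t) *\<^sub>R t *\<^sub>R x) \<le> (1 / t) * p (t *\<^sub>R x)" using t by (intro scale) simp
    hence "t * p x \<le> p (t *\<^sub>R x)" using t by (simp add: field_simps)
    with scale[OF t, of x] show ?thesis by simp
  qed (simp add: zero)
  thus ?thesis using add by (auto simp: sublinear_def)
qed

lemma sublinear_zero: "sublinear p \<Longrightarrow> p 0 = 0"
  unfolding sublinear_def using scaleR_zero_left[of 0] by (metis mult_zero_left order_refl)

lemma sublinear_lower_bound: "sublinear p \<Longrightarrow> - p (- x) \<le> p x"
  using sublinear_zero[of p] unfolding sublinear_def by (smt (verit) add.right_inverse)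

text \<open>The inequality \<open>q (- b) \<le> - p b\<close> together with \<open>q b \<le> p b\<close> forces any linear functional
  below \<open>q\<close> to take the value \<open>p b\<close> at \<open>b\<close>. In particular a minimal sublinear functional cannot be
  shrunk this way, hence is odd.\<close>

lemma sublinear_shrink:
  assumes p: "sublinear p"
  shows "\<exists>q. sublinear q \<and> q \<le> p \<and> q (- b) \<le> - p b"
proof -
  have add: "p (x + y) \<le> p x + p y" and hom: "0 \<le> t \<Longrightarrow> p (t *\<^sub>R x) = t * p x" for x y t
    using p by (auto simp: sublinear_def)
  define q where "q x = (INF t\<in>{0..}. p (x + t *\<^sub>R b) - t * p b)" for x
  have lb: "- p (- x) \<le> p (x + t *\<^sub>R b) - t * p b" if "0 \<le> t" for x t
    using add[of "x + t *\<^sub>R b" "- x"] hom[OF that, of b] by simp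
  have q_le: "q x \<le> p (x + t *\<^sub>R b) - t * p b" if "0 \<le> t" for x t
    unfolding q_def using that lb by (intro cINF_lower) (auto intro!: bdd_belowI2)
  have le_q: "c \<le> q x" if "\<And>t. 0 \<le> t \<Longrightarrow> c \<le> p (x + t *\<^sub>R b) - t * p b" for c x
    unfolding q_def using that by (intro cINF_greatest) auto
  have "q (x + y) \<le> q x + q y" for x y
  proof -
    have "q (x + y) - (p (y + s *\<^sub>R b) - s * p b) \<le> q x" if s: "0 \<le> s" for s
    proof (rule le_q)
      fix t :: real assume t: "0 \<le> t"
      have "q (x + y) \<le> p ((x + t *\<^sub>R b) + (y + s *\<^sub>R b)) - (t + s) * p b"
        using q_le[of "t + s" "x + y"] s t by (simp add: algebra_simps)
      also have "\<dots> \<le> p (x + t *\<^sub>R b) + p (y + s *\<^sub>R b) - (t + s) * p b"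
        using add by simp
      finally show "q (x + y) - (p (y + s *\<^sub>R b) - s * p b) \<le> p (x + t *\<^sub>R b) - t * p b"
        by (simp add: algebra_simps)
    qed
    hence "q (x + y) - q x \<le> q y" by (intro le_q) (simp add: algebra_simps)
    thus ?thesis by simp
  qed
  moreover have "q 0 = 0"
    using q_le[of 0 0] sublinear_zero[OF p] by (intro antisym le_q) (auto simp: hom)
  moreover have "q (t *\<^sub>R x) \<le> t * q x" if t: "0 < t" for t x
  proof -
    have "q (t *\<^sub>R x) / t \<le> q x"
    proof (rule le_q)
      fix s :: real assume s: "0 \<le> s"
      have "q (t *\<^sub>R x) \<le> p (t *\<^sub>R (x + s *\<^sub>R b)) - t * s * p b"
        using q_le[of "t * s" "t *\<^sub>R x"] s t by (simp add: scaleR_add_right)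
      also have "\<dots> = t * (p (x + s *\<^sub>R b) - s * p b)" using hom[of t "x + s *\<^sub>R b"] t by (simp only: right_diff_distrib mult.assoc)
      finally show "q (t *\<^sub>R x) / t \<le> p (x + s *\<^sub>R b) - s * p b"
        using t by (simp add: field_simps)
    qed
    thus ?thesis using t by (simp add: field_simps)
  qed
  ultimately have "sublinear q" by (rule sublinearI)
  moreover have "q \<le> p" using q_le[of 0] by (intro le_funI) simp
  moreover have "q (- b) \<le> - p b" using q_le[of 1 "- b"] sublinear_zero[OF p] by simp
  ultimately show ?thesis by blast
qed

text \<open>Zorn's lemma applies because a chain of sublinear functionals below \<open>p\<close> is bounded below
  pointwise by \<open>- p (- x)\<close>, and its pointwise infimum is again sublinear.\<close>

lemma minimal_sublinear_exists:
  fixes p :: "'a::real_vector \<Rightarrow> real"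
  assumes p: "sublinear p"
  shows "\<exists>m. sublinear m \<and> m \<le> p \<and> (\<forall>q. sublinear q \<longrightarrow> q \<le> m \<longrightarrow> q = m)"
proof -
  define A where "A = {q :: 'a \<Rightarrow> real. sublinear q \<and> q \<le> p}"
  have "\<exists>m\<in>A. \<forall>q\<in>A. q \<le> m \<longrightarrow> q = m"
  proof (rule predicate_Zorn)
    show "partial_order_on A (relation_of (\<lambda>x y. y \<le> x) A)"
      by (rule partial_order_on_relation_ofI) auto
    fix C assume "C \<in> Chains (relation_of (\<lambda>x y. y \<le> x) A)"
    hence CA: "C \<subseteq> A" and total: "\<And>q q'. q \<in> C \<Longrightarrow> q' \<in> C \<Longrightarrow> q \<le> q' \<or> q' \<le> q"
      by (auto simp: Chains_def relation_of_def)
    show "\<exists>u\<in>A. \<forall>q\<in>C. u \<le> q"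
    proof (cases "C = {}")
      case True
      thus ?thesis using p by (auto simp: A_def)
    next
      case False
      have sub: "sublinear q" and le: "q x \<le> p x" if "q \<in> C" for q x
        using that CA by (auto simp: A_def le_fun_def)
      define u where "u x = (INF q\<in>C. q x)" for x
      have lb: "- p (- x) \<le> q x" if "q \<in> C" for q x
        using sublinear_lower_bound[OF sub[OF that], of x] le[OF that, of "- x"] by simp
      have u_le: "u x \<le> q x" if "q \<in> C" for q x
        unfolding u_def using that lb by (intro cINF_lower) (auto intro!: bdd_belowI2)
      have le_u: "c \<le> u x" if "\<And>q. q \<in> C \<Longrightarrow> c \<le> q x" for c x
        unfolding u_def using that False by (intro cINF_greatest) auto
      have "u (x + y) \<le> u x + u y" for x y
      proof -
        have "u (x + y) \<le> q x + q' y" if qq: "q \<in> C" "q' \<in> C" for q q'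
        proof -
          obtain r where r: "r \<in> C" "r \<le> q" "r \<le> q'"
            using total[OF qq] qq by auto
          have "u (x + y) \<le> r (x + y)" by (rule u_le[OF r(1)])
          also have "\<dots> \<le> r x + r y" using sub[OF r(1)] by (simp add: sublinear_def)
          also have "\<dots> \<le> q x + q' y" using r by (intro add_mono) (auto simp: le_fun_def)
          finally show ?thesis .
        qed
        hence "u (x + y) - q' y \<le> u x" if "q' \<in> C" for q'
          using that by (intro le_u) (simp add: algebra_simps)
        hence "u (x + y) - u x \<le> u y" by (intro le_u) (simp add: algebra_simps)
        thus ?thesis by simp
      qed
      moreover have "u 0 = 0"
        using False u_le[of _ 0] by (intro antisym le_u) (auto simp: sublinear_zero[OF sub])
      moreover have "u (t *\<^sub>R x) \<le> t * u x" if t: "0 < t" for t x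
      proof -
        have "u (t *\<^sub>R x) / t \<le> u x"
        proof (rule le_u)
          fix q assume q: "q \<in> C"
          hence "u (t *\<^sub>R x) \<le> t * q x"
            using u_le[OF q, of "t *\<^sub>R x"] sub[OF q] t by (simp add: sublinear_def)
          thus "u (t *\<^sub>R x) / t \<le> q x" using t by (simp add: field_simps)
        qed
        thus ?thesis using t by (simp add: field_simps)
      qed
      ultimately have "sublinear u" by (rule sublinearI)
      moreover have "u \<le> p"
        using False u_le le by (intro le_funI) (meson all_not_in_conv order_trans)
      ultimately show ?thesis using u_le by (auto simp: A_def le_fun_def)
    qed
  qed
  then obtain m where "m \<in> A" and min: "\<And>q. q \<in> A \<Longrightarrow> q \<le> m \<Longrightarrow> q = m" by blast
  thus ?thesis unfolding A_def by (intro exI[of _ m]) (auto intro: order_trans)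
qed

text \<open>Shrinking \<open>p\<close> in the direction \<open>b\<close> fixes the value at \<open>b\<close>; a minimal sublinear functional
  below the result is odd, and odd sublinear functionals are linear.\<close>

lemma Hahn_Banach_sublinear:
  fixes p :: "'a::real_vector \<Rightarrow> real"
  assumes p: "sublinear p"
  shows "\<exists>f. linear f \<and> (\<forall>x. f x \<le> p x) \<and> f b = p b"
proof -
  obtain p' where p': "sublinear p'" "p' \<le> p" "p' (- b) \<le> - p b"
    using sublinear_shrink[OF p] by blast
  obtain f where f: "sublinear f" "f \<le> p'" and min: "\<And>q. sublinear q \<Longrightarrow> q \<le> f \<Longrightarrow> q = f"
    using minimal_sublinear_exists[OF p'(1)] by blast
  have odd: "f (- x) = - f x" for x
  proof (rule antisym)
    show "f (- x) \<le> - f x" using sublinear_shrink[OF f(1), of x] min by blast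
    show "- f x \<le> f (- x)" using sublinear_lower_bound[OF f(1), of "- x"] by simp
  qed
  have le: "f (x + y) \<le> f x + f y" and hom: "0 \<le> t \<Longrightarrow> f (t *\<^sub>R x) = t * f x" for x y t
    using f(1) by (auto simp: sublinear_def)
  have "linear f"
  proof (rule linearI)
    show "f (x + y) = f x + f y" for x y
      using le[of x y] le[of "x + y" "- y"] odd[of y] by simp
    show "f (t *\<^sub>R x) = t *\<^sub>R f x" for t x
    proof (cases "0 \<le> t")
      case False
      thus ?thesis using hom[of "- t" x] odd[of "t *\<^sub>R x"] by simp
    qed (simp add: hom)
  qed
  moreover have fp: "f x \<le> p x" for x using f(2) p'(2) by (metis le_funD order_trans)
  moreover have "f b = p b"
    using fp[of b] odd[of b] le_funD[OF f(2), of "- b"] p'(3) by simp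
  ultimately show ?thesis by blast
qed

lemma sublinear_infdist:
  fixes S :: "'a::real_normed_vector set"
  assumes S: "subspace S"
  shows "sublinear (\<lambda>x. infdist x S)"
proof (rule sublinearI)
  have ne: "S \<noteq> {}" using subspace_0[OF S] by blast
  have le_inf: "c \<le> infdist x S" if "\<And>s. s \<in> S \<Longrightarrow> c \<le> dist x s" for c x
    unfolding infdist_notempty[OF ne] using that ne by (intro cINF_greatest) auto
  show "infdist (x + y) S \<le> infdist x S + infdist y S" for x y
  proof -
    have "infdist (x + y) S \<le> dist x s + dist y s'" if "s \<in> S" "s' \<in> S" for s s'
    proof (rule infdist_le2)
      show "s + s' \<in> S" using that by (rule subspace_add[OF S])
      show "dist (x + y) (s + s') \<le> dist x s + dist y s'" by (rule dist_triangle_add)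
    qed
    hence "infdist (x + y) S - dist y s' \<le> infdist x S" if "s' \<in> S" for s'
      using that by (intro le_inf) (simp add: algebra_simps)
    hence "infdist (x + y) S - infdist x S \<le> infdist y S"
      by (intro le_inf) (simp add: algebra_simps)
    thus ?thesis by simp
  qed
  show "infdist 0 S = 0" using subspace_0[OF S] by simp
  show "infdist (t *\<^sub>R x) S \<le> t * infdist x S" if t: "0 < t" for t x
  proof -
    have "infdist (t *\<^sub>R x) S / t \<le> infdist x S"
    proof (rule le_inf)
      fix s assume s: "s \<in> S"
      have "infdist (t *\<^sub>R x) S \<le> dist (t *\<^sub>R x) (t *\<^sub>R s)"
        using s by (intro infdist_le subspace_scale[OF S])
      also have "\<dots> = t * dist x s"
        using t by (simp add: dist_norm flip: scaleR_right_diff_distrib)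
      finally show "infdist (t *\<^sub>R x) S / t \<le> dist x s" using t by (simp add: field_simps)
    qed
    thus ?thesis using t by (simp add: field_simps)
  qed
qed

text \<open>The distance to \<open>S\<close> is a sublinear functional that vanishes exactly on \<open>S\<close>. A real linear
  functional \<open>f\<close> below it is complexified as \<open>f x - \<i> f (\<i> x)\<close>.\<close>

lemma complex_functional_separation:
  fixes S :: "'a::cstar_algebra set"
  assumes S: "cstar_subalgebra S" and b: "b \<notin> S"
  obtains \<phi> K where "\<And>x y. \<phi> (x + y) = \<phi> x + \<phi> y" "\<And>c x. \<phi> (c *\<^sub>C x) = c * \<phi> x"
    "\<And>x. cmod (\<phi> x) \<le> K * norm x" "\<And>x. x \<in> S \<Longrightarrow> \<phi> x = 0" "\<phi> b \<noteq> 0"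
proof -
  have S0: "0 \<in> S" and SC: "\<And>c x. x \<in> S \<Longrightarrow> c *\<^sub>C x \<in> S" and clo: "closed S"
    using S by (auto simp: cstar_subalgebra_def)
  have "subspace S"
    using S by (auto simp: subspace_def cstar_subalgebra_def scaleR_scaleC)
  from Hahn_Banach_sublinear[OF sublinear_infdist[OF this], of b] obtain f where
    f: "linear f" "\<And>x. f x \<le> infdist x S" "f b = infdist b S" by blast
  interpret linear f by (rule f(1))
  have bound: "\<bar>f x\<bar> \<le> norm x" for x
    using f(2)[of x] f(2)[of "- x"] infdist_le[OF S0, of x] infdist_le[OF S0, of "- x"]
    by (simp add: neg)
  have f0: "f x = 0" if "x \<in> S" for x
    using f(2)[of x] f(2)[of "- x"] that SC[OF that, of "-1"] scaleR_scaleC[of "-1" x]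
    by (simp add: neg)
  have fb: "f b \<noteq> 0"
    using f(3) b in_closed_iff_infdist_zero[OF clo, of b] S0 by auto
  define \<phi> where "\<phi> x = Complex (f x) (- f (\<i> *\<^sub>C x))" for x
  have fC: "f (c *\<^sub>C x) = Re c * f x + Im c * f (\<i> *\<^sub>C x)" for c x
  proof -
    have "c *\<^sub>C x = Re c *\<^sub>R x + Im c *\<^sub>R \<i> *\<^sub>C x"
      unfolding scaleR_scaleC scaleC_scaleC scaleC_add_left[symmetric]
      by (metis complex_eq mult.commute)
    thus ?thesis by (simp add: add scale)
  qed
  have "\<phi> (x + y) = \<phi> x + \<phi> y" for x y
    by (simp add: \<phi>_def complex_eq_iff scaleC_add_right add)
  moreover have "\<phi> (c *\<^sub>C x) = c * \<phi> x" for c x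
    using fC[of c x] fC[of "\<i> * c" x] by (simp add: \<phi>_def complex_eq_iff scaleC_scaleC)
  moreover have "cmod (\<phi> x) \<le> 2 * norm x" for x
    using cmod_le[of "\<phi> x"] bound[of x] bound[of "\<i> *\<^sub>C x"] by (simp add: \<phi>_def norm_scaleC)
  moreover have "\<phi> x = 0" if "x \<in> S" for x
    using f0[OF that] f0[OF SC[OF that]] by (simp add: \<phi>_def complex_eq_iff)
  moreover have "\<phi> b \<noteq> 0" using fb by (simp add: \<phi>_def complex_eq_iff)
  ultimately show thesis by (rule that)
qed

section \<open>Contractivity and square roots in \<open>C\<^sup>*\<close>-algebras\<close>

lemma scaleC_zero_left [simp]: "0 *\<^sub>C x = (0::'a::complex_vector)"
  using scaleR_scaleC[of 0 x] by simp

lemma scaleC_minus_right: "c *\<^sub>C (- x) = - (c *\<^sub>C (x::'a::complex_vector))"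
  by (metis add.right_inverse minus_unique scaleC_add_right scaleC_zero_right)

lemma scaleC_minus_left: "(- c) *\<^sub>C x = - (c *\<^sub>C (x::'a::complex_vector))"
  using scaleC_add_left[of c "- c" x] by (simp add: eq_neg_iff_add_eq_0 add.commute)

lemma scaleC_diff_right: "c *\<^sub>C (x - y) = c *\<^sub>C x - c *\<^sub>C (y::'a::complex_vector)"
  using scaleC_add_right[of c x "- y"] by (simp add: scaleC_minus_right)

lemma scaleC_sum_right: "c *\<^sub>C (\<Sum>i\<in>I. f i) = (\<Sum>i\<in>I. c *\<^sub>C (f i :: 'a::complex_vector))"
  by (induction I rule: infinite_finite_induct) (auto simp: scaleC_add_right)

lemma norm_star [simp]: "norm (star x) = norm (x::'a::cstar_algebra)"
proof -
  have le: "norm y \<le> norm (star y)" for y :: 'a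
  proof (cases "y = 0")
    case False
    have "norm y * norm y \<le> norm (star y) * norm y"
      using norm_mult_ineq[of "star y" y] by (simp add: cstar_identity power2_eq_square)
    thus ?thesis using False by simp
  qed simp
  show ?thesis using le[of x] le[of "star x"] by (simp add: star_star)
qed

lemma bounded_linear_star: "bounded_linear (star :: 'a::cstar_algebra \<Rightarrow> 'a)"
  by (rule bounded_linear_intro[where K = 1])
    (auto simp: star_add scaleR_scaleC star_scaleC)

lemma star_scaleR: "star (r *\<^sub>R x) = r *\<^sub>R star (x::'a::cstar_algebra)"
  by (simp add: scaleR_scaleC star_scaleC)

lemma star_one [simp]: "star 1 = (1::'a::cstar_algebra)"
  by (metis mult.left_neutral mult.right_neutral star_mult star_star)

lemma star_power: "star (x ^ n) = star x ^ n" for x :: "'a::cstar_algebra"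
  by (induction n) (simp_all add: star_mult power_commutes)

lemma star_hom_simps:
  assumes "star_hom \<phi>"
  shows "\<phi> (x + y) = \<phi> x + \<phi> y" "\<phi> (x * y) = \<phi> x * \<phi> y" "\<phi> (c *\<^sub>C x) = c *\<^sub>C \<phi> x"
    "\<phi> (star x) = star (\<phi> x)" "\<phi> (r *\<^sub>R x) = r *\<^sub>R \<phi> x" "\<phi> 0 = 0" "\<phi> (x - y) = \<phi> x - \<phi> y"
proof -
  show 1: "\<phi> (x + y) = \<phi> x + \<phi> y" "\<phi> (x * y) = \<phi> x * \<phi> y" "\<phi> (c *\<^sub>C x) = c *\<^sub>C \<phi> x"
    "\<phi> (star x) = star (\<phi> x)" for x y c
    using assms by (auto simp: star_hom_def)
  show "\<phi> (r *\<^sub>R x) = r *\<^sub>R \<phi> x" by (simp add: scaleR_scaleC 1)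
  show "\<phi> 0 = 0" using 1(3)[of 0 0] by simp
  show "\<phi> (x - y) = \<phi> x - \<phi> y"
    using 1(1)[of "x - y" y] by (simp add: algebra_simps)
qed

lemma Neumann_left_inverse:
  fixes y :: "'a::{real_normed_algebra_1, banach}"
  assumes "norm y < 1"
  shows "\<exists>z. z * (1 - y) = 1"
proof -
  have s: "summable (\<lambda>n. y ^ n)" by (rule complete_algebra_summable_geometric[OF assms])
  have "(\<Sum>n. y ^ n) = 1 + (\<Sum>n. y ^ Suc n)"
    using suminf_split_head[OF s] by simp
  also have "(\<Sum>n. y ^ Suc n) = (\<Sum>n. y ^ n) * y"
    by (subst suminf_mult2[OF s]) (simp add: power_commutes)
  finally show ?thesis by (intro exI[of _ "\<Sum>n. y ^ n"]) (simp add: algebra_simps)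
qed

text \<open>If \<open>T = \<phi> x\<close> is selfadjoint with \<open>\<parallel>T\<parallel> = M > \<parallel>x\<parallel>\<close>, then \<open>M\<^sup>2 - x\<^sup>2\<close> is invertible by a Neumann
  series, hence so is \<open>M\<^sup>2 - T\<^sup>2\<close>. But unit vectors on which \<open>T\<close> nearly attains its norm are
  approximate eigenvectors of \<open>T\<^sup>2\<close> for \<open>M\<^sup>2\<close>. The general case follows from the \<open>C\<^sup>*\<close>-identity.\<close>

lemma star_hom_contractive:
  fixes \<phi> :: "'a::cstar_algebra \<Rightarrow> 'h::complex_hilbert_space bop"
  assumes \<phi>: "star_hom \<phi>" and one: "\<phi> 1 = 1"
  shows "norm (\<phi> a) \<le> norm a"
proof -
  note hom = star_hom_simps[OF \<phi>]
  have sa: "norm (\<phi> x) \<le> norm x" if x: "star x = x" for x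
  proof (rule ccontr)
    define T where "T = \<phi> x"
    define M where "M = norm T"
    assume "\<not> ?thesis"
    hence M: "norm x < M" "0 < M" by (auto simp: M_def T_def intro: le_less_trans[OF norm_ge_zero])
    have "norm ((1 / M\<^sup>2) *\<^sub>R (x * x)) < 1"
    proof -
      have "norm (x * x) = (norm x)\<^sup>2" using cstar_identity[of x] x by simp
      also have "\<dots> < M\<^sup>2" using M by (intro power_strict_mono) auto
      finally show ?thesis using M by simp
    qed
    then obtain z where z: "z * (1 - (1 / M\<^sup>2) *\<^sub>R (x * x)) = 1"
      using Neumann_left_inverse by blast
    define K where "K = norm (\<phi> z)"
    have "\<phi> z * (1 - (1 / M\<^sup>2) *\<^sub>R (T * T)) = 1"
      using arg_cong[OF z, of \<phi>] by (simp add: hom one T_def)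
    hence inv: "\<phi> z \<bullet>\<^sub>O (h - (1 / M\<^sup>2) *\<^sub>R T \<bullet>\<^sub>O T \<bullet>\<^sub>O h) = h" for h
      by (metis bop_apply_simps(2,4,6,7))
    have T_sa: "star T = T" using hom(4)[of x] x by (simp add: T_def)
    have T2: "inner h (T \<bullet>\<^sub>O T \<bullet>\<^sub>O h) = (norm (T \<bullet>\<^sub>O h))\<^sup>2" for h
      using cinner_star_bop[of T h "T \<bullet>\<^sub>O h"]
      by (simp add: T_sa inner_eq_Re_cinner power2_norm_eq_inner)
    have key: "(norm h)\<^sup>2 \<le> K\<^sup>2 * (2 * (norm h)\<^sup>2 - 2 / M\<^sup>2 * (norm (T \<bullet>\<^sub>O h))\<^sup>2)" for h
    proof -
      have TT: "norm (T \<bullet>\<^sub>O T \<bullet>\<^sub>O h) \<le> M * (M * norm h)"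
        using norm_bop_apply[of T "T \<bullet>\<^sub>O h"] mult_left_mono[OF norm_bop_apply[of T h], of M] M
        unfolding M_def by linarith
      have "(norm (h - (1 / M\<^sup>2) *\<^sub>R T \<bullet>\<^sub>O T \<bullet>\<^sub>O h))\<^sup>2 =
          (norm h)\<^sup>2 - 2 / M\<^sup>2 * (norm (T \<bullet>\<^sub>O h))\<^sup>2 + (norm (T \<bullet>\<^sub>O T \<bullet>\<^sub>O h) / M\<^sup>2)\<^sup>2"
        by (simp add: power2_norm_eq_inner inner_diff_left inner_diff_right T2 
            inner_commute[of "T \<bullet>\<^sub>O T \<bullet>\<^sub>O h" h] power_divide)
          (simp add: power2_norm_eq_inner diff_divide_distrib power2_eq_square power4_eq_xxxx)
      also have "\<dots> \<le> (norm h)\<^sup>2 - 2 / M\<^sup>2 * (norm (T \<bullet>\<^sub>O h))\<^sup>2 + (norm h)\<^sup>2"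
      proof -
        have "norm (T \<bullet>\<^sub>O T \<bullet>\<^sub>O h) / M\<^sup>2 \<le> norm h"
          using TT M by (simp add: field_simps power2_eq_square)
        thus ?thesis by (intro add_left_mono power_mono) auto
      qed
      finally have *: "(norm (h - (1 / M\<^sup>2) *\<^sub>R T \<bullet>\<^sub>O T \<bullet>\<^sub>O h))\<^sup>2 \<le>
        2 * (norm h)\<^sup>2 - 2 / M\<^sup>2 * (norm (T \<bullet>\<^sub>O h))\<^sup>2" by simp
      have "(norm h)\<^sup>2 \<le> (K * norm (h - (1 / M\<^sup>2) *\<^sub>R T \<bullet>\<^sub>O T \<bullet>\<^sub>O h))\<^sup>2"
        using norm_bop_apply[of "\<phi> z" "h - (1 / M\<^sup>2) *\<^sub>R T \<bullet>\<^sub>O T \<bullet>\<^sub>O h"]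
        by (intro power_mono) (simp_all add: inv K_def)
      also have "\<dots> \<le> K\<^sup>2 * (2 * (norm h)\<^sup>2 - 2 / M\<^sup>2 * (norm (T \<bullet>\<^sub>O h))\<^sup>2)"
        unfolding power_mult_distrib by (intro mult_left_mono *) simp
      finally show ?thesis .
    qed
    have K: "0 < K"
    proof (rule ccontr)
      assume "\<not> 0 < K"
      hence "K = 0" by (simp add: K_def)
      obtain h :: 'h where "h \<noteq> 0" using nonzero_space by blast
      thus False using key[of h] \<open>K = 0\<close> by simp
    qed
    \<comment> \<open>The estimate above bounds \<open>\<parallel>T h\<parallel>\<^sup>2\<close> by \<open>M\<^sup>2 d \<parallel>h\<parallel>\<^sup>2\<close> with \<open>d < 1\<close>, contradicting \<open>\<parallel>T\<parallel> = M\<close>.\<close>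
    define d where "d = max 0 (1 - 1 / (2 * K\<^sup>2))"
    have d: "0 \<le> d" "d < 1" using K by (auto simp: d_def)
    have "norm T \<le> M * sqrt d"
    proof (rule norm_bop_bound)
      show "0 \<le> M * sqrt d" using M d by simp
      fix h
      have "(norm (T \<bullet>\<^sub>O h))\<^sup>2 \<le> M\<^sup>2 * ((1 - 1 / (2 * K\<^sup>2)) * (norm h)\<^sup>2)"
        using key[of h] K M by (simp add: field_simps)
      also have "\<dots> \<le> M\<^sup>2 * (d * (norm h)\<^sup>2)"
        by (intro mult_left_mono mult_right_mono) (auto simp: d_def)
      also have "\<dots> = (M * sqrt d * norm h)\<^sup>2" using d by (simp add: power_mult_distrib)
      finally show "norm (T \<bullet>\<^sub>O h) \<le> M * sqrt d * norm h"
        by (rule power2_le_imp_le) (use M d in auto)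
    qed
    also have "\<dots> < M * 1" using M d by (intro mult_strict_left_mono) auto
    finally show False by (simp add: M_def)
  qed
  have "(norm (\<phi> a))\<^sup>2 = norm (\<phi> (star a * a))" by (simp add: hom cstar_identity)
  also have "\<dots> \<le> norm (star a * a)" by (rule sa) (simp add: star_mult star_star)
  also have "\<dots> = (norm a)\<^sup>2" by (rule cstar_identity)
  finally show ?thesis by (rule power2_le_imp_le) simp
qed

text \<open>The binomial series of \<open>sqrt (1 - y)\<close>; its Cauchy square is computed with Vandermonde's
  identity for \<open>1/2 + 1/2 = 1\<close>.\<close>

lemma sqrt_one_minus_exists:
  fixes y :: "'a::cstar_algebra"
  assumes y: "star y = y" "norm y < 1"
  shows "\<exists>s. star s = s \<and> s * s = 1 - y \<and> (\<forall>x. x * y = y * x \<longrightarrow> x * s = s * x)"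
proof -
  define c :: "nat \<Rightarrow> real" where "c n = (-1) ^ n * ((1/2) gchoose n)" for n
  have conv: "(\<Sum>i\<le>n. c i * c (n - i)) = (-1) ^ n * (1 gchoose n)" for n
  proof -
    have "(\<Sum>i\<le>n. c i * c (n - i)) = (\<Sum>i\<le>n. (-1) ^ n * (((1/2 :: real) gchoose i) * ((1/2) gchoose (n - i))))"
    proof (rule sum.cong[OF refl])
      fix i assume "i \<in> {..n}"
      hence "(-1 :: real) ^ n = (-1) ^ i * (-1) ^ (n - i)" by (simp flip: power_add)
      thus "c i * c (n - i) = (-1) ^ n * (((1/2) gchoose i) * ((1/2) gchoose (n - i)))"
        by (simp add: c_def)
    qed
    also have "\<dots> = (-1) ^ n * (1 gchoose n)"
      using gbinomial_Vandermonde[of "1/2 :: real" "1/2" n]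
      by (simp add: sum_distrib_left[symmetric] atLeast0AtMost)
    finally show ?thesis .
  qed
  \<comment> \<open>Strictly between \<open>\<parallel>y\<parallel>\<close> and \<open>1\<close>: convergence of the scalar series at \<open>- q\<close> gives absolute convergence at \<open>\<parallel>y\<parallel>\<close>.\<close>
  define q where "q = (1 + norm y) / 2"
  have q: "norm y < q" "q < 1" "0 < q" using y(2) by (auto simp: q_def add_pos_nonneg)
  have "summable (\<lambda>n. ((1/2) gchoose n) * (- q) ^ n)"
    using gen_binomial_real[of "- q" "1/2"] q by (auto simp: sums_iff)
  from powser_insidea[OF this, of "norm y"] q
  have abs: "summable (\<lambda>n. \<bar>c n\<bar> * norm y ^ n)"
    by (simp add: c_def abs_mult norm_power)
  have abs': "summable (\<lambda>n. norm (c n *\<^sub>R y ^ n))"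
    by (rule summable_comparison_test'[OF abs, of 0])
      (simp add: mult_left_mono norm_power_ineq)
  define s where "s = (\<Sum>n. c n *\<^sub>R y ^ n)"
  have s: "(\<lambda>n. c n *\<^sub>R y ^ n) sums s"
    unfolding s_def by (rule summable_sums, rule summable_norm_cancel, rule abs')
  have "star s = s"
    using bounded_linear.sums[OF bounded_linear_star s] s
    by (intro sums_unique2[of "\<lambda>n. c n *\<^sub>R y ^ n"]) (simp_all add: star_scaleR star_power y)
  moreover have "s * s = 1 - y"
  proof (rule sums_unique2)
    have "(\<Sum>i\<le>n. (c i *\<^sub>R y ^ i) * (c (n - i) *\<^sub>R y ^ (n - i))) = ((-1) ^ n * (1 gchoose n)) *\<^sub>R y ^ n"
      for n
      unfolding conv[symmetric] scaleR_sum_left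
      by (intro sum.cong) (simp_all flip: power_add)
    with Cauchy_product_sums[OF abs' abs']
    show "(\<lambda>n. ((-1) ^ n * (1 gchoose n)) *\<^sub>R y ^ n) sums (s * s)"
      by (simp add: s_def)
    have "(1 gchoose n) = (0::real)" if "n \<notin> {0, 1}" for n
      using that binomial_gbinomial[of 1 n, where 'a = real] by (simp add: binomial_eq_0)
    hence "(\<lambda>n. ((-1) ^ n * (1 gchoose n)) *\<^sub>R y ^ n) sums (\<Sum>n\<in>{0, 1}. ((-1) ^ n * (1 gchoose n)) *\<^sub>R y ^ n)"
      by (intro sums_finite) auto
    thus "(\<lambda>n. ((-1) ^ n * (1 gchoose n)) *\<^sub>R y ^ n) sums (1 - y)" by simp
  qed
  moreover have "x * s = s * x" if x: "x * y = y * x" for x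
  proof (rule sums_unique2)
    show "(\<lambda>n. x * c n *\<^sub>R y ^ n) sums (x * s)" by (rule sums_mult[OF s])
    have "y ^ n * x = x * y ^ n" for n by (rule power_commuting_commutes) (rule x[symmetric])
    with sums_mult2[OF s, of x] show "(\<lambda>n. x * c n *\<^sub>R y ^ n) sums (s * x)" by simp
  qed
  ultimately show ?thesis by blast
qed

lemma norm_unitary_power_le: "star u * u = 1 \<Longrightarrow> norm (u ^ k) \<le> 1" for u :: "'a::cstar_algebra"
proof -
  assume "star u * u = 1"
  hence "(norm u)\<^sup>2 = 1" using cstar_identity[of u] by simp
  hence "norm u = 1" using norm_ge_zero[of u] by (auto simp: power2_eq_1_iff)
  thus ?thesis using norm_power_ineq[of u k] by simp
qed

lemma norm_normal_power:
  fixes x :: "'a::cstar_algebra"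
  assumes "star x * x = x * star x"
  shows "norm (x ^ 2 ^ k) = norm x ^ 2 ^ k"
proof -
  have square: "norm (y * y) = (norm y)\<^sup>2" if y: "star y * y = y * star y" for y :: 'a
  proof -
    have "(norm (y * y))\<^sup>2 = norm (star y * (star y * y) * y)"
      by (simp add: cstar_identity[symmetric] star_mult mult.assoc)
    also have "star y * (star y * y) * y = star (star y * y) * (star y * y)"
      unfolding star_mult star_star by (metis mult.assoc y)
    also have "norm \<dots> = ((norm y)\<^sup>2)\<^sup>2" by (simp only: cstar_identity)
    finally show ?thesis by (rule power2_eq_imp_eq) auto
  qed
  have comm: "star (x ^ n) * x ^ n = x ^ n * star (x ^ n)" for n
    unfolding star_power using assms by (metis power_commuting_commutes)
  show ?thesis
  proof (induction k)
    case (Suc k)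
    have "x ^ 2 ^ Suc k = x ^ 2 ^ k * x ^ 2 ^ k" by (simp flip: power_add add: mult_2)
    hence "norm (x ^ 2 ^ Suc k) = (norm (x ^ 2 ^ k))\<^sup>2" using square[OF comm] by simp
    thus ?case using Suc by (simp flip: power_mult add: mult.commute)
  qed simp
qed

section \<open>Polynomial calculus and isometry of faithful representations\<close>

definition poly_calc :: "complex poly \<Rightarrow> 'a::cstar_algebra \<Rightarrow> 'a"
  where "poly_calc p x = (\<Sum>i\<le>degree p. coeff p i *\<^sub>C x ^ i)"

lemma poly_calc_altdef: "degree p \<le> n \<Longrightarrow> poly_calc p x = (\<Sum>i\<le>n. coeff p i *\<^sub>C x ^ i)"
  unfolding poly_calc_def by (rule sum.mono_neutral_left) (auto simp: coeff_eq_0)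

lemma poly_calc_add: "poly_calc (p + q) x = poly_calc p x + poly_calc q x"
proof -
  define n where "n = max (degree p) (degree q)"
  have "degree p \<le> n" "degree q \<le> n" "degree (p + q) \<le> n"
    by (auto simp: n_def degree_add_le)
  thus ?thesis by (simp add: poly_calc_altdef[of _ n] scaleC_add_left sum.distrib)
qed

lemma poly_calc_smult: "poly_calc (smult c p) x = c *\<^sub>C poly_calc p x"
  using poly_calc_altdef[OF degree_smult_le, of c p x]
  by (simp add: poly_calc_def scaleC_sum_right scaleC_scaleC)

lemma poly_calc_0 [simp]: "poly_calc 0 x = 0"
  by (simp add: poly_calc_def)

lemma poly_calc_pCons: "poly_calc (pCons a p) x = a *\<^sub>C 1 + x * poly_calc p x"
proof -
  have "poly_calc (pCons a p) x = (\<Sum>i\<le>Suc (degree p). coeff (pCons a p) i *\<^sub>C x ^ i)"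
    by (rule poly_calc_altdef) (rule degree_pCons_le)
  also have "\<dots> = a *\<^sub>C 1 + (\<Sum>i\<le>degree p. coeff p i *\<^sub>C x ^ Suc i)"
    by (subst sum.atMost_Suc_shift) simp
  finally show ?thesis by (simp add: poly_calc_def sum_distrib_left mult_scaleC_right)
qed

lemma poly_calc_mult: "poly_calc (p * q) x = poly_calc p x * poly_calc q x"
  by (induction p)
    (simp_all add: poly_calc_pCons poly_calc_add poly_calc_smult mult_scaleC_left algebra_simps)

lemma poly_calc_1 [simp]: "poly_calc 1 x = 1"
  by (simp add: one_pCons poly_calc_pCons)

lemma poly_calc_power: "poly_calc (p ^ n) x = poly_calc p x ^ n"
  by (induction n) (simp_all add: poly_calc_mult)

lemma poly_calc_diff: "poly_calc (p - q) x = poly_calc p x - poly_calc q x"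
  using poly_calc_add[of "p - q" q x] by simp

lemma poly_calc_sum: "poly_calc (\<Sum>i\<in>I. p i) x = (\<Sum>i\<in>I. poly_calc (p i) x)"
  by (induction I rule: infinite_finite_induct) (simp_all add: poly_calc_add)

lemma poly_calc_monom: "poly_calc (monom c n) x = c *\<^sub>C x ^ n"
  by (induction n) (simp_all add: monom_0 monom_Suc poly_calc_pCons mult_scaleC_right)

lemma poly_calc_commute:
  assumes "y * x = x * y"
  shows "y * poly_calc p x = poly_calc p x * y"
proof (induction p)
  case (pCons a p)
  have "y * (x * poly_calc p x) = (x * poly_calc p x) * y"
    using pCons.IH assms by (metis mult.assoc)
  thus ?case by (simp add: poly_calc_pCons algebra_simps mult_scaleC_left mult_scaleC_right)
qed simp

text \<open>If \<open>star x\<close> commutes with \<open>x\<close> then it commutes with \<open>p(x)\<close>; taking adjoints, \<open>star (p(x))\<close>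
  commutes with \<open>x\<close>, hence with \<open>p(x)\<close>.\<close>

lemma poly_calc_normal:
  assumes "star x * x = x * star x"
  shows "star (poly_calc p x) * poly_calc p x = poly_calc p x * star (poly_calc p x)"
proof -
  have "star (star x * poly_calc p x) = star (poly_calc p x * star x)"
    by (simp only: poly_calc_commute[OF assms])
  hence "star (poly_calc p x) * x = x * star (poly_calc p x)"
    by (simp add: star_mult star_star)
  thus ?thesis by (rule poly_calc_commute)
qed

lemma star_hom_poly_calc:
  assumes "star_hom \<phi>" "\<phi> 1 = 1"
  shows "\<phi> (poly_calc p x) = poly_calc p (\<phi> x)"
  by (induction p) (simp_all add: poly_calc_pCons star_hom_simps[OF assms(1)] assms(2))

text \<open>With \<open>M = deg p + 1\<close>, the coefficient is the average of \<open>p(z) / z\<^sup>k\<close> over the \<open>M\<close>-th roots of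
  unity; \<open>1 / z\<^sup>k\<close> appears as \<open>z ^ (M - k)\<close>.\<close>

lemma norm_coeff_le_on_circle:
  fixes p :: "complex poly"
  assumes S: "\<And>z. cmod z = 1 \<Longrightarrow> cmod (poly p z) \<le> S"
  shows "cmod (coeff p k) \<le> S"
proof (cases "k \<le> degree p")
  case False
  thus ?thesis using S[of 1] by (simp add: coeff_eq_0 order_trans[OF norm_ge_zero])
next
  case True
  define M where "M = Suc (degree p)"
  have k: "k < M" using True by (simp add: M_def)
  define w where "w = exp (2 * of_real pi * \<i> / of_nat M)"
  have w_pow: "w ^ m = exp (2 * of_real pi * \<i> * of_nat m / of_nat M)" for m
    by (simp add: w_def exp_of_nat_mult[symmetric] mult_ac)
  have M: "1 \<le> M" by (simp add: M_def)
  have w_eq_1: "w ^ m = 1 \<longleftrightarrow> M dvd m" for m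
    unfolding w_pow using complex_root_unity_eq_1[OF M, of m] by simp
  have norm_w: "cmod (w ^ m) = 1" for m
    by (simp add: w_def norm_power)
  have orth: "(\<Sum>j<M. (w ^ (i + (M - k))) ^ j) = (if i = k then of_nat M else 0)" if "i < M" for i
  proof -
    have "M dvd i + (M - k) \<longleftrightarrow> i = k"
    proof
      assume "M dvd i + (M - k)"
      then obtain r where r: "i + (M - k) = M * r" by blast
      have "i + (M - k) < M * 2" "0 < i + (M - k)" using that k by auto
      hence "r = 1" unfolding r by (cases r) auto
      thus "i = k" using r k by simp
    qed (use k in auto)
    moreover have "(w ^ (i + (M - k))) ^ M = 1"
      using w_eq_1[of "(i + (M - k)) * M"] by (simp add: power_mult)
    ultimately show ?thesis
      using geometric_sum[of "w ^ (i + (M - k))" M] w_eq_1[of "i + (M - k)"] by auto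
  qed
  have "(\<Sum>j<M. poly p (w ^ j) * (w ^ j) ^ (M - k)) =
      (\<Sum>j<M. \<Sum>i<M. coeff p i * (w ^ (i + (M - k))) ^ j)"
  proof (rule sum.cong[OF refl])
    fix j
    have "poly p (w ^ j) * (w ^ j) ^ (M - k) = (\<Sum>i<M. coeff p i * ((w ^ j) ^ i * (w ^ j) ^ (M - k)))"
      by (simp add: poly_altdef M_def lessThan_Suc_atMost sum_distrib_right mult.assoc)
    also have "\<dots> = (\<Sum>i<M. coeff p i * (w ^ (i + (M - k))) ^ j)"
      by (simp add: power_add[symmetric] power_mult[symmetric] algebra_simps)
    finally show "poly p (w ^ j) * (w ^ j) ^ (M - k) = (\<Sum>i<M. coeff p i * (w ^ (i + (M - k))) ^ j)" .
  qed
  also have "\<dots> = (\<Sum>i<M. coeff p i * (\<Sum>j<M. (w ^ (i + (M - k))) ^ j))"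
    by (subst sum.swap) (simp add: sum_distrib_left)
  also have "\<dots> = (\<Sum>i<M. if i = k then coeff p i * of_nat M else 0)"
    by (intro sum.cong refl) (auto simp: orth)
  also have "\<dots> = of_nat M * coeff p k" using k by simp
  finally have "real M * cmod (coeff p k) = cmod (\<Sum>j<M. poly p (w ^ j) * (w ^ j) ^ (M - k))"
    by (simp add: norm_mult)
  also have "\<dots> \<le> (\<Sum>j<M. S)"
    using S norm_w by (intro sum_norm_le) (simp add: norm_mult norm_power)
  finally show ?thesis using M by simp
qed

text \<open>A factor of linear growth disappears after taking roots of order \<open>2\<^sup>k\<close>.\<close>

lemma le_of_powers_le_linear_times_power:
  fixes x S D :: real
  assumes le: "\<And>k. x ^ 2 ^ k \<le> (D * 2 ^ k + 1) * S ^ 2 ^ k" and "0 \<le> S" "0 \<le> x"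
  shows "x \<le> S"
proof (rule ccontr)
  assume "\<not> x \<le> S"
  define r where "r = S / x"
  have x: "0 < x" "S < x" using assms \<open>\<not> x \<le> S\<close> by auto
  hence r: "0 \<le> r" "r < 1" using assms by (auto simp: r_def)
  have "(\<lambda>n. D * (of_nat n * r ^ n) + r ^ n) \<longlonglongrightarrow> D * 0 + 0"
    using r by (intro tendsto_intros powser_times_n_limit_0 LIMSEQ_power_zero) auto
  hence "\<forall>\<^sub>F n in sequentially. D * (of_nat n * r ^ n) + r ^ n < 1"
    by (rule order_tendstoD) simp
  then obtain N where N: "\<And>n. N \<le> n \<Longrightarrow> D * (of_nat n * r ^ n) + r ^ n < 1"
    by (auto simp: eventually_sequentially)
  have "N \<le> 2 ^ N" by (rule less_imp_le) simp
  hence "D * (2 ^ N * r ^ 2 ^ N) + r ^ 2 ^ N < 1" using N[of "2 ^ N"] by simp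
  moreover have "1 \<le> (D * 2 ^ N + 1) * r ^ 2 ^ N"
    using le[of N] x by (simp add: r_def power_divide field_simps)
  ultimately show False by (simp add: algebra_simps)
qed

text \<open>Bounding \<open>p(u)\<close> by the sum of the moduli of its coefficients loses a factor \<open>deg p + 1\<close>.
  Applied to the powers \<open>p\<^sup>n\<close> with \<open>n = 2\<^sup>k\<close>, whose values at \<open>u\<close> are normal, so that
  \<open>\<parallel>p(u)\<^sup>n\<parallel> = \<parallel>p(u)\<parallel>\<^sup>n\<close>, the loss disappears in the limit.\<close>

lemma norm_poly_calc_unitary_le:
  fixes u :: "'a::cstar_algebra"
  assumes u: "star u * u = 1" "u * star u = 1"
    and S: "\<And>z. cmod z = 1 \<Longrightarrow> cmod (poly p z) \<le> S"
  shows "norm (poly_calc p u) \<le> S"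
proof (rule le_of_powers_le_linear_times_power)
  show "0 \<le> S" using S[of 1] by (simp add: order_trans[OF norm_ge_zero])
  show "norm (poly_calc p u) ^ 2 ^ k \<le> (real (degree p) * 2 ^ k + 1) * S ^ 2 ^ k" for k
  proof -
    define n :: nat where "n = 2 ^ k"
    have bound: "cmod (coeff (p ^ n) i) \<le> S ^ n" for i
      by (rule norm_coeff_le_on_circle) (auto simp: norm_power intro!: power_mono S)
    have "norm (poly_calc p u) ^ n = norm (poly_calc (p ^ n) u)"
      unfolding poly_calc_power n_def using u
      by (intro norm_normal_power[symmetric] poly_calc_normal) simp
    also have "poly_calc (p ^ n) u = (\<Sum>i\<le>degree p * n. coeff (p ^ n) i *\<^sub>C u ^ i)"
      by (rule poly_calc_altdef) (rule degree_power_le)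
    also have "norm \<dots> \<le> (\<Sum>i\<le>degree p * n. S ^ n)"
    proof (rule sum_norm_le)
      show "norm (coeff (p ^ n) i *\<^sub>C u ^ i) \<le> S ^ n" for i
        using mult_mono[OF bound[of i] norm_unitary_power_le[OF u(1), of i]] \<open>0 \<le> S\<close>
        by (simp add: norm_scaleC)
    qed
    finally show ?thesis by (simp add: n_def algebra_simps)
  qed
qed simp

text \<open>After scaling to \<open>x = c / r\<close>, the element \<open>u = x + \<i> sqrt (1 - x\<^sup>2)\<close> is unitary with real part
  \<open>x\<close>, and \<open>p(c) u\<^sup>N\<close> is a polynomial in \<open>u\<close>, where \<open>N\<close> is the degree of \<open>p\<close>. At a scalar \<open>z\<close> of
  modulus \<open>1\<close> that polynomial has the modulus of \<open>p(r Re z)\<close>.\<close>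

lemma norm_poly_calc_le:
  fixes c :: "'a::cstar_algebra"
  assumes c: "star c = c" "norm c < r"
    and S: "\<And>t. \<bar>t\<bar> \<le> r \<Longrightarrow> cmod (poly p (of_real t)) \<le> S"
  shows "norm (poly_calc p c) \<le> S"
proof -
  have r: "0 < r" using c(2) norm_ge_zero[of c] by linarith
  define x where "x = (1 / r) *\<^sub>R c"
  have x: "star x = x" "norm x < 1" using c r by (auto simp: x_def star_scaleR)
  have "norm (x * x) < 1"
  proof -
    have "norm (x * x) = (norm x)\<^sup>2" using cstar_identity[of x] x(1) by simp
    also have "\<dots> < 1" using x(2) by (simp add: power_less_one_iff abs_square_less_1)
    finally show ?thesis .
  qed
  then obtain s where s: "star s = s" "s * s = 1 - x * x" "x * s = s * x"
    using sqrt_one_minus_exists[of "x * x"] x by (auto simp: star_mult mult.assoc)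
  define u where "u = x + \<i> *\<^sub>C s"
  have star_u: "star u = x - \<i> *\<^sub>C s"
    by (simp add: u_def star_add star_scaleC x s scaleC_minus_left)
  have u: "star u * u = 1" "u * star u = 1"
    unfolding star_u
    by (simp_all add: u_def algebra_simps mult_scaleC_left mult_scaleC_right scaleC_scaleC s
        scaleC_add_right scaleC_diff_right scaleC_minus_left)
  define N where "N = degree p"
  \<comment> \<open>This is \<open>z\<^sup>N p (r (z + 1/z) / 2)\<close>, with \<open>z + 1/z\<close> written as \<open>(1 + z\<^sup>2) / z\<close>.\<close>
  define Q where "Q = (\<Sum>i\<le>N. smult (coeff p i * of_real (r / 2) ^ i) ([:1, 0, 1:] ^ i * monom 1 (N - i)))"
  have xu: "u * x = x * u" by (simp add: u_def algebra_simps mult_scaleC_left mult_scaleC_right s)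
  have "star u = 2 *\<^sub>R x - u" unfolding star_u by (simp add: u_def scaleR_2)
  hence "u * u + 1 = 2 *\<^sub>R (x * u)"
    using u(2) by (simp add: right_diff_distrib xu diff_eq_eq add.commute)
  have calc1: "poly_calc [:1, 0, 1:] u = 2 *\<^sub>R (x * u)"
    using \<open>u * u + 1 = 2 *\<^sub>R (x * u)\<close> by (simp add: poly_calc_pCons add.commute)
  have xu_pow: "(x * u) ^ i = x ^ i * u ^ i" for i
  proof (induction i)
    case (Suc i)
    have "u * x ^ i = x ^ i * u" using power_commuting_commutes[of x u i] xu by simp
    thus ?case using Suc by (simp add: mult.assoc) (metis mult.assoc)
  qed simp
  have c_pow: "c ^ i = r ^ i *\<^sub>R x ^ i" for i
    using r by (simp add: x_def scaleR_power power_divide)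
  have "poly_calc Q u = (\<Sum>i\<le>N. coeff p i *\<^sub>C c ^ i * u ^ N)"
    unfolding Q_def poly_calc_sum
  proof (rule sum.cong[OF refl])
    fix i assume "i \<in> {..N}"
    hence "u ^ N = u ^ i * u ^ (N - i)" by (simp flip: power_add)
    thus "poly_calc (smult (coeff p i * of_real (r / 2) ^ i) ([:1, 0, 1:] ^ i * monom 1 (N - i))) u =
        coeff p i *\<^sub>C c ^ i * u ^ N"
      by (simp add: poly_calc_smult poly_calc_mult poly_calc_power calc1 xu_pow poly_calc_monom
          c_pow mult.assoc mult_scaleC_left)
        (simp add: scaleR_scaleC mult_scaleC_left scaleC_scaleC power_divide mult.assoc)
  qed
  also have "\<dots> = poly_calc p c * u ^ N"
    by (simp add: poly_calc_def N_def sum_distrib_right)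
  finally have Qu: "poly_calc Q u = poly_calc p c * u ^ N" .
  have "norm (poly_calc Q u) \<le> S"
  proof (rule norm_poly_calc_unitary_le[OF u])
    fix z :: complex assume z: "cmod z = 1"
    have "z * cnj z = 1" using z complex_norm_square[of z] by simp
    moreover have "2 * of_real (Re z) = z + cnj z" using complex_add_cnj[of z] by simp
    ultimately have zz: "1 + z * z = 2 * of_real (Re z) * z" by (simp add: algebra_simps)
    have "poly Q z = (\<Sum>i\<le>N. coeff p i * of_real (r * Re z) ^ i * z ^ N)"
      unfolding Q_def poly_sum
    proof (rule sum.cong[OF refl])
      fix i assume "i \<in> {..N}"
      hence "z ^ N = z ^ i * z ^ (N - i)" by (simp flip: power_add)
      thus "poly (smult (coeff p i * of_real (r / 2) ^ i) ([:1, 0, 1:] ^ i * monom 1 (N - i))) z =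
          coeff p i * of_real (r * Re z) ^ i * z ^ N"
        by (simp add: poly_power poly_monom zz power_mult_distrib power_divide)
    qed
    also have "\<dots> = poly p (of_real (r * Re z)) * z ^ N"
      by (simp add: poly_altdef N_def sum_distrib_right)
    finally have "cmod (poly Q z) = cmod (poly p (of_real (r * Re z)))"
      using z by (simp add: norm_mult norm_power)
    also have "\<dots> \<le> S"
    proof (rule S)
      show "\<bar>r * Re z\<bar> \<le> r"
        using abs_Re_le_cmod[of z] z r by (simp add: abs_mult mult_left_le)
    qed
    finally show "cmod (poly Q z) \<le> S" .
  qed
  moreover have "poly_calc p c = poly_calc Q u * star u ^ N"
  proof -
    have "u ^ N * star u ^ N = 1"
      by (metis left_right_inverse_power u(2))
    thus ?thesis by (simp add: Qu mult.assoc)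
  qed
  moreover have "norm (star u ^ N) \<le> 1"
    using norm_unitary_power_le[of "star u" N] u by (simp add: star_star)
  ultimately show ?thesis
    using norm_mult_ineq[of "poly_calc Q u" "star u ^ N"] mult_left_le[of "norm (star u ^ N)" "norm (poly_calc Q u)"]
    by simp
qed


text \<open>Suppose \<open>x\<close> is selfadjoint with \<open>\<parallel>\<rho>(x)\<parallel> < r\<close>. Let \<open>f\<close> vanish on \<open>[-r, r]\<close> and differ from the
  identity function by at most \<open>r\<close> everywhere. Approximating \<open>f\<close> by polynomials defines \<open>f(x)\<close>,
  and \<open>\<rho>(f(x)) = f(\<rho>(x)) = 0\<close>. By injectivity \<open>f(x) = 0\<close>, so \<open>x = x - f(x)\<close> has norm at most \<open>r\<close>.\<close>

lemma injective_rep_isometric: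
  fixes \<rho> :: "'a::cstar_algebra \<Rightarrow> 'h::complex_hilbert_space bop"
  assumes "faithful_rep \<rho>"
  shows "norm (\<rho> a) = norm a"
proof -
  have \<rho>: "star_hom \<rho>" "\<rho> 1 = 1" "inj \<rho>"
    using assms by (auto simp: faithful_rep_def)
  note hom = star_hom_simps[OF \<rho>(1)]
  have contr: "norm (\<rho> x) \<le> norm x" for x by (rule star_hom_contractive[OF \<rho>(1,2)])
  have small: "norm x \<le> r" if x: "star x = x" "norm x < 1" and r: "norm (\<rho> x) < r" for x r
  proof -
    have "0 < r" using r norm_ge_zero[of "\<rho> x"] by linarith
    define f where "f t = t - max (- r) (min r t)" for t :: real
    have f_small: "f t = 0" if "\<bar>t\<bar> \<le> r" for t using that by (auto simp: f_def)
    have "\<exists>p. \<forall>t. \<bar>t\<bar> \<le> 1 \<longrightarrow> cmod (of_real (f t) - poly p (of_real t)) < 1 / real (Suc n)" for n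
    proof -
      have "continuous_on {-1..1} f" unfolding f_def by (intro continuous_intros)
      then obtain g where g: "real_polynomial_function g" "\<And>t. t \<in> {-1..1} \<Longrightarrow> \<bar>f t - g t\<bar> < 1 / real (Suc n)"
        using Stone_Weierstrass_real_polynomial_function[of "{-1..1}" f "1 / real (Suc n)"] by auto
      then obtain a N where a: "g = (\<lambda>t. \<Sum>i\<le>N. a i * t ^ i)"
        by (auto simp: real_polynomial_function_iff_sum)
      define p where "p = (\<Sum>i\<le>N. monom (complex_of_real (a i)) i)"
      have "poly p (of_real t) = of_real (g t)" for t
        by (simp add: p_def a poly_sum poly_monom)
      hence "cmod (of_real (f t) - poly p (of_real t)) < 1 / real (Suc n)" if "\<bar>t\<bar> \<le> 1" for t
        using g(2)[of t] that by (simp add: abs_le_iff flip: of_real_diff)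
      thus ?thesis by blast
    qed
    then obtain p where p: "\<And>n t. \<bar>t\<bar> \<le> 1 \<Longrightarrow> cmod (of_real (f t) - poly (p n) (of_real t)) < 1 / real (Suc n)"
      by metis
    have lim: "(\<lambda>n. 1 / real (Suc n)) \<longlonglongrightarrow> 0"
      using LIMSEQ_inverse_real_of_nat by (simp add: inverse_eq_divide)
    define y where "y n = poly_calc (p n) x" for n
    have "Cauchy y"
    proof (rule CauchyI)
      fix e :: real assume "0 < e"
      hence "\<forall>\<^sub>F n in sequentially. 1 / real (Suc n) < e / 2" by (intro order_tendstoD(2)[OF lim]) simp
      then obtain M where M: "\<And>n. M \<le> n \<Longrightarrow> 1 / real (Suc n) < e / 2"
        by (auto simp: eventually_sequentially)
      show "\<exists>M. \<forall>m\<ge>M. \<forall>n\<ge>M. norm (y m - y n) < e"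
      proof (intro exI[of _ M] allI impI)
        fix m n assume mn: "M \<le> m" "M \<le> n"
        have "norm (y m - y n) \<le> 1 / real (Suc m) + 1 / real (Suc n)"
          unfolding y_def poly_calc_diff[symmetric]
        proof (rule norm_poly_calc_le[OF x])
          fix t :: real assume t: "\<bar>t\<bar> \<le> 1"
          show "cmod (poly (p m - p n) (of_real t)) \<le> 1 / real (Suc m) + 1 / real (Suc n)"
            using norm_triangle_ineq4[of "of_real (f t) - poly (p n) (of_real t)" "of_real (f t) - poly (p m) (of_real t)"]
              p[OF t, of m] p[OF t, of n] by simp
        qed
        also have "\<dots> < e" using M[OF mn(1)] M[OF mn(2)] by simp
        finally show "norm (y m - y n) < e" .
      qed
    qed
    then obtain l where l: "y \<longlonglongrightarrow> l" by (metis Cauchy_convergent convergent_def)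
    have "bounded_linear \<rho>" using contr
      by (intro bounded_linear_intro[where K = 1]) (auto simp: hom)
    hence "(\<lambda>n. \<rho> (y n)) \<longlonglongrightarrow> \<rho> l" by (rule bounded_linear.tendsto[OF _ l])
    moreover have "(\<lambda>n. \<rho> (y n)) \<longlonglongrightarrow> 0"
    proof (rule Lim_null_comparison[OF _ lim], intro always_eventually allI)
      fix n
      \<comment> \<open>The polynomials approximate \<open>f\<close> on \<open>[-1, 1]\<close> only.\<close>
      have "r \<le> 1 \<or> 1 < r" by linarith
      thus "norm (\<rho> (y n)) \<le> 1 / real (Suc n)"
      proof
        assume r1: "r \<le> 1"
        show ?thesis unfolding y_def star_hom_poly_calc[OF \<rho>(1,2)]
        proof (rule norm_poly_calc_le[OF _ r])
          show "star (\<rho> x) = \<rho> x" using hom(4)[of x] x by simp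
          show "cmod (poly (p n) (of_real t)) \<le> 1 / real (Suc n)" if "\<bar>t\<bar> \<le> r" for t
            using p[of t n] f_small[OF that] that r1 by simp
        qed
      next
        assume r1: "1 < r"
        show ?thesis unfolding y_def star_hom_poly_calc[OF \<rho>(1,2)]
        proof (rule norm_poly_calc_le[of _ 1])
          show "star (\<rho> x) = \<rho> x" using hom(4)[of x] x by simp
          show "norm (\<rho> x) < 1" using contr[of x] x by simp
          show "cmod (poly (p n) (of_real t)) \<le> 1 / real (Suc n)" if "\<bar>t\<bar> \<le> 1" for t
            using p[of t n] f_small[of t] that r1 by simp
        qed
      qed
    qed
    ultimately have "\<rho> l = 0" by (rule LIMSEQ_unique)
    hence "l = 0" using \<rho>(3) hom(6) by (metis injD)
    have "norm x \<le> r + 0"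
    proof (rule LIMSEQ_le)
      show "(\<lambda>n. norm (x - y n)) \<longlonglongrightarrow> norm x"
        using tendsto_norm[OF tendsto_diff[OF tendsto_const[of x] l]] \<open>l = 0\<close> by simp
      show "(\<lambda>n. r + 1 / real (Suc n)) \<longlonglongrightarrow> r + 0" by (intro tendsto_add tendsto_const lim)
      have "norm (x - y n) \<le> r + 1 / real (Suc n)" for n
      proof -
        have "x - y n = poly_calc ([:0, 1:] - p n) x"
          by (simp add: poly_calc_diff poly_calc_pCons y_def)
        also have "norm \<dots> \<le> r + 1 / real (Suc n)"
        proof (rule norm_poly_calc_le[OF x])
          fix t :: real assume t: "\<bar>t\<bar> \<le> 1"
          have "\<bar>t - f t\<bar> \<le> r" using \<open>0 < r\<close> by (auto simp: f_def)
          hence "cmod (of_real t - of_real (f t)) \<le> r" by (simp flip: of_real_diff)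
          thus "cmod (poly ([:0, 1:] - p n) (of_real t)) \<le> r + 1 / real (Suc n)"
            using norm_triangle_ineq[of "of_real t - of_real (f t)" "of_real (f t) - poly (p n) (of_real t)"]
              p[OF t, of n] by simp
        qed
        finally show ?thesis .
      qed
      thus "\<exists>N. \<forall>n\<ge>N. norm (x - y n) \<le> r + 1 / real (Suc n)" by blast
    qed
    thus ?thesis by simp
  qed
  have sa: "norm x \<le> norm (\<rho> x)" if x: "star x = x" for x
  proof (rule dense_ge)
    fix r assume r: "norm (\<rho> x) < r"
    \<comment> \<open>Rescales \<open>x\<close> into the open unit ball.\<close>
    define s where "s = 1 / (norm x + 1)"
    have s: "0 < s" by (simp add: s_def add_nonneg_pos)
    have "norm (s *\<^sub>R x) \<le> s * r"
    proof (rule small)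
      show "star (s *\<^sub>R x) = s *\<^sub>R x" by (simp add: star_scaleR x)
      show "norm (s *\<^sub>R x) < 1" by (simp add: s_def add_nonneg_pos)
      show "norm (\<rho> (s *\<^sub>R x)) < s * r" using r s by (simp add: hom)
    qed
    thus "norm x \<le> r" using s by simp
  qed
  have "(norm a)\<^sup>2 = norm (star a * a)" by (simp add: cstar_identity)
  also have "\<dots> \<le> norm (\<rho> (star a * a))" by (rule sa) (simp add: star_mult star_star)
  also have "\<dots> = (norm (\<rho> a))\<^sup>2" by (simp add: hom cstar_identity)
  finally have "norm a \<le> norm (\<rho> a)" by (rule power2_le_imp_le) simp
  thus ?thesis using contr[of a] by simp
qed

section \<open>Scalar matrices, Herz-Schur multipliers and translations\<close>

lemma scaleC_sum_left: "(\<Sum>i\<in>I. c i) *\<^sub>C x = (\<Sum>i\<in>I. c i *\<^sub>C (x::'a::complex_vector))"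
  by (induction I rule: infinite_finite_induct) (auto simp: scaleC_add_left)

lemma cinner_zero_right [simp]: "cinner x 0 = 0"
  using cinner_add_right[of x 0 0] by simp

lemma cinner_sum_right: "cinner x (\<Sum>i\<in>I. f i) = (\<Sum>i\<in>I. cinner x (f i))"
  by (induction I rule: infinite_finite_induct) (auto simp: cinner_add_right)

lemma cinner_self: "cinner x x = of_real ((norm x)\<^sup>2)"
proof (rule complex_eqI)
  show "Im (cinner x x) = Im (of_real ((norm x)\<^sup>2))"
  proof -
    have "Im (cinner x x) = - Im (cinner x x)"
      by (metis cinner_commute cnj.sel(2))
    thus ?thesis by auto
  qed
qed (simp add: power2_norm_eq_inner inner_eq_Re_cinner)

lemma norm_orthogonal_add:
  assumes "norm h = 1" "cinner h w = 0"
  shows "(norm (a *\<^sub>C h + w))\<^sup>2 = (cmod a)\<^sup>2 + (norm w)\<^sup>2"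
proof -
  have "inner (a *\<^sub>C h) w = 0"
    using assms by (simp add: inner_eq_Re_cinner cinner_scaleC_left)
  hence "(norm (a *\<^sub>C h + w))\<^sup>2 = (norm (a *\<^sub>C h))\<^sup>2 + (norm w)\<^sup>2"
    using dot_norm[of "a *\<^sub>C h" w] by simp
  thus ?thesis by (simp add: norm_scaleC_hilbert assms)
qed

text \<open>A scalar matrix has the same norm on Hilbert space vectors as on scalars. Splitting off the
  component of all vectors along one nonzero \<open>v j0\<close> reduces that component to the scalar case and
  leaves an orthogonal remainder with fewer nonzero members.\<close>

lemma scalar_matrix_amplification:
  fixes x :: "'i \<Rightarrow> 'j \<Rightarrow> complex" and v :: "'j \<Rightarrow> 'h::complex_hilbert_space"
  assumes J: "finite J"
    and K: "\<And>c. (\<Sum>i\<in>I. (cmod (\<Sum>j\<in>J. x i j * c j))\<^sup>2) \<le> K * (\<Sum>j\<in>J. (cmod (c j))\<^sup>2)"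
  shows "(\<Sum>i\<in>I. (norm (\<Sum>j\<in>J. x i j *\<^sub>C v j))\<^sup>2) \<le> K * (\<Sum>j\<in>J. (norm (v j))\<^sup>2)"
proof (induction "card {j\<in>J. v j \<noteq> 0}" arbitrary: v rule: less_induct)
  case less
  show ?case
  proof (cases "\<exists>j0\<in>J. v j0 \<noteq> 0")
    case False
    hence "v j = 0" if "j \<in> J" for j using that by blast
    thus ?thesis by simp
  next
    case True
    then obtain j0 where j0: "j0 \<in> J" "v j0 \<noteq> 0" by blast
    define h where "h = complex_of_real (1 / norm (v j0)) *\<^sub>C v j0"
    have h: "norm h = 1" using j0 by (simp add: h_def norm_scaleC_hilbert norm_divide)
    define c where "c j = cinner h (v j)" for j
    define w where "w j = v j - c j *\<^sub>C h" for j
    have v: "v j = c j *\<^sub>C h + w j" for j by (simp add: w_def)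
    have hw: "cinner h (w j) = 0" for j
    proof -
      have "c j = cinner h (c j *\<^sub>C h + w j)" 
        unfolding v[of j, symmetric] by (rule c_def)
      thus ?thesis by (simp add: cinner_add_right cinner_scaleC_right cinner_self h)
    qed
    have "c j0 *\<^sub>C h = v j0"
      using j0 by (simp add: c_def h_def cinner_scaleC_left cinner_self scaleC_scaleC power2_eq_square)
    hence "w j0 = 0" by (simp add: w_def)
    moreover have "w j = 0" if "v j = 0" for j using that by (simp add: w_def c_def)
    ultimately have "{j\<in>J. w j \<noteq> 0} \<subseteq> {j\<in>J. v j \<noteq> 0}" "j0 \<notin> {j\<in>J. w j \<noteq> 0}" "j0 \<in> {j\<in>J. v j \<noteq> 0}"
      using j0 by auto
    hence "{j\<in>J. w j \<noteq> 0} \<subset> {j\<in>J. v j \<noteq> 0}" by (metis psubsetI)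
    hence "card {j\<in>J. w j \<noteq> 0} < card {j\<in>J. v j \<noteq> 0}" using J by (intro psubset_card_mono) auto
    note IH = less[OF this]
    have "(norm (\<Sum>j\<in>J. x i j *\<^sub>C v j))\<^sup>2 =
        (cmod (\<Sum>j\<in>J. x i j * c j))\<^sup>2 + (norm (\<Sum>j\<in>J. x i j *\<^sub>C w j))\<^sup>2" for i
    proof -
      have "(\<Sum>j\<in>J. x i j *\<^sub>C v j) = (\<Sum>j\<in>J. x i j * c j) *\<^sub>C h + (\<Sum>j\<in>J. x i j *\<^sub>C w j)"
        by (simp add: v scaleC_add_right scaleC_scaleC sum.distrib scaleC_sum_left)
      thus ?thesis
        using norm_orthogonal_add[OF h, of "\<Sum>j\<in>J. x i j *\<^sub>C w j"]
        by (simp add: cinner_sum_right cinner_scaleC_right hw)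
    qed
    hence "(\<Sum>i\<in>I. (norm (\<Sum>j\<in>J. x i j *\<^sub>C v j))\<^sup>2) =
        (\<Sum>i\<in>I. (cmod (\<Sum>j\<in>J. x i j * c j))\<^sup>2) + (\<Sum>i\<in>I. (norm (\<Sum>j\<in>J. x i j *\<^sub>C w j))\<^sup>2)"
      by (simp add: sum.distrib)
    also have "\<dots> \<le> K * (\<Sum>j\<in>J. (cmod (c j))\<^sup>2) + K * (\<Sum>j\<in>J. (norm (w j))\<^sup>2)"
      by (intro add_mono K IH)
    also have "\<dots> = K * (\<Sum>j\<in>J. (norm (v j))\<^sup>2)"
      by (simp add: v norm_orthogonal_add[OF h hw] sum.distrib distrib_left)
    finally show ?thesis .
  qed
qed

lemma Rep_ell2_sum: "Rep_ell2 (\<Sum>i\<in>I. f i) t = (\<Sum>i\<in>I. Rep_ell2 (f i) t)"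
  by (induction I rule: infinite_finite_induct) (auto simp: zero_ell2.rep_eq plus_ell2.rep_eq)

lemma ell2_eqI: "(\<And>t. Rep_ell2 \<xi> t = Rep_ell2 \<eta> t) \<Longrightarrow> \<xi> = \<eta>"
  by (rule Rep_ell2_inject[THEN iffD1, OF ext])

lemma bop_apply_zero_right [simp]: "T \<bullet>\<^sub>O 0 = 0"
  by (rule linear_0) (rule bounded_linear.linear[OF bounded_linear_bop_apply])

lemma bop_apply_scaleR: "T \<bullet>\<^sub>O (r *\<^sub>R x) = r *\<^sub>R T \<bullet>\<^sub>O x"
  by (rule linear_scale) (rule bounded_linear.linear[OF bounded_linear_bop_apply])

lemma bop_apply_sum_right: "T \<bullet>\<^sub>O (\<Sum>i\<in>I. f i) = (\<Sum>i\<in>I. T \<bullet>\<^sub>O f i)"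
  by (rule linear_sum) (simp add: bounded_linear.linear bounded_linear_bop_apply)

lemma bop_apply_sum_left: "(\<Sum>i\<in>I. T i) \<bullet>\<^sub>O \<xi> = (\<Sum>i\<in>I. T i \<bullet>\<^sub>O \<xi>)"
  by (induction I rule: infinite_finite_induct) (auto simp: bop_apply_simps)

definition finite_ell2 :: "'g set \<Rightarrow> ('g \<Rightarrow> 'h) \<Rightarrow> ('g, 'h::complex_hilbert_space) ell2"
  where "finite_ell2 J v = Abs_ell2 (\<lambda>t. if t \<in> J then v t else 0)"

lemma Rep_finite_ell2:
  assumes "finite J"
  shows "Rep_ell2 (finite_ell2 J v) t = (if t \<in> J then v t else 0)"
proof -
  have "finite {t \<in> UNIV. (norm (if t \<in> J then v t else 0))\<^sup>2 \<noteq> 0}"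
    by (rule finite_subset[OF _ assms]) auto
  hence "(\<lambda>t. (norm (if t \<in> J then v t else 0))\<^sup>2) summable_on UNIV"
    by (rule finite_nonzero_values_imp_summable_on)
  thus ?thesis unfolding finite_ell2_def by (subst Abs_ell2_inverse) auto
qed

lemma norm_finite_ell2:
  assumes "finite J"
  shows "(norm (finite_ell2 J v))\<^sup>2 = (\<Sum>t\<in>J. (norm (v t))\<^sup>2)"
proof (rule has_sum_unique[OF ell2_norm_power2])
  show "((\<lambda>t. (norm (Rep_ell2 (finite_ell2 J v) t))\<^sup>2) has_sum (\<Sum>t\<in>J. (norm (v t))\<^sup>2)) UNIV"
    by (rule has_sum_finite_neutralI[of J]) (use assms in \<open>auto simp: Rep_finite_ell2\<close>)
qed

lemma regular_unitary_add: "regular_unitary s * regular_unitary t = regular_unitary (s + t)"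
  by (rule bop_eqI, rule ell2_eqI)
    (simp add: bop_apply_simps Rep_regular_unitary minus_add add.assoc del: add_uminus_conv_diff)

lemma regular_unitary_0: "regular_unitary 0 = 1"
  by (rule bop_eqI, rule ell2_eqI) (simp add: bop_apply_simps Rep_regular_unitary)

lemma norm_regular_unitary_apply: "norm (regular_unitary s \<bullet>\<^sub>O \<xi>) = norm \<xi>"
proof -
  have b: "bij ((+) (- s))"
    by (intro bij_betwI[where g = "(+) s"]) (auto simp: add.assoc[symmetric])
  have "(norm (regular_unitary s \<bullet>\<^sub>O \<xi>))\<^sup>2 = (norm \<xi>)\<^sup>2"
  proof (rule has_sum_unique[OF ell2_norm_power2])
    show "((\<lambda>t. (norm (Rep_ell2 (regular_unitary s \<bullet>\<^sub>O \<xi>) t))\<^sup>2) has_sum (norm \<xi>)\<^sup>2) UNIV"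
      unfolding Rep_regular_unitary
      using has_sum_reindex_bij_betw[OF b, of "\<lambda>t. (norm (Rep_ell2 \<xi> t))\<^sup>2"] ell2_norm_power2[of \<xi>]
      by simp
  qed
  thus ?thesis by (rule power2_eq_imp_eq) auto
qed

lemma norm_regular_unitary_le: "norm (regular_unitary s) \<le> 1"
  by (rule norm_bop_bound) (simp_all add: norm_regular_unitary_apply)

lemma star_regular_unitary: "star (regular_unitary s) = regular_unitary (- s)"
proof (rule star_bop_eqI)
  fix \<xi> \<eta> :: "('a, 'b) ell2"
  have b: "bij ((+) (- s))"
    by (intro bij_betwI[where g = "(+) s"]) (auto simp: add.assoc[symmetric])
  have "cinner \<xi> (regular_unitary s \<bullet>\<^sub>O \<eta>) = (\<Sum>\<^sub>\<infinity>t. cinner (Rep_ell2 (regular_unitary (- s) \<bullet>\<^sub>O \<xi>) (- s + t)) (Rep_ell2 \<eta> (- s + t)))"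
    by (simp add: cinner_ell2.rep_eq Rep_regular_unitary)
  also have "\<dots> = cinner (regular_unitary (- s) \<bullet>\<^sub>O \<xi>) \<eta>"
    using infsum_reindex_bij_betw[OF b] by (simp add: cinner_ell2.rep_eq)
  finally show "cinner (regular_unitary (- s) \<bullet>\<^sub>O \<xi>) \<eta> = cinner \<xi> (regular_unitary s \<bullet>\<^sub>O \<eta>)" ..
qed

text \<open>An operator on \<open>\<ell>\<^sup>2(\<Gamma>, H)\<close> given by a scalar matrix with finite rows is bounded by the operator on
  \<open>\<ell>\<^sup>2(\<Gamma>)\<close> with the same matrix. This moves estimates for the left regular representation,
  such as plumpness, to \<open>\<ell>\<^sup>2(\<Gamma>, H)\<close>.\<close>

lemma norm_scalar_matrix_le:
  fixes S :: "('g, complex) ell2 bop" and S' :: "('g, 'h::complex_hilbert_space) ell2 bop"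
  assumes fin: "\<And>t. finite (J t)"
    and S: "\<And>\<xi> t. Rep_ell2 (S \<bullet>\<^sub>O \<xi>) t = (\<Sum>r\<in>J t. x t r *\<^sub>C Rep_ell2 \<xi> r)"
    and S': "\<And>\<xi> t. Rep_ell2 (S' \<bullet>\<^sub>O \<xi>) t = (\<Sum>r\<in>J t. x t r *\<^sub>C Rep_ell2 \<xi> r)"
  shows "norm S' \<le> norm S"
proof (rule norm_bop_bound)
  fix \<xi>
  show "norm (S' \<bullet>\<^sub>O \<xi>) \<le> norm S * norm \<xi>"
  proof (rule ell2_norm_bound)
    fix F :: "'g set" assume F: "finite F"
    define G where "G = (\<Union>t\<in>F. J t)"
    have G: "finite G" using F fin by (auto simp: G_def)
    define y where "y t r = (if r \<in> J t then x t r else 0)" for t r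
    have y: "(\<Sum>r\<in>J t. x t r *\<^sub>C v r) = (\<Sum>r\<in>G. y t r *\<^sub>C v r)" if "t \<in> F" for t and v :: "'g \<Rightarrow> 'k::complex_vector"
      using that G by (intro sum.mono_neutral_cong_left) (auto simp: G_def y_def)
    have "(\<Sum>t\<in>F. (norm (Rep_ell2 (S' \<bullet>\<^sub>O \<xi>) t))\<^sup>2) = (\<Sum>t\<in>F. (norm (\<Sum>r\<in>G. y t r *\<^sub>C Rep_ell2 \<xi> r))\<^sup>2)"
      by (intro sum.cong) (simp_all add: S' y)
    also have "\<dots> \<le> (norm S)\<^sup>2 * (\<Sum>r\<in>G. (norm (Rep_ell2 \<xi> r))\<^sup>2)"
    proof (rule scalar_matrix_amplification[OF G])
      fix c :: "'g \<Rightarrow> complex"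
      have "(\<Sum>r\<in>G. y t r * c r) = Rep_ell2 (S \<bullet>\<^sub>O finite_ell2 G c) t" if "t \<in> F" for t
        unfolding S y[OF that] using G by (simp add: Rep_finite_ell2 scaleC_complex_def)
      hence "(\<Sum>t\<in>F. (cmod (\<Sum>r\<in>G. y t r * c r))\<^sup>2) = (\<Sum>t\<in>F. (cmod (Rep_ell2 (S \<bullet>\<^sub>O finite_ell2 G c) t))\<^sup>2)"
        by simp
      also have "\<dots> \<le> (norm (S \<bullet>\<^sub>O finite_ell2 G c))\<^sup>2" by (rule ell2_sum_le[OF F])
      also have "\<dots> \<le> (norm S * norm (finite_ell2 G c))\<^sup>2" by (intro power_mono norm_bop_apply) simp
      finally show "(\<Sum>t\<in>F. (cmod (\<Sum>r\<in>G. y t r * c r))\<^sup>2) \<le> (norm S)\<^sup>2 * (\<Sum>r\<in>G. (cmod (c r))\<^sup>2)"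
        by (simp add: power_mult_distrib norm_finite_ell2[OF G])
    qed
    also have "\<dots> \<le> (norm S)\<^sup>2 * (norm \<xi>)\<^sup>2" by (intro mult_left_mono ell2_sum_le G) simp
    finally show "(\<Sum>t\<in>F. (norm (Rep_ell2 (S' \<bullet>\<^sub>O \<xi>) t))\<^sup>2) \<le> (norm S * norm \<xi>)\<^sup>2"
      by (simp add: power_mult_distrib)
  qed simp
qed simp

lemma norm_sum_regular_unitary_le:
  fixes f :: "nat \<Rightarrow> 'g::group_add"
  shows "norm (\<Sum>i<m. regular_unitary (f i) :: ('g, 'h::complex_hilbert_space) ell2 bop)
    \<le> norm (\<Sum>i<m. regular_unitary (f i) :: ('g, complex) ell2 bop)"
proof (rule norm_scalar_matrix_le)
  \<comment> \<open>Several indices can send \<open>t\<close> to the same \<open>r\<close>; the matrix entry counts them.\<close>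
  define J where "J t = (\<lambda>i. - f i + t) ` {..<m}" for t
  define x :: "'g \<Rightarrow> 'g \<Rightarrow> complex" where "x t r = (\<Sum>i<m. if r = - f i + t then 1 else 0)" for t r
  show "finite (J t)" for t by (simp add: J_def)
  have *: "Rep_ell2 ((\<Sum>i<m. regular_unitary (f i)) \<bullet>\<^sub>O \<xi>) t = (\<Sum>r\<in>J t. x t r *\<^sub>C Rep_ell2 \<xi> r)"
    for \<xi> :: "('g, 'k::complex_hilbert_space) ell2" and t
  proof -
    have "(\<Sum>r\<in>J t. x t r *\<^sub>C Rep_ell2 \<xi> r) = (\<Sum>i<m. \<Sum>r\<in>J t. if r = - f i + t then Rep_ell2 \<xi> r else 0)"
      unfolding x_def scaleC_sum_left by (subst sum.swap) (auto intro!: sum.cong)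
    also have "\<dots> = (\<Sum>i<m. Rep_ell2 \<xi> (- f i + t))"
      by (intro sum.cong refl) (simp add: J_def)
    finally show ?thesis by (simp add: bop_apply_sum_left Rep_ell2_sum Rep_regular_unitary)
  qed
  show "Rep_ell2 ((\<Sum>i<m. regular_unitary (f i)) \<bullet>\<^sub>O \<xi>) t = (\<Sum>r\<in>J t. x t r *\<^sub>C Rep_ell2 \<xi> r)"
    for \<xi> :: "('g, complex) ell2" and t by (rule *)
  show "Rep_ell2 ((\<Sum>i<m. regular_unitary (f i)) \<bullet>\<^sub>O \<xi>) t = (\<Sum>r\<in>J t. x t r *\<^sub>C Rep_ell2 \<xi> r)"
    for \<xi> :: "('g, 'h) ell2" and t by (rule *)
qed

lemma matrix_norm_bdd_above:
  fixes T :: "nat \<Rightarrow> nat \<Rightarrow> 'h::complex_hilbert_space bop"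
  shows "bdd_above ((\<lambda>x. sqrt (\<Sum>i<n. (norm (\<Sum>j<n. T i j \<bullet>\<^sub>O x j))\<^sup>2)) ` {x. (\<Sum>j<n. (norm (x j))\<^sup>2) \<le> 1})"
proof (rule bdd_aboveI2)
  fix x :: "nat \<Rightarrow> 'h" assume x: "x \<in> {x. (\<Sum>j<n. (norm (x j))\<^sup>2) \<le> 1}"
  have x1: "norm (x j) \<le> 1" if "j < n" for j
  proof -
    have "(norm (x j))\<^sup>2 \<le> (\<Sum>j<n. (norm (x j))\<^sup>2)" using that by (intro member_le_sum) auto
    also have "\<dots> \<le> 1\<^sup>2" using x by simp
    finally show ?thesis by (rule power2_le_imp_le) simp
  qed
  have "norm (\<Sum>j<n. T i j \<bullet>\<^sub>O x j) \<le> (\<Sum>j<n. norm (T i j))" for i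
  proof (rule sum_norm_le)
    fix j assume "j \<in> {..<n}"
    thus "norm (T i j \<bullet>\<^sub>O x j) \<le> norm (T i j)"
      using norm_bop_apply[of "T i j" "x j"] mult_left_le[OF x1[of j] norm_ge_zero[of "T i j"]] by simp
  qed
  thus "sqrt (\<Sum>i<n. (norm (\<Sum>j<n. T i j \<bullet>\<^sub>O x j))\<^sup>2) \<le> sqrt (\<Sum>i<n. (\<Sum>j<n. norm (T i j))\<^sup>2)"
    by (intro real_sqrt_le_mono sum_mono power_mono) auto
qed

lemma matrix_norm_upper:
  assumes "(\<Sum>j<n. (norm (x j))\<^sup>2) \<le> 1"
  shows "sqrt (\<Sum>i<n. (norm (\<Sum>j<n. T i j \<bullet>\<^sub>O x j))\<^sup>2) \<le> matrix_norm n T"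
  unfolding matrix_norm_def by (rule cSUP_upper[OF _ matrix_norm_bdd_above]) (use assms in simp)

lemma matrix_norm_nonneg: "0 \<le> matrix_norm n T"
  using matrix_norm_upper[where x = "\<lambda>_. 0" and n = n and T = T] by simp

lemma matrix_norm_least:
  fixes T :: "nat \<Rightarrow> nat \<Rightarrow> 'h::complex_hilbert_space bop"
  assumes "\<And>x. (\<Sum>j<n. (norm (x j))\<^sup>2) \<le> 1 \<Longrightarrow> sqrt (\<Sum>i<n. (norm (\<Sum>j<n. T i j \<bullet>\<^sub>O x j))\<^sup>2) \<le> K"
  shows "matrix_norm n T \<le> K"
  unfolding matrix_norm_def using assms by (intro cSUP_least) (auto intro!: exI[of _ "\<lambda>_. 0"])

lemma matrix_norm_apply:
  fixes T :: "nat \<Rightarrow> nat \<Rightarrow> 'h::complex_hilbert_space bop"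
  shows "(\<Sum>i<n. (norm (\<Sum>j<n. T i j \<bullet>\<^sub>O x j))\<^sup>2) \<le> (matrix_norm n T)\<^sup>2 * (\<Sum>j<n. (norm (x j))\<^sup>2)"
proof -
  define N where "N = sqrt (\<Sum>j<n. (norm (x j))\<^sup>2)"
  have N2: "N\<^sup>2 = (\<Sum>j<n. (norm (x j))\<^sup>2)" by (simp add: N_def sum_nonneg)
  have N0: "0 \<le> N" by (simp add: N_def sum_nonneg)
  show ?thesis
  proof (cases "N = 0")
    case True
    hence "\<forall>j<n. x j = 0" using N2 by (simp add: sum_nonneg_eq_0_iff)
    thus ?thesis by simp
  next
    case False
    define y where "y j = (1 / N) *\<^sub>R x j" for j
    have xy: "x j = N *\<^sub>R y j" for j using False by (simp add: y_def)
    have "(\<Sum>j<n. (norm (y j))\<^sup>2) = (1 / N)\<^sup>2 * N\<^sup>2"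
      unfolding N2 sum_distrib_left by (intro sum.cong) (auto simp: y_def power_mult_distrib power_divide)
    hence "(\<Sum>j<n. (norm (y j))\<^sup>2) \<le> 1" using False by (simp add: power_divide)
    from matrix_norm_upper[OF this, of T]
    have "(\<Sum>i<n. (norm (\<Sum>j<n. T i j \<bullet>\<^sub>O y j))\<^sup>2) \<le> (matrix_norm n T)\<^sup>2"
      by (rule sqrt_le_D)
    hence "N\<^sup>2 * (\<Sum>i<n. (norm (\<Sum>j<n. T i j \<bullet>\<^sub>O y j))\<^sup>2) \<le> N\<^sup>2 * (matrix_norm n T)\<^sup>2"
      by (intro mult_left_mono) auto
    moreover have "(norm (\<Sum>j<n. T i j \<bullet>\<^sub>O x j))\<^sup>2 = N\<^sup>2 * (norm (\<Sum>j<n. T i j \<bullet>\<^sub>O y j))\<^sup>2" for i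
      by (simp add: xy bop_apply_scaleR power_mult_distrib flip: scaleR_sum_right)
    ultimately show ?thesis by (simp add: sum_distrib_left mult.commute flip: N2)
  qed
qed

lemma regular_unitary_in_group_algebra: "regular_unitary s \<in> reduced_group_algebra"
  unfolding reduced_group_algebra_def by (rule hull_inc) simp

lemma cstar_subalgebra_hull: "cstar_subalgebra (cstar_subalgebra hull X)"
proof (rule hull_in)
  show "cstar_subalgebra (\<Inter> \<S>)" if "\<forall>S\<in>\<S>. cstar_subalgebra S" for \<S>
    using that unfolding cstar_subalgebra_def by (auto intro!: closed_Inter)
qed

text \<open>A completely bounded multiplier \<open>u\<close> gives the Schur multiplier \<open>u(t r\<inverse>)\<close>. The matrix with entries
  \<open>x\<^sub>t\<^sub>r \<lambda>\<^bsub>t r\<inverse>\<^esub>\<close> is \<open>x\<close> conjugated by the diagonal unitary with entries \<open>\<lambda>\<^sub>t\<close>, so it has the norm of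
  \<open>x\<close>. Its image under the multiplier map has entries \<open>u(t r\<inverse>) x\<^sub>t\<^sub>r \<lambda>\<^bsub>t r\<inverse>\<^esub>\<close> and is tested on the
  vectors \<open>c\<^sub>r \<delta>\<^sub>r\<close>. The set \<open>I\<close> is enumerated since matrices over the operators are indexed by
  natural numbers.\<close>

lemma Herz_Schur_multiplier_bound:
  fixes u :: "'g::group_add \<Rightarrow> complex"
  assumes u: "cb_multiplier_bound u C" and I: "finite I" and K0: "0 \<le> K"
    and K: "\<And>c. (\<Sum>t\<in>I. (cmod (\<Sum>r\<in>I. x t r * c r))\<^sup>2) \<le> K\<^sup>2 * (\<Sum>r\<in>I. (cmod (c r))\<^sup>2)"
  shows "(\<Sum>t\<in>I. (cmod (\<Sum>r\<in>I. u (t - r) * x t r * c r))\<^sup>2) \<le> (C * K)\<^sup>2 * (\<Sum>r\<in>I. (cmod (c r))\<^sup>2)"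
proof -
  obtain \<Phi> :: "('g, complex) ell2 bop \<Rightarrow> ('g, complex) ell2 bop" where
    \<Phi>: "\<And>s. \<Phi> (regular_unitary s) = u s *\<^sub>C regular_unitary s" and cb: "cb_bounded_on reduced_group_algebra \<Phi> C"
    using u by (auto simp: cb_multiplier_bound_def)
  have C0: "0 \<le> C" using cb by (simp add: cb_bounded_on_def)
  define n where "n = card I"
  obtain e where e: "bij_betw e {..<n} I"
    using ex_bij_betw_nat_finite[OF I] by (auto simp: n_def atLeast0LessThan)
  have reindex: "(\<Sum>t\<in>I. f t) = (\<Sum>i<n. f (e i))" for f :: "'g \<Rightarrow> 'z::comm_monoid_add"
    by (rule sum.reindex_bij_betw[OF e, symmetric])
  define T :: "nat \<Rightarrow> nat \<Rightarrow> ('g, complex) ell2 bop"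
    where "T i j = x (e i) (e j) *\<^sub>C regular_unitary (e i - e j)" for i j
  have TR: "T i j \<in> reduced_group_algebra" for i j
    using cstar_subalgebra_hull[of "range (regular_unitary :: 'g \<Rightarrow> ('g, complex) ell2 bop)"]
      regular_unitary_in_group_algebra
    unfolding T_def reduced_group_algebra_def cstar_subalgebra_def by blast
  have \<Phi>T: "\<Phi> (T i j) = (u (e i - e j) * x (e i) (e j)) *\<^sub>C regular_unitary (e i - e j)" for i j
  proof -
    have "\<Phi> (x (e i) (e j) *\<^sub>C regular_unitary (e i - e j)) = x (e i) (e j) *\<^sub>C \<Phi> (regular_unitary (e i - e j))"
      using cb regular_unitary_in_group_algebra unfolding cb_bounded_on_def by blast
    thus ?thesis by (simp add: T_def \<Phi> scaleC_scaleC mult.commute)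
  qed
  have "matrix_norm n T \<le> K"
  proof (rule matrix_norm_least)
    fix v :: "nat \<Rightarrow> ('g, complex) ell2" assume v: "(\<Sum>j<n. (norm (v j))\<^sup>2) \<le> 1"
    define w where "w j = regular_unitary (- e j) \<bullet>\<^sub>O v j" for j
    have "T i j \<bullet>\<^sub>O v j = regular_unitary (e i) \<bullet>\<^sub>O (x (e i) (e j) *\<^sub>C w j)" for i j
      by (simp add: T_def w_def bop_apply_simps bop_apply_scaleC regular_unitary_add[symmetric] diff_conv_add_uminus del: add_uminus_conv_diff)
    hence "(\<Sum>i<n. (norm (\<Sum>j<n. T i j \<bullet>\<^sub>O v j))\<^sup>2) = (\<Sum>i<n. (norm (\<Sum>j<n. x (e i) (e j) *\<^sub>C w j))\<^sup>2)"
      by (simp add: bop_apply_sum_right[symmetric] norm_regular_unitary_apply)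
    also have "\<dots> \<le> K\<^sup>2 * (\<Sum>j<n. (norm (w j))\<^sup>2)"
    proof (rule scalar_matrix_amplification)
      fix c :: "nat \<Rightarrow> complex"
      define c' where "c' r = c (inv_into {..<n} e r)" for r
      have "c' (e j) = c j" if "j < n" for j
        using bij_betw_inv_into_left[OF e] that by (simp add: c'_def)
      thus "(\<Sum>i<n. (cmod (\<Sum>j<n. x (e i) (e j) * c j))\<^sup>2) \<le> K\<^sup>2 * (\<Sum>j<n. (cmod (c j))\<^sup>2)"
        using K[of c'] by (simp add: reindex)
    qed simp
    also have "(\<Sum>j<n. (norm (w j))\<^sup>2) = (\<Sum>j<n. (norm (v j))\<^sup>2)"
      by (simp add: w_def norm_regular_unitary_apply)
    also have "K\<^sup>2 * \<dots> \<le> K\<^sup>2" using v by (simp add: mult_left_le)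
    finally show "sqrt (\<Sum>i<n. (norm (\<Sum>j<n. T i j \<bullet>\<^sub>O v j))\<^sup>2) \<le> K"
      using K0 by (simp add: real_le_lsqrt)
  qed
  hence "matrix_norm n (\<lambda>i j. \<Phi> (T i j)) \<le> C * K"
    using cb TR C0 unfolding cb_bounded_on_def by (meson mult_left_mono order_trans)
  hence CK: "(matrix_norm n (\<lambda>i j. \<Phi> (T i j)))\<^sup>2 \<le> (C * K)\<^sup>2"
    by (intro power_mono matrix_norm_nonneg)
  define \<delta> :: "'g \<Rightarrow> ('g, complex) ell2" where "\<delta> t = finite_ell2 {t} (\<lambda>_. 1)" for t
  have norm_\<delta>: "norm (\<delta> t) = 1" for t
    by (rule power2_eq_imp_eq) (simp_all add: \<delta>_def norm_finite_ell2)
  have shift: "regular_unitary (t - r) \<bullet>\<^sub>O \<delta> r = \<delta> t" for t r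
  proof (rule ell2_eqI)
    fix q
    have "- (t - r) + q = r \<longleftrightarrow> q = t"
      by (metis add_minus_cancel diff_add_cancel minus_add_cancel)
    thus "Rep_ell2 (regular_unitary (t - r) \<bullet>\<^sub>O \<delta> r) q = Rep_ell2 (\<delta> t) q"
      by (simp add: Rep_regular_unitary \<delta>_def Rep_finite_ell2 del: minus_diff_eq)
  qed
  define v where "v j = c (e j) *\<^sub>C \<delta> (e j)" for j
  have norm_v: "norm (v j) = cmod (c (e j))" for j
    by (simp add: v_def norm_scaleC_hilbert norm_\<delta>)
  have "(\<Sum>j<n. \<Phi> (T i j) \<bullet>\<^sub>O v j) = (\<Sum>j<n. u (e i - e j) * x (e i) (e j) * c (e j)) *\<^sub>C \<delta> (e i)" for i
    by (simp add: \<Phi>T v_def bop_apply_simps bop_apply_scaleC shift scaleC_scaleC scaleC_sum_left mult_ac)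
  hence "(\<Sum>t\<in>I. (cmod (\<Sum>r\<in>I. u (t - r) * x t r * c r))\<^sup>2) = (\<Sum>i<n. (norm (\<Sum>j<n. \<Phi> (T i j) \<bullet>\<^sub>O v j))\<^sup>2)"
    by (simp add: reindex norm_scaleC_hilbert norm_\<delta>)
  also have "\<dots> \<le> (matrix_norm n (\<lambda>i j. \<Phi> (T i j)))\<^sup>2 * (\<Sum>j<n. (norm (v j))\<^sup>2)"
    by (rule matrix_norm_apply)
  also have "\<dots> \<le> (C * K)\<^sup>2 * (\<Sum>j<n. (norm (v j))\<^sup>2)"
    by (intro mult_right_mono CK sum_nonneg) auto
  finally show ?thesis by (simp add: reindex norm_v)
qed

section \<open>Fourier polynomials in the reduced crossed product\<close>

lemma norm_Rep_ell2_le: "norm (Rep_ell2 \<xi> t) \<le> norm \<xi>"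
  using ell2_sum_le[of "{t}" \<xi>] by (auto intro: power2_le_imp_le)

lemma cstar_subalgebra_closure:
  fixes P :: "'a::cstar_algebra set"
  assumes zero: "0 \<in> P" and add: "\<And>x y. x \<in> P \<Longrightarrow> y \<in> P \<Longrightarrow> x + y \<in> P"
    and mult: "\<And>x y. x \<in> P \<Longrightarrow> y \<in> P \<Longrightarrow> x * y \<in> P"
    and star: "\<And>x. x \<in> P \<Longrightarrow> star x \<in> P" and scale: "\<And>c x. x \<in> P \<Longrightarrow> c *\<^sub>C x \<in> P"
  shows "cstar_subalgebra (closure P)"
proof -
  have limit: "l \<in> closure P" if "f \<longlonglongrightarrow> l" "\<And>n :: nat. f n \<in> P" for f l
    unfolding closure_sequential using that by blast
  have "x + y \<in> closure P \<and> x * y \<in> closure P" if xy: "x \<in> closure P" "y \<in> closure P" for x y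
  proof -
    obtain X where X: "\<And>n. X n \<in> P" "X \<longlonglongrightarrow> x" using xy(1) by (auto simp: closure_sequential)
    obtain Y where Y: "\<And>n. Y n \<in> P" "Y \<longlonglongrightarrow> y" using xy(2) by (auto simp: closure_sequential)
    have "\<And>n. X n + Y n \<in> P" "\<And>n. X n * Y n \<in> P" using X(1) Y(1) by (simp_all add: add mult)
    thus ?thesis using limit[OF tendsto_add[OF X(2) Y(2)]] limit[OF tendsto_mult[OF X(2) Y(2)]] by simp
  qed
  moreover have "star x \<in> closure P \<and> (\<forall>c. c *\<^sub>C x \<in> closure P)" if x: "x \<in> closure P" for x
  proof -
    obtain X where X: "\<And>n. X n \<in> P" "X \<longlonglongrightarrow> x" using x by (auto simp: closure_sequential)
    have "bounded_linear (\<lambda>x :: 'a. c *\<^sub>C x)" for c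
      by (rule bounded_linear_intro[where K = "cmod c"])
        (auto simp: norm_scaleC scaleC_add_right scaleR_scaleC scaleC_scaleC mult.commute)
    from bounded_linear.tendsto[OF this X(2)] bounded_linear.tendsto[OF bounded_linear_star X(2)]
    have lim: "(\<lambda>n. c *\<^sub>C X n) \<longlonglongrightarrow> c *\<^sub>C x" "(\<lambda>n. star (X n)) \<longlonglongrightarrow> star x" for c .
    have "\<And>n. star (X n) \<in> P" "\<And>c n. c *\<^sub>C X n \<in> P" using X(1) by (simp_all add: star scale)
    thus ?thesis using limit[OF lim(1)] limit[OF lim(2)] by simp
  qed
  ultimately show ?thesis
    using zero closure_subset[of P] unfolding cstar_subalgebra_def by (simp add: subset_iff)
qed

lemma cstar_subalgebra_sum:
  "cstar_subalgebra S \<Longrightarrow> (\<And>i. i \<in> I \<Longrightarrow> f i \<in> S) \<Longrightarrow> (\<Sum>i\<in>I. f i) \<in> S"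
  by (induction I rule: infinite_finite_induct) (auto simp: cstar_subalgebra_def)

locale covariant_system =
  fixes \<alpha> :: "'g::group_add \<Rightarrow> 'a::cstar_algebra \<Rightarrow> 'a"
    and \<rho> :: "'a \<Rightarrow> 'h::complex_hilbert_space bop"
  assumes action: "cstar_action \<alpha>" and faithful: "faithful_rep \<rho>"
begin

abbreviation \<pi> :: "'a \<Rightarrow> ('g, 'h) ell2 bop" where "\<pi> \<equiv> covariant_rep \<rho> \<alpha>"

abbreviation U :: "'g \<Rightarrow> ('g, 'h) ell2 bop" where "U \<equiv> regular_unitary"

lemma \<rho>_hom: "star_hom \<rho>" and \<rho>_1 [simp]: "\<rho> 1 = 1"
  using faithful by (auto simp: faithful_rep_def)

lemma \<alpha>_hom: "star_hom (\<alpha> s)" and \<alpha>_0 [simp]: "\<alpha> 0 a = a" and \<alpha>_add: "\<alpha> (s + t) a = \<alpha> s (\<alpha> t a)"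
  using action by (auto simp: cstar_action_def)

lemma \<alpha>_1 [simp]: "\<alpha> s 1 = 1"
proof -
  obtain e where "\<alpha> s e = 1" using action unfolding cstar_action_def by (metis bij_pointE)
  hence "\<alpha> s 1 * 1 = 1" using star_hom_simps(2)[OF \<alpha>_hom, of s 1 e] by simp
  thus ?thesis by simp
qed

lemmas \<rho>_simps = star_hom_simps[OF \<rho>_hom] and \<alpha>_simps = star_hom_simps[OF \<alpha>_hom]

lemma norm_\<rho>_\<alpha>_le: "norm (\<rho> (\<alpha> s a)) \<le> norm a"
  by (rule star_hom_contractive[of "\<lambda>a. \<rho> (\<alpha> s a)"])
    (simp_all add: star_hom_def \<rho>_simps \<alpha>_simps)

lemma Rep_\<pi>: "Rep_ell2 (\<pi> a \<bullet>\<^sub>O \<xi>) t = \<rho> (\<alpha> (- t) a) \<bullet>\<^sub>O Rep_ell2 \<xi> t"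
  by (rule Rep_covariant_rep) (rule norm_\<rho>_\<alpha>_le)

lemma \<pi>_hom: "star_hom \<pi>"
proof -
  have "\<pi> (star a) = star (\<pi> a)" for a
  proof (rule star_bop_eqI[symmetric])
    show "cinner (\<pi> (star a) \<bullet>\<^sub>O \<xi>) \<eta> = cinner \<xi> (\<pi> a \<bullet>\<^sub>O \<eta>)" for \<xi> \<eta>
      by (simp add: cinner_ell2.rep_eq Rep_\<pi> \<rho>_simps \<alpha>_simps cinner_star_bop)
  qed
  moreover have "\<pi> (a + b) = \<pi> a + \<pi> b" "\<pi> (a * b) = \<pi> a * \<pi> b" "\<pi> (c *\<^sub>C a) = c *\<^sub>C \<pi> a" for a b c
    by (rule bop_eqI, rule ell2_eqI,
        simp add: bop_apply_simps Rep_\<pi> \<rho>_simps \<alpha>_simps plus_ell2.rep_eq scaleC_ell2.rep_eq)+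
  ultimately show ?thesis by (simp add: star_hom_def)
qed

lemmas \<pi>_simps = star_hom_simps[OF \<pi>_hom]

lemma \<pi>_1: "\<pi> 1 = 1"
  by (rule bop_eqI, rule ell2_eqI) (simp add: bop_apply_simps Rep_\<pi>)

lemma norm_\<pi>_le: "norm (\<pi> a) \<le> norm a"
  by (rule star_hom_contractive[OF \<pi>_hom \<pi>_1])

lemma tendsto_\<pi>: "(f \<longlongrightarrow> a) F \<Longrightarrow> ((\<lambda>x. \<pi> (f x)) \<longlongrightarrow> \<pi> a) F"
  by (rule bounded_linear.tendsto[OF bounded_linear_intro[where K = 1]])
    (auto simp: \<pi>_simps norm_\<pi>_le)

lemma covariance: "U s * \<pi> a = \<pi> (\<alpha> s a) * U s"
proof (rule bop_eqI, rule ell2_eqI)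
  fix \<xi> t
  have "\<alpha> (- (- s + t)) a = \<alpha> (- t) (\<alpha> s a)"
    by (simp add: minus_add \<alpha>_add[symmetric] del: add_uminus_conv_diff)
  thus "Rep_ell2 ((U s * \<pi> a) \<bullet>\<^sub>O \<xi>) t = Rep_ell2 ((\<pi> (\<alpha> s a) * U s) \<bullet>\<^sub>O \<xi>) t"
    by (simp add: bop_apply_simps Rep_\<pi> Rep_regular_unitary)
qed

lemma \<pi>_\<alpha>: "\<pi> (\<alpha> s a) = U s * \<pi> a * U (- s)"
  by (simp add: covariance mult.assoc regular_unitary_add regular_unitary_0)

definition fourier_poly :: "('g \<Rightarrow> 'a) \<Rightarrow> ('g, 'h) ell2 bop"
  where "fourier_poly a = (\<Sum>s | a s \<noteq> 0. \<pi> (a s) * U s)"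

lemma fourier_poly_eq:
  "finite F \<Longrightarrow> {s. a s \<noteq> 0} \<subseteq> F \<Longrightarrow> fourier_poly a = (\<Sum>s\<in>F. \<pi> (a s) * U s)"
  unfolding fourier_poly_def by (rule sum.mono_neutral_left) (auto simp: \<pi>_simps)

lemma fourier_poly_add:
  assumes "finite {s. a s \<noteq> 0}" "finite {s. b s \<noteq> 0}"
  shows "fourier_poly (\<lambda>s. a s + b s) = fourier_poly a + fourier_poly b"
proof -
  define F where "F = {s. a s \<noteq> 0} \<union> {s. b s \<noteq> 0}"
  have "finite F" "{s. a s \<noteq> 0} \<subseteq> F" "{s. b s \<noteq> 0} \<subseteq> F" "{s. a s + b s \<noteq> 0} \<subseteq> F"
    using assms by (auto simp: F_def)
  thus ?thesis by (simp add: fourier_poly_eq[of F] \<pi>_simps distrib_right sum.distrib)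
qed

lemma fourier_poly_scaleC:
  assumes "finite {s. a s \<noteq> 0}"
  shows "fourier_poly (\<lambda>s. c *\<^sub>C a s) = c *\<^sub>C fourier_poly a"
proof -
  have "{s. c *\<^sub>C a s \<noteq> 0} \<subseteq> {s. a s \<noteq> 0}" by auto
  thus ?thesis
    by (simp add: fourier_poly_eq[OF assms] \<pi>_simps mult_scaleC_left scaleC_sum_right)
qed

lemma fourier_poly_diff:
  assumes "finite {s. a s \<noteq> 0}" "finite {s. b s \<noteq> 0}"
  shows "fourier_poly (\<lambda>s. a s - b s) = fourier_poly a - fourier_poly b"
proof -
  have "finite {s. a s - b s \<noteq> 0}"
    by (rule finite_subset[OF _ finite_UnI[OF assms]]) auto
  from fourier_poly_add[OF this assms(2)] show ?thesis by simp
qed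

text \<open>The substitution \<open>r = s\<inverse> t\<close> displays the operator as the matrix with entries
  \<open>\<rho> (\<alpha>\<^bsub>t\<inverse>\<^esub> (a\<^bsub>t r\<inverse>\<^esub>))\<close>. The set \<open>I\<close> only has to contain the indices in row \<open>t\<close> where the vector and the
  coefficient are both nonzero.\<close>

lemma fourier_poly_apply:
  assumes a: "finite {s. a s \<noteq> 0}" and I: "finite I"
    and supp: "\<And>s. a s \<noteq> 0 \<Longrightarrow> - s + t \<notin> I \<Longrightarrow> Rep_ell2 \<xi> (- s + t) = 0"
  shows "Rep_ell2 (fourier_poly a \<bullet>\<^sub>O \<xi>) t = (\<Sum>r\<in>I. \<rho> (\<alpha> (- t) (a (t - r))) \<bullet>\<^sub>O Rep_ell2 \<xi> r)"
proof -
  define f where "f s = \<rho> (\<alpha> (- t) (a s)) \<bullet>\<^sub>O Rep_ell2 \<xi> (- s + t)" for s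
  have inj: "inj_on (\<lambda>r. t - r) I" by (rule inj_on_inverseI[of _ "\<lambda>q. - q + t"]) simp
  have "Rep_ell2 (fourier_poly a \<bullet>\<^sub>O \<xi>) t = (\<Sum>s | a s \<noteq> 0. f s)"
    by (simp add: fourier_poly_def bop_apply_sum_left Rep_ell2_sum bop_apply_simps Rep_\<pi>
        Rep_regular_unitary f_def)
  also have "\<dots> = (\<Sum>s\<in>(\<lambda>r. t - r) ` I. f s)"
  proof (rule sum.mono_neutral_cong)
    show "f s = 0" if "s \<in> (\<lambda>r. t - r) ` I - {s. a s \<noteq> 0}" for s
      using that by (simp add: f_def \<rho>_simps \<alpha>_simps bop_apply_simps)
    show "f s = 0" if "s \<in> {s. a s \<noteq> 0} - (\<lambda>r. t - r) ` I" for s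
    proof -
      have "- s + t \<notin> I"
      proof
        assume "- s + t \<in> I"
        hence "t - (- s + t) \<in> (\<lambda>r. t - r) ` I" by blast
        moreover have "t - (- s + t) = s"
          by (simp add: diff_conv_add_uminus minus_add add.assoc[symmetric] del: add_uminus_conv_diff)
        ultimately show False using that by simp
      qed
      thus ?thesis using supp[of s] that by (simp add: f_def)
    qed
  qed (use a I in auto)
  also have "\<dots> = (\<Sum>r\<in>I. \<rho> (\<alpha> (- t) (a (t - r))) \<bullet>\<^sub>O Rep_ell2 \<xi> r)"
    by (simp add: sum.reindex[OF inj] f_def)
  finally show ?thesis .
qed

text \<open>The matrix entry in row \<open>0\<close> and column \<open>- s\<close> is \<open>\<rho> (a s)\<close>, and \<open>\<rho>\<close> is isometric.\<close>

lemma norm_fourier_coeff_le: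
  assumes "finite {s. a s \<noteq> 0}"
  shows "norm (a s) \<le> norm (fourier_poly a)"
proof -
  have "norm (\<rho> (a s)) \<le> norm (fourier_poly a)"
  proof (rule norm_bop_bound)
    fix h
    define \<xi> :: "('g, 'h) ell2" where "\<xi> = finite_ell2 {- s} (\<lambda>_. h)"
    have "Rep_ell2 (fourier_poly a \<bullet>\<^sub>O \<xi>) 0 = (\<Sum>r\<in>{- s}. \<rho> (\<alpha> (- 0) (a (0 - r))) \<bullet>\<^sub>O Rep_ell2 \<xi> r)"
      by (rule fourier_poly_apply[OF assms]) (auto simp: \<xi>_def Rep_finite_ell2)
    hence "norm (\<rho> (a s) \<bullet>\<^sub>O h) = norm (Rep_ell2 (fourier_poly a \<bullet>\<^sub>O \<xi>) 0)"
      by (simp add: \<xi>_def Rep_finite_ell2)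
    also have "\<dots> \<le> norm (fourier_poly a) * norm \<xi>"
      using norm_Rep_ell2_le norm_bop_apply by (rule order_trans)
    also have "norm \<xi> = norm h"
      by (rule power2_eq_imp_eq) (simp_all add: \<xi>_def norm_finite_ell2)
    finally show "norm (\<rho> (a s) \<bullet>\<^sub>O h) \<le> norm (fourier_poly a) * norm h" .
  qed simp
  thus ?thesis by (simp add: injective_rep_isometric[OF faithful])
qed

text \<open>The multiplier acts on operator matrices by the Schur multiplier \<open>u(t r\<inverse>)\<close>. To pass to scalar
  matrices, the entry \<open>X\<^sub>t\<^sub>r\<close> is compressed to the number \<open>\<langle>\<zeta>'\<^sub>t, X\<^sub>t\<^sub>r \<xi>'\<^sub>r\<rangle>\<close>, where \<open>\<xi>'\<close> and \<open>\<zeta>'\<close> are the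
  normalised components of the vector and of its image. Normalisation keeps the compression
  bounded by the operator, and the lengths of the components become the scalar vector to which
  the Schur multiplier bound is applied.\<close>

lemma norm_multiplier_le:
  assumes u: "cb_multiplier_bound u C" and a: "finite {s. a s \<noteq> 0}"
  shows "norm (fourier_poly (\<lambda>s. u s *\<^sub>C a s)) \<le> C * norm (fourier_poly a)"
proof -
  define T where "T = fourier_poly a"
  define T' where "T' = fourier_poly (\<lambda>s. u s *\<^sub>C a s)"
  have C: "0 \<le> C" using u by (auto simp: cb_multiplier_bound_def cb_bounded_on_def)
  have ua: "finite {s. u s *\<^sub>C a s \<noteq> 0}" by (rule finite_subset[OF _ a]) auto
  have "norm T' \<le> C * norm T"
  proof (rule norm_bop_bound)
    fix \<xi>
    show "norm (T' \<bullet>\<^sub>O \<xi>) \<le> C * norm T * norm \<xi>"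
    proof (rule ell2_norm_bound)
      fix F :: "'g set" assume F: "finite F"
      define I where "I = F \<union> (\<Union>t\<in>F. (\<lambda>s. - s + t) ` {s. a s \<noteq> 0})"
      have I: "finite I" using F a by (auto simp: I_def)
      define X where "X t r = \<rho> (\<alpha> (- t) (a (t - r)))" for t r
      define \<zeta> where "\<zeta> t = (if t \<in> F then Rep_ell2 (T' \<bullet>\<^sub>O \<xi>) t else 0)" for t
      define x where "x t r = cinner (sgn (\<zeta> t)) (X t r \<bullet>\<^sub>O sgn (Rep_ell2 \<xi> r))" for t r
      have sgn_le: "norm (sgn v) \<le> 1" for v :: 'h by (simp add: norm_sgn)
      have bound: "(\<Sum>t\<in>I. (cmod (\<Sum>r\<in>I. x t r * c r))\<^sup>2) \<le> (norm T)\<^sup>2 * (\<Sum>r\<in>I. (cmod (c r))\<^sup>2)" for c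
      proof -
        define w where "w = finite_ell2 I (\<lambda>r. c r *\<^sub>C sgn (Rep_ell2 \<xi> r))"
        have "cmod (\<Sum>r\<in>I. x t r * c r) \<le> norm (Rep_ell2 (T \<bullet>\<^sub>O w) t)" for t
        proof -
          have "Rep_ell2 (T \<bullet>\<^sub>O w) t = (\<Sum>r\<in>I. X t r \<bullet>\<^sub>O Rep_ell2 w r)"
            unfolding T_def X_def by (rule fourier_poly_apply[OF a I]) (simp add: w_def Rep_finite_ell2 I)
          also have "\<dots> = (\<Sum>r\<in>I. c r *\<^sub>C X t r \<bullet>\<^sub>O sgn (Rep_ell2 \<xi> r))"
            by (intro sum.cong) (simp_all add: w_def Rep_finite_ell2 I bop_apply_scaleC)
          finally have "(\<Sum>r\<in>I. x t r * c r) = cinner (sgn (\<zeta> t)) (Rep_ell2 (T \<bullet>\<^sub>O w) t)"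
            by (simp add: cinner_sum_right cinner_scaleC_right x_def mult.commute)
          thus ?thesis
            using cinner_Cauchy_Schwarz[of "sgn (\<zeta> t)" "Rep_ell2 (T \<bullet>\<^sub>O w) t"]
              mult_right_mono[OF sgn_le[of "\<zeta> t"] norm_ge_zero[of "Rep_ell2 (T \<bullet>\<^sub>O w) t"]]
            by simp
        qed
        hence "(\<Sum>t\<in>I. (cmod (\<Sum>r\<in>I. x t r * c r))\<^sup>2) \<le> (\<Sum>t\<in>I. (norm (Rep_ell2 (T \<bullet>\<^sub>O w) t))\<^sup>2)"
          by (intro sum_mono power_mono) auto
        also have "\<dots> \<le> (norm (T \<bullet>\<^sub>O w))\<^sup>2" by (rule ell2_sum_le[OF I])
        also have "\<dots> \<le> (norm T * norm w)\<^sup>2" by (intro power_mono norm_bop_apply) simp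
        also have "\<dots> = (norm T)\<^sup>2 * (\<Sum>r\<in>I. (norm (c r *\<^sub>C sgn (Rep_ell2 \<xi> r)))\<^sup>2)"
          by (simp add: power_mult_distrib w_def norm_finite_ell2[OF I])
        also have "\<dots> \<le> (norm T)\<^sup>2 * (\<Sum>r\<in>I. (cmod (c r))\<^sup>2)"
          by (intro mult_left_mono sum_mono power_mono) (auto simp: norm_scaleC_hilbert norm_sgn)
        finally show ?thesis .
      qed
      have \<zeta>: "cmod (\<Sum>r\<in>I. u (t - r) * x t r * of_real (norm (Rep_ell2 \<xi> r))) = norm (Rep_ell2 (T' \<bullet>\<^sub>O \<xi>) t)"
        if t: "t \<in> F" for t
      proof -
        have tI: "- s + t \<in> I" if "u s *\<^sub>C a s \<noteq> 0" for s
        proof -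
          have "a s \<noteq> 0" using that by auto
          thus ?thesis using t unfolding I_def by blast
        qed
        have "\<zeta> t = (\<Sum>r\<in>I. \<rho> (\<alpha> (- t) (u (t - r) *\<^sub>C a (t - r))) \<bullet>\<^sub>O Rep_ell2 \<xi> r)"
          unfolding \<zeta>_def T'_def using t
          by (subst fourier_poly_apply[OF ua I]) (auto dest: tI)
        also have "\<dots> = (\<Sum>r\<in>I. (u (t - r) * of_real (norm (Rep_ell2 \<xi> r))) *\<^sub>C X t r \<bullet>\<^sub>O sgn (Rep_ell2 \<xi> r))"
        proof (rule sum.cong[OF refl])
          fix r
          have "Rep_ell2 \<xi> r = complex_of_real (norm (Rep_ell2 \<xi> r)) *\<^sub>C sgn (Rep_ell2 \<xi> r)"
            by (cases "Rep_ell2 \<xi> r = 0") (simp_all add: sgn_div_norm flip: scaleR_scaleC)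
          hence "X t r \<bullet>\<^sub>O Rep_ell2 \<xi> r = complex_of_real (norm (Rep_ell2 \<xi> r)) *\<^sub>C X t r \<bullet>\<^sub>O sgn (Rep_ell2 \<xi> r)"
            by (metis bop_apply_scaleC)
          thus "\<rho> (\<alpha> (- t) (u (t - r) *\<^sub>C a (t - r))) \<bullet>\<^sub>O Rep_ell2 \<xi> r =
              (u (t - r) * of_real (norm (Rep_ell2 \<xi> r))) *\<^sub>C X t r \<bullet>\<^sub>O sgn (Rep_ell2 \<xi> r)"
            by (simp add: X_def \<rho>_simps \<alpha>_simps bop_apply_simps scaleC_scaleC)
        qed
        finally have "cinner (sgn (\<zeta> t)) (\<zeta> t) =
            (\<Sum>r\<in>I. u (t - r) * x t r * of_real (norm (Rep_ell2 \<xi> r)))"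
          by (simp add: cinner_sum_right cinner_scaleC_right x_def mult_ac)
        moreover have "cinner (sgn (\<zeta> t)) (\<zeta> t) = of_real (norm (\<zeta> t))"
          by (cases "\<zeta> t = 0")
            (simp_all add: sgn_div_norm scaleR_scaleC cinner_scaleC_left cinner_self power2_eq_square)
        ultimately show ?thesis using t by (metis \<zeta>_def abs_norm_cancel norm_of_real)
      qed
      have "(\<Sum>t\<in>F. (norm (Rep_ell2 (T' \<bullet>\<^sub>O \<xi>) t))\<^sup>2) =
          (\<Sum>t\<in>F. (cmod (\<Sum>r\<in>I. u (t - r) * x t r * of_real (norm (Rep_ell2 \<xi> r))))\<^sup>2)"
        by (simp add: \<zeta>)
      also have "\<dots> \<le> (\<Sum>t\<in>I. (cmod (\<Sum>r\<in>I. u (t - r) * x t r * of_real (norm (Rep_ell2 \<xi> r))))\<^sup>2)"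
        by (rule sum_mono2[OF I]) (auto simp: I_def)
      also have "\<dots> \<le> (C * norm T)\<^sup>2 * (\<Sum>r\<in>I. (cmod (of_real (norm (Rep_ell2 \<xi> r))))\<^sup>2)"
        by (rule Herz_Schur_multiplier_bound[OF u I norm_ge_zero bound])
      also have "\<dots> \<le> (C * norm T)\<^sup>2 * (norm \<xi>)\<^sup>2"
        using ell2_sum_le[OF I, of \<xi>] by (intro mult_left_mono) auto
      finally show "(\<Sum>t\<in>F. (norm (Rep_ell2 (T' \<bullet>\<^sub>O \<xi>) t))\<^sup>2) \<le> (C * norm T * norm \<xi>)\<^sup>2"
        by (simp add: power_mult_distrib)
    qed (use C in simp)
  qed (use C in simp)
  thus ?thesis by (simp add: T_def T'_def)
qed

definition fourier_polys :: "('g, 'h) ell2 bop set"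
  where "fourier_polys = {fourier_poly a | a. finite {s. a s \<noteq> 0}}"

lemma fourier_polysI: "finite {s. a s \<noteq> 0} \<Longrightarrow> fourier_poly a \<in> fourier_polys"
  by (auto simp: fourier_polys_def)

lemma fourier_polys_add: "x \<in> fourier_polys \<Longrightarrow> y \<in> fourier_polys \<Longrightarrow> x + y \<in> fourier_polys"
proof -
  assume "x \<in> fourier_polys" "y \<in> fourier_polys"
  then obtain a b where ab: "x = fourier_poly a" "y = fourier_poly b"
    "finite {s. a s \<noteq> 0}" "finite {s. b s \<noteq> 0}" by (auto simp: fourier_polys_def)
  have "finite {s. a s + b s \<noteq> 0}"
    by (rule finite_subset[OF _ finite_UnI[OF ab(3,4)]]) auto
  from fourier_polysI[OF this] show ?thesis by (simp add: fourier_poly_add[OF ab(3,4)] ab(1,2))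
qed

lemma fourier_polys_0: "0 \<in> fourier_polys"
  using fourier_polysI[of "\<lambda>_. 0"] by (simp add: fourier_poly_def)

lemma fourier_polys_sum: "(\<And>i. i \<in> I \<Longrightarrow> f i \<in> fourier_polys) \<Longrightarrow> (\<Sum>i\<in>I. f i) \<in> fourier_polys"
  by (induction I rule: infinite_finite_induct) (simp_all add: fourier_polys_0 fourier_polys_add)

lemma monomial_in_fourier_polys: "\<pi> a * U s \<in> fourier_polys"
proof -
  have "fourier_poly (\<lambda>t. if t = s then a else 0) = \<pi> a * U s"
    by (subst fourier_poly_eq[of "{s}"]) auto
  moreover have "finite {t. (if t = s then a else 0) \<noteq> 0}"
    by (rule finite_subset[of _ "{s}"]) auto
  ultimately show ?thesis using fourier_polysI[of "\<lambda>t. if t = s then a else 0"] by simp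
qed

text \<open>Products and adjoints of monomials are monomials by covariance, so the closure is itself a
  \<open>C\<^sup>*\<close>-subalgebra containing the generators.\<close>

lemma crossed_product_subset_closure:
  "reduced_crossed_product \<rho> \<alpha> UNIV \<subseteq> closure fourier_polys"
  unfolding reduced_crossed_product_def
proof (rule hull_minimal)
  have "\<pi> a \<in> fourier_polys" for a
    using monomial_in_fourier_polys[of a 0] by (simp add: regular_unitary_0)
  moreover have "U s \<in> fourier_polys" for s
    using monomial_in_fourier_polys[of 1 s] by (simp add: \<pi>_1)
  ultimately show "range \<pi> \<union> range U \<subseteq> closure fourier_polys"
    using closure_subset by blast
  show "cstar_subalgebra (closure fourier_polys)"
  proof (rule cstar_subalgebra_closure)
    fix x assume "x \<in> fourier_polys"
    then obtain a where a: "x = fourier_poly a" "finite {s. a s \<noteq> 0}"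
      by (auto simp: fourier_polys_def)
    have "star (\<pi> (a s) * U s) = \<pi> (\<alpha> (- s) (star (a s))) * U (- s)" for s
      by (simp add: star_mult star_regular_unitary covariance flip: \<pi>_simps)
    hence "star x = (\<Sum>s | a s \<noteq> 0. \<pi> (\<alpha> (- s) (star (a s))) * U (- s))"
      by (simp add: a fourier_poly_def linear_sum[OF bounded_linear.linear[OF bounded_linear_star]])
    thus "star x \<in> fourier_polys"
      by (simp add: fourier_polys_sum monomial_in_fourier_polys)
    fix c
    have "finite {s. c *\<^sub>C a s \<noteq> 0}" by (rule finite_subset[OF _ a(2)]) auto
    thus "c *\<^sub>C x \<in> fourier_polys"
      unfolding a(1) fourier_poly_scaleC[OF a(2), symmetric] by (rule fourier_polysI)
  next
    fix x y assume "x \<in> fourier_polys" "y \<in> fourier_polys"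
    then obtain a b where ab: "x = fourier_poly a" "y = fourier_poly b"
      by (auto simp: fourier_polys_def)
    have "(\<pi> c * U s) * (\<pi> d * U t) = \<pi> (c * \<alpha> s d) * U (s + t)" for c d s t
    proof -
      have "(\<pi> c * U s) * (\<pi> d * U t) = \<pi> c * (U s * \<pi> d) * U t" by (simp only: mult.assoc)
      thus ?thesis by (simp add: covariance \<pi>_simps mult.assoc regular_unitary_add)
    qed
    hence "x * y = (\<Sum>s | a s \<noteq> 0. \<Sum>t | b t \<noteq> 0. \<pi> (a s * \<alpha> s (b t)) * U (s + t))"
      by (simp add: ab fourier_poly_def sum_product)
    thus "x * y \<in> fourier_polys"
      by (simp add: fourier_polys_sum monomial_in_fourier_polys)
  qed (simp_all add: fourier_polys_0 fourier_polys_add)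
qed

lemma fourier_approximation:
  assumes "b \<in> reduced_crossed_product \<rho> \<alpha> UNIV"
  shows "\<exists>a. (\<forall>n :: nat. finite {s. a n s \<noteq> 0}) \<and> (\<lambda>n. fourier_poly (a n)) \<longlonglongrightarrow> b"
proof -
  obtain X where X: "\<And>n. X n \<in> fourier_polys" "X \<longlonglongrightarrow> b"
    using subsetD[OF crossed_product_subset_closure assms] unfolding closure_sequential by blast
  have "\<forall>n. \<exists>a. finite {s. a s \<noteq> 0} \<and> X n = fourier_poly a"
    using X(1) by (auto simp: fourier_polys_def)
  from choice[OF this] obtain a where a: "\<forall>n. finite {s. a n s \<noteq> 0} \<and> X n = fourier_poly (a n)"
    by blast
  hence "X = (\<lambda>n. fourier_poly (a n))" by (intro ext) simp
  with X(2) a show ?thesis by (intro exI[of _ a]) simp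
qed

lemma fourier_coeff_convergent:
  assumes a: "\<And>n :: nat. finite {s. a n s \<noteq> 0}" and lim: "(\<lambda>n. fourier_poly (a n)) \<longlonglongrightarrow> b"
  shows "convergent (\<lambda>n. a n s)"
proof -
  have le: "norm (a m s - a n s) \<le> norm (fourier_poly (a m) - fourier_poly (a n))" for m n
  proof -
    have "finite {s. a m s - a n s \<noteq> 0}"
      by (rule finite_subset[OF _ finite_UnI[OF a[of m] a[of n]]]) auto
    from norm_fourier_coeff_le[OF this, of s] show ?thesis
      by (simp add: fourier_poly_diff a)
  qed
  have "Cauchy (\<lambda>n. fourier_poly (a n))" by (rule LIMSEQ_imp_Cauchy[OF lim])
  hence "Cauchy (\<lambda>n. a n s)"
    unfolding Cauchy_def dist_norm
  proof (intro allI impI)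
    fix e :: real assume "0 < e"
      and "\<forall>e>0. \<exists>M. \<forall>m\<ge>M. \<forall>n\<ge>M. norm (fourier_poly (a m) - fourier_poly (a n)) < e"
    then obtain M where "\<forall>m\<ge>M. \<forall>n\<ge>M. norm (fourier_poly (a m) - fourier_poly (a n)) < e" by blast
    hence "norm (a m s - a n s) < e" if "M \<le> m" "M \<le> n" for m n
      using le[of m n] that by (meson order_le_less_trans)
    thus "\<exists>M. \<forall>m\<ge>M. \<forall>n\<ge>M. norm (a m s - a n s) < e" by blast
  qed
  thus ?thesis by (rule Cauchy_convergent)
qed

end

section \<open>Fourier coefficients of an intermediate algebra\<close>

definition conj_average :: "'g::group_add list \<Rightarrow> ('g, 'h::complex_hilbert_space) ell2 bop \<Rightarrow> ('g, 'h) ell2 bop"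
  where "conj_average ss x = (1 / real (length ss)) *\<^sub>R
    (\<Sum>i<length ss. regular_unitary (ss ! i) * x * regular_unitary (- (ss ! i)))"

lemma conj_average_diff: "conj_average ss (x - y) = conj_average ss x - conj_average ss y"
  by (simp add: conj_average_def right_diff_distrib left_diff_distrib sum_subtractf scaleR_right_diff_distrib)

lemma conj_average_sum: "conj_average ss (\<Sum>i\<in>I. f i) = (\<Sum>i\<in>I. conj_average ss (f i))"
  unfolding conj_average_def scaleR_sum_right[symmetric] sum_distrib_left sum_distrib_right
  by (subst sum.swap) simp

lemma conj_average_one: "ss \<noteq> [] \<Longrightarrow> conj_average ss 1 = 1"
  by (simp add: conj_average_def regular_unitary_add regular_unitary_0 sum_constant_scaleR del: sum_constant)

lemma norm_conj_average_le: "norm (conj_average ss x) \<le> norm x"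
proof -
  have "norm (regular_unitary s * x * regular_unitary (- s)) \<le> norm x" for s
  proof -
    have "norm (regular_unitary s * x * regular_unitary (- s)) \<le>
        norm (regular_unitary s * x) * norm (regular_unitary (- s) :: ('a, 'b) ell2 bop)"
      by (rule norm_mult_ineq)
    also have "\<dots> \<le> norm (regular_unitary s * x)"
      by (rule mult_left_le[OF norm_regular_unitary_le norm_ge_zero])
    also have "\<dots> \<le> norm (regular_unitary s :: ('a, 'b) ell2 bop) * norm x" by (rule norm_mult_ineq)
    also have "\<dots> \<le> norm x" by (rule mult_left_le_one_le) (auto intro: norm_regular_unitary_le)
    finally show ?thesis .
  qed
  hence "norm (\<Sum>i<length ss. regular_unitary (ss ! i) * x * regular_unitary (- (ss ! i))) \<le> (\<Sum>i<length ss. norm x)"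
    by (intro sum_norm_le)
  thus ?thesis by (cases "ss = []") (simp_all add: conj_average_def field_simps)
qed

lemma conj_average_in_subalgebra:
  assumes B: "cstar_subalgebra B" and U: "range regular_unitary \<subseteq> B" and x: "x \<in> B"
  shows "conj_average ss x \<in> B"
proof -
  have mult: "y * z \<in> B" and scale: "c *\<^sub>C y \<in> B" if "y \<in> B" "z \<in> B" for y z c
    using B that by (auto simp: cstar_subalgebra_def)
  have "regular_unitary s \<in> B" for s using U by blast
  thus ?thesis unfolding conj_average_def scaleR_scaleC
    by (intro scale[OF _ x] cstar_subalgebra_sum[OF B] mult x) auto
qed

text \<open>On \<open>\<ell>\<^sup>2(\<Gamma>, H)\<close> the averages of \<open>\<lambda>\<^sub>t\<close> have norm at most that of the same averages on \<open>\<ell>\<^sup>2(\<Gamma>)\<close>.\<close>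

lemma plump_conj_average:
  fixes \<Lambda> :: "'g::group_add set"
  assumes "plump \<Lambda>" "finite F" "0 \<notin> F" "0 < \<epsilon>"
  shows "\<exists>ss. ss \<noteq> [] \<and> set ss \<subseteq> \<Lambda> \<and>
    (\<forall>t\<in>F. norm (conj_average ss (regular_unitary t) :: ('g, 'h::complex_hilbert_space) ell2 bop) < \<epsilon>)"
proof -
  obtain ss where ss: "ss \<noteq> []" "set ss \<subseteq> \<Lambda>" and small: "\<And>t. t \<in> F \<Longrightarrow> norm ((1 / real (length ss)) *\<^sub>R (\<Sum>s\<leftarrow>ss.
      regular_unitary s * regular_unitary t * regular_unitary (- s) :: ('g, complex) ell2 bop)) < \<epsilon>"
    using assms(1)[unfolded plump_def, THEN conjunct2, THEN conjunct2, rule_format, OF assms(4) conjI[OF assms(2,3)]]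
    by (elim exE conjE) (rule that, assumption, assumption, erule (1) bspec)
  have avg: "conj_average ss (regular_unitary t) = (1 / real (length ss)) *\<^sub>R
      (\<Sum>i<length ss. regular_unitary (ss ! i + t + - (ss ! i)) :: ('g, 'k::complex_hilbert_space) ell2 bop)" for t
    by (simp only: conj_average_def regular_unitary_add)
  have "norm (conj_average ss (regular_unitary t) :: ('g, 'h) ell2 bop) < \<epsilon>" if t: "t \<in> F" for t
  proof -
    have "norm (conj_average ss (regular_unitary t) :: ('g, 'h) ell2 bop) \<le>
        norm (conj_average ss (regular_unitary t) :: ('g, complex) ell2 bop)"
      unfolding avg norm_scaleR by (rule mult_left_mono[OF norm_sum_regular_unitary_le abs_ge_zero])
    also have "conj_average ss (regular_unitary t) = (1 / real (length ss)) *\<^sub>R (\<Sum>s\<leftarrow>ss.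
        regular_unitary s * regular_unitary t * regular_unitary (- s) :: ('g, complex) ell2 bop)"
      unfolding conj_average_def sum_list_sum_nth length_map atLeast0LessThan
      by (rule arg_cong2[where f = scaleR], rule refl, rule sum.cong, rule refl) simp
    also have "norm \<dots> < \<epsilon>" by (rule small[OF t])
    finally show ?thesis .
  qed
  thus ?thesis using ss by blast
qed

context covariant_system
begin

lemma conj_average_\<pi>:
  assumes "set ss \<subseteq> action_kernel \<alpha>"
  shows "conj_average ss (\<pi> a * x) = \<pi> a * conj_average ss x"
proof -
  have "U (ss ! i) * (\<pi> a * x) = \<pi> a * (U (ss ! i) * x)" if "i < length ss" for i
  proof -
    have "\<alpha> (ss ! i) = id" using assms nth_mem[OF that] by (auto simp: action_kernel_def)
    thus ?thesis using covariance[of "ss ! i" a] by (simp add: mult.assoc[symmetric])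
  qed
  thus ?thesis by (simp add: conj_average_def sum_distrib_left mult.assoc)
qed

text \<open>After multiplying by \<open>\<lambda>\<^sub>s\<^sup>*\<close> the coefficient \<open>a s\<close> sits at the neutral element, where conjugation
  does nothing; plumpness makes the averages of all other terms small.\<close>

lemma average_approximates_coeff:
  assumes \<Lambda>: "plump \<Lambda>" "\<Lambda> \<subseteq> action_kernel \<alpha>" and a: "finite {s. a s \<noteq> 0}" and e: "0 < e"
  shows "\<exists>ss. norm (conj_average ss (fourier_poly a * U (- s)) - \<pi> (a s)) \<le> e"
proof -
  define S where "S = {t. a t \<noteq> 0} - {s}"
  have S: "finite S" "s \<notin> S" using a by (auto simp: S_def)
  \<comment> \<open>The summand \<open>1\<close> keeps \<open>e / M\<close> meaningful when \<open>S\<close> is empty.\<close>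
  define M where "M = 1 + (\<Sum>t\<in>S. norm (a t))"
  have M: "0 < M" by (simp add: M_def add_pos_nonneg sum_nonneg)
  define F where "F = (\<lambda>t. t - s) ` S"
  have "finite F" "0 \<notin> F" using S by (auto simp: F_def)
  then obtain ss where ss: "ss \<noteq> []" "set ss \<subseteq> \<Lambda>"
    and small: "\<And>t. t \<in> F \<Longrightarrow> norm (conj_average ss (U t)) < e / M"
    using plump_conj_average[OF \<Lambda>(1), of F "e / M"] e M by (metis divide_pos_pos)
  have ker: "set ss \<subseteq> action_kernel \<alpha>" using ss(2) \<Lambda>(2) by blast
  have "fourier_poly a = (\<Sum>t\<in>insert s S. \<pi> (a t) * U t)"
    using S by (intro fourier_poly_eq) (auto simp: S_def)
  hence "fourier_poly a * U (- s) = (\<Sum>t\<in>insert s S. \<pi> (a t) * U (t - s))"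
    by (simp only: sum_distrib_right mult.assoc regular_unitary_add add_uminus_conv_diff)
  hence "conj_average ss (fourier_poly a * U (- s)) = (\<Sum>t\<in>insert s S. \<pi> (a t) * conj_average ss (U (t - s)))"
    by (simp only: conj_average_sum conj_average_\<pi>[OF ker])
  also have "\<dots> = \<pi> (a s) + (\<Sum>t\<in>S. \<pi> (a t) * conj_average ss (U (t - s)))"
    using S by (simp add: regular_unitary_0 conj_average_one[OF ss(1)])
  finally have "norm (conj_average ss (fourier_poly a * U (- s)) - \<pi> (a s)) =
      norm (\<Sum>t\<in>S. \<pi> (a t) * conj_average ss (U (t - s)))" by simp
  also have "\<dots> \<le> (\<Sum>t\<in>S. norm (a t) * (e / M))"
  proof (rule sum_norm_le)
    fix t assume "t \<in> S"
    hence "norm (conj_average ss (U (t - s))) \<le> e / M" by (intro less_imp_le small) (simp add: F_def)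
    thus "norm (\<pi> (a t) * conj_average ss (U (t - s))) \<le> norm (a t) * (e / M)"
      by (intro order_trans[OF norm_mult_ineq] mult_mono norm_\<pi>_le) auto
  qed
  also have "\<dots> = (M - 1) * (e / M)" unfolding sum_distrib_right[symmetric] by (simp add: M_def)
  also have "\<dots> \<le> e" using M e by (simp add: field_simps)
  finally show ?thesis by blast
qed

text \<open>Averages of \<open>b \<lambda>\<^sub>s\<^sup>*\<close> stay in \<open>B\<close>. Averaging is contractive, so they are close to the averages for an
  approximating Fourier polynomial, which are close to its coefficient at \<open>s\<close>.\<close>

lemma fourier_coeff_in_subalgebra:
  assumes \<Lambda>: "plump \<Lambda>" "\<Lambda> \<subseteq> action_kernel \<alpha>"
    and B: "cstar_subalgebra B" "range U \<subseteq> B" and b: "b \<in> B"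
    and a: "\<And>n :: nat. finite {s. a n s \<noteq> 0}" "(\<lambda>n. fourier_poly (a n)) \<longlonglongrightarrow> b"
    and c: "(\<lambda>n. a n s) \<longlonglongrightarrow> c"
  shows "\<pi> c \<in> B"
proof -
  have clo: "closed B" and bU: "b * U (- s) \<in> B"
    using B b by (auto simp: cstar_subalgebra_def)
  have "\<exists>y\<in>B. dist y (\<pi> c) < e" if e: "0 < e" for e
  proof -
    have "\<forall>\<^sub>F n in sequentially. dist (fourier_poly (a n)) b < e / 3 \<and> dist (a n s) c < e / 3"
      using e by (intro eventually_conj tendstoD[OF a(2)] tendstoD[OF c]) auto
    then obtain n where n: "norm (b - fourier_poly (a n)) < e / 3" "norm (a n s - c) < e / 3"
      by (auto simp: eventually_sequentially dist_norm norm_minus_commute)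
    obtain ss where ss: "norm (conj_average ss (fourier_poly (a n) * U (- s)) - \<pi> (a n s)) \<le> e / 3"
      using average_approximates_coeff[OF \<Lambda> a(1), of "e / 3" n s] e by auto
    define y where "y = conj_average ss (b * U (- s))"
    have "norm (y - conj_average ss (fourier_poly (a n) * U (- s))) \<le> norm (b * U (- s) - fourier_poly (a n) * U (- s))"
      unfolding y_def conj_average_diff[symmetric] by (rule norm_conj_average_le)
    also have "\<dots> = norm ((b - fourier_poly (a n)) * U (- s))" by (simp only: left_diff_distrib)
    also have "\<dots> \<le> norm (b - fourier_poly (a n)) * norm (U (- s))" by (rule norm_mult_ineq)
    also have "\<dots> \<le> norm (b - fourier_poly (a n))"
      by (rule mult_left_le[OF norm_regular_unitary_le norm_ge_zero])
    finally have 1: "norm (y - conj_average ss (fourier_poly (a n) * U (- s))) < e / 3" using n(1) by simp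
    have 2: "norm (\<pi> (a n s) - \<pi> c) < e / 3"
      using norm_\<pi>_le[of "a n s - c"] n(2) by (simp add: \<pi>_simps)
    have "y - \<pi> c = (y - conj_average ss (fourier_poly (a n) * U (- s))) +
        ((conj_average ss (fourier_poly (a n) * U (- s)) - \<pi> (a n s)) + (\<pi> (a n s) - \<pi> c))" by simp
    hence "norm (y - \<pi> c) \<le> norm (y - conj_average ss (fourier_poly (a n) * U (- s))) +
        (norm (conj_average ss (fourier_poly (a n) * U (- s)) - \<pi> (a n s)) + norm (\<pi> (a n s) - \<pi> c))"
      by (metis norm_triangle_ineq norm_triangle_mono order_refl)
    hence "dist y (\<pi> c) < e" using 1 2 ss by (simp add: dist_norm)
    moreover have "y \<in> B" unfolding y_def by (rule conj_average_in_subalgebra[OF B bU])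
    ultimately show ?thesis by blast
  qed
  thus ?thesis using closed_approachable[OF clo] by blast
qed

lemma coefficient_algebra:
  assumes B: "cstar_subalgebra B" "range U \<subseteq> B"
  shows "cstar_subalgebra {a. \<pi> a \<in> B}" and "1 \<in> {a. \<pi> a \<in> B}"
    and "\<alpha> s ` {a. \<pi> a \<in> B} \<subseteq> {a. \<pi> a \<in> B}"
proof -
  have UB: "U t \<in> B" for t using B(2) by blast
  have "isCont \<pi> a" for a using tendsto_\<pi>[OF tendsto_ident_at] by (simp add: isCont_def)
  hence "closed (\<pi> -` B)"
    using B(1) by (intro continuous_closed_vimage) (auto simp: cstar_subalgebra_def)
  thus "cstar_subalgebra {a. \<pi> a \<in> B}"
    using B(1) by (auto simp: cstar_subalgebra_def \<pi>_simps vimage_def)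
  show "1 \<in> {a. \<pi> a \<in> B}" using UB[of 0] by (simp add: \<pi>_1 regular_unitary_0)
  show "\<alpha> s ` {a. \<pi> a \<in> B} \<subseteq> {a. \<pi> a \<in> B}"
    using B(1) UB by (auto simp: \<pi>_\<alpha> cstar_subalgebra_def)
qed

end

section \<open>The approximation property\<close>

lemma pairing_finite:
  assumes "finite I" "\<And>s. s \<notin> I \<Longrightarrow> f s * u s = 0"
  shows "pairing f u = (\<Sum>s\<in>I. f s * u s)"
proof -
  have "pairing f u = (\<Sum>\<^sub>\<infinity>s\<in>I. f s * u s)"
    unfolding pairing_def by (rule infsum_cong_neutral) (use assms in auto)
  thus ?thesis using assms(1) by simp
qed

lemma zero_in_M0A_ball: "(\<lambda>_. 0) \<in> {u \<in> (M0A :: ('g::group_add \<Rightarrow> complex) set). norm_M0A u \<le> 1}"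
proof -
  have "matrix_norm n (\<lambda>i j. 0 :: ('g, complex) ell2 bop) \<le> 0" for n
    by (rule matrix_norm_least) (simp add: bop_apply_simps)
  hence "cb_bounded_on reduced_group_algebra (\<lambda>_. 0 :: ('g, complex) ell2 bop) 0"
    by (simp add: cb_bounded_on_def)
  hence bound: "cb_multiplier_bound (\<lambda>_ :: 'g. 0) 0"
    unfolding cb_multiplier_bound_def by (intro exI[of _ "\<lambda>_. 0"]) simp
  have "bdd_below {C. cb_multiplier_bound (\<lambda>_ :: 'g. 0) C}"
    by (rule bdd_belowI[of _ 0]) (auto simp: cb_multiplier_bound_def cb_bounded_on_def)
  hence "norm_M0A (\<lambda>_ :: 'g. 0) \<le> 0"
    unfolding norm_M0A_def using bound by (intro cInf_lower) auto
  thus ?thesis using bound by (auto simp: M0A_def)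
qed

lemma predual_norm_le:
  assumes "\<And>u. u \<in> M0A \<Longrightarrow> norm_M0A u \<le> 1 \<Longrightarrow> cmod (pairing f u) \<le> K"
  shows "predual_norm f \<le> K"
  unfolding predual_norm_def
proof (rule cSUP_least)
  show "{u \<in> M0A. norm_M0A u \<le> 1} \<noteq> ({} :: ('a \<Rightarrow> complex) set)"
    using zero_in_M0A_ball by blast
qed (use assms in auto)

text \<open>The approximation property in the form used below: an element of the predual that vanishes at
  the finitely supported multipliers vanishes at the constant \<open>1\<close>, because the complement of its zero
  set is open and would otherwise contain a finitely supported multiplier.\<close>

lemma approximation_property_finite_support:
  fixes q :: "('g::group_add \<Rightarrow> complex) \<Rightarrow> complex"
  assumes AP: "approximation_property TYPE('g)" and q: "q \<in> M0A_predual"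
    and zero: "\<And>u. u \<in> M0A \<Longrightarrow> finite {s. u s \<noteq> 0} \<Longrightarrow> q u = 0"
  shows "(\<lambda>_. 1) \<in> (M0A :: ('g \<Rightarrow> complex) set)" and "q (\<lambda>_. 1) = 0"
proof -
  obtain F :: "('g \<Rightarrow> complex) filter" where F: "F \<noteq> bot" "\<forall>\<^sub>F u in F. finite {s. u s \<noteq> 0}"
    and lim: "limitin M0A_weak_star (\<lambda>u. u) (\<lambda>_. 1) F"
    using AP by (auto simp: approximation_property_def)
  have "(\<lambda>_. 1) \<in> topspace (M0A_weak_star :: ('g \<Rightarrow> complex) topology)"
    using lim by (simp add: limitin_def)
  thus 1: "(\<lambda>_. 1) \<in> (M0A :: ('g \<Rightarrow> complex) set)"
    by (auto simp: M0A_weak_star_def)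
  show "q (\<lambda>_. 1) = 0"
  proof (rule ccontr)
    assume q1: "q (\<lambda>_. 1) \<noteq> 0"
    have "openin M0A_weak_star {u \<in> M0A. q u \<in> - {0}}"
      unfolding M0A_weak_star_def
      by (rule topology_generated_by_Basis) (use q in \<open>auto intro!: exI[of _ q] exI[of _ "- {0}"]\<close>)
    moreover have "(\<lambda>_. 1) \<in> {u \<in> M0A. q u \<in> - {0}}" using 1 q1 by simp
    ultimately have "\<forall>\<^sub>F u in F. u \<in> {u \<in> M0A. q u \<in> - {0}}"
      using lim unfolding limitin_def by blast
    with F(2) have "\<forall>\<^sub>F u in F. False"
      by eventually_elim (use zero in auto)
    thus False using F(1) by (simp add: eventually_False)
  qed
qed

context covariant_system
begin

text \<open>The numbers \<open>f n s = \<phi> (\<pi> (a n s) \<lambda>\<^sub>s)\<close> form finitely supported functions whose pairing with \<open>u\<close>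
  is \<open>\<phi>\<close> of the \<open>n\<close>-th Fourier polynomial multiplied by \<open>u\<close>. By the norm bound for multipliers
  they form a Cauchy sequence in the predual norm when the Fourier polynomials converge.\<close>

lemma slice_in_predual:
  fixes \<phi> :: "('g, 'h) ell2 bop \<Rightarrow> complex"
  assumes \<phi>: "\<And>x y. \<phi> (x + y) = \<phi> x + \<phi> y" "\<And>c x. \<phi> (c *\<^sub>C x) = c * \<phi> x"
      "\<And>x. cmod (\<phi> x) \<le> K * norm x"
    and a: "\<And>n :: nat. finite {s. a n s \<noteq> 0}" "(\<lambda>n. fourier_poly (a n)) \<longlonglongrightarrow> b"
  shows "\<exists>q\<in>M0A_predual. \<forall>u\<in>M0A. (\<lambda>n. \<phi> (fourier_poly (\<lambda>s. u s *\<^sub>C a n s))) \<longlonglongrightarrow> q u"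
proof -
  have \<phi>0: "\<phi> 0 = 0" using \<phi>(2)[of 0 0] by simp
  have \<phi>_diff: "\<phi> (x - y) = \<phi> x - \<phi> y" for x y using \<phi>(1)[of "x - y" y] by simp
  have \<phi>_sum: "\<phi> (\<Sum>i\<in>I. g i) = (\<Sum>i\<in>I. \<phi> (g i))" for I :: "'g set" and g
    by (induction I rule: infinite_finite_induct) (simp_all add: \<phi> \<phi>0)
  have K: "0 \<le> K" using \<phi>(3)[of 1] norm_ge_zero[of "\<phi> 1"] by (simp del: norm_ge_zero)
  define f where "f n s = \<phi> (\<pi> (a n s) * U s)" for n s
  have f0: "f n s = 0" if "a n s = 0" for n s using that by (simp add: f_def \<pi>_simps \<phi>0)
  have pairing_f: "pairing (f n) u = \<phi> (fourier_poly (\<lambda>s. u s *\<^sub>C a n s))" for n u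
  proof -
    have "pairing (f n) u = (\<Sum>s | a n s \<noteq> 0. f n s * u s)"
      by (rule pairing_finite[OF a(1)]) (simp add: f0)
    also have "\<dots> = \<phi> (\<Sum>s | a n s \<noteq> 0. \<pi> (u s *\<^sub>C a n s) * U s)"
      by (simp add: \<phi>_sum f_def \<pi>_simps mult_scaleC_left \<phi> mult.commute)
    also have "(\<Sum>s | a n s \<noteq> 0. \<pi> (u s *\<^sub>C a n s) * U s) = fourier_poly (\<lambda>s. u s *\<^sub>C a n s)"
      by (rule fourier_poly_eq[OF a(1), symmetric]) auto
    finally show ?thesis .
  qed
  have diff: "cmod (\<phi> (fourier_poly (\<lambda>s. u s *\<^sub>C a m s)) - \<phi> (fourier_poly (\<lambda>s. u s *\<^sub>C a n s)))
      \<le> K * (C * norm (fourier_poly (a m) - fourier_poly (a n)))"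
    if u: "cb_multiplier_bound u C" for u C m n
  proof -
    have fin: "finite {s. a m s - a n s \<noteq> 0}"
      by (rule finite_subset[OF _ finite_UnI[OF a(1)[of m] a(1)[of n]]]) auto
    have fin': "finite {s. u s *\<^sub>C a k s \<noteq> 0}" for k
      by (rule finite_subset[OF _ a(1)[of k]]) auto
    have "\<phi> (fourier_poly (\<lambda>s. u s *\<^sub>C a m s)) - \<phi> (fourier_poly (\<lambda>s. u s *\<^sub>C a n s)) =
        \<phi> (fourier_poly (\<lambda>s. u s *\<^sub>C (a m s - a n s)))"
      by (simp add: \<phi>_diff[symmetric] fourier_poly_diff[OF fin' fin', symmetric] scaleC_diff_right)
    also have "cmod \<dots> \<le> K * norm (fourier_poly (\<lambda>s. u s *\<^sub>C (a m s - a n s)))" by (rule \<phi>(3))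
    also have "\<dots> \<le> K * (C * norm (fourier_poly (\<lambda>s. a m s - a n s)))"
      by (intro mult_left_mono norm_multiplier_le[OF u fin] K)
    finally show ?thesis by (simp add: fourier_poly_diff a(1))
  qed
  have Cauchy: "\<exists>N. \<forall>m\<ge>N. \<forall>n\<ge>N. K * (C * norm (fourier_poly (a m) - fourier_poly (a n))) < e"
    if "0 < e" "0 \<le> C" for e C
  proof -
    define d where "d = e / (K * C + 1)"
    have KC: "0 < K * C + 1" using K that by (simp add: add_nonneg_pos)
    hence "0 < d" using that by (simp add: d_def)
    then obtain N where N: "\<forall>m\<ge>N. \<forall>n\<ge>N. norm (fourier_poly (a m) - fourier_poly (a n)) < d"
      using LIMSEQ_imp_Cauchy[OF a(2)] unfolding Cauchy_def dist_norm by blast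
    have "K * (C * norm (fourier_poly (a m) - fourier_poly (a n))) < e" if "N \<le> m" "N \<le> n" for m n
    proof -
      have "norm (fourier_poly (a m) - fourier_poly (a n)) \<le> d" using N that by (simp add: less_imp_le)
      hence "K * (C * norm (fourier_poly (a m) - fourier_poly (a n))) \<le> K * (C * d)"
        using K \<open>0 \<le> C\<close> by (intro mult_left_mono)
      also have "\<dots> < (K * C + 1) * d" using \<open>0 < d\<close> by (simp add: distrib_right)
      also have "\<dots> = e" using KC by (simp add: d_def)
      finally show ?thesis .
    qed
    thus ?thesis by blast
  qed
  define q where "q u = lim (\<lambda>n. \<phi> (fourier_poly (\<lambda>s. u s *\<^sub>C a n s)))" for u
  have q: "(\<lambda>n. \<phi> (fourier_poly (\<lambda>s. u s *\<^sub>C a n s))) \<longlonglongrightarrow> q u" if u: "u \<in> M0A" for u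
  proof -
    obtain C where C: "cb_multiplier_bound u C" using u by (auto simp: M0A_def)
    hence C0: "0 \<le> C" by (auto simp: cb_multiplier_bound_def cb_bounded_on_def)
    have "Cauchy (\<lambda>n. \<phi> (fourier_poly (\<lambda>s. u s *\<^sub>C a n s)))"
    proof (rule CauchyI)
      fix e :: real assume "0 < e"
      from Cauchy[OF this C0] obtain N where
        "\<forall>m\<ge>N. \<forall>n\<ge>N. K * (C * norm (fourier_poly (a m) - fourier_poly (a n))) < e" by blast
      thus "\<exists>N. \<forall>m\<ge>N. \<forall>n\<ge>N. cmod (\<phi> (fourier_poly (\<lambda>s. u s *\<^sub>C a m s)) - \<phi> (fourier_poly (\<lambda>s. u s *\<^sub>C a n s))) < e"
        by (intro exI[of _ N] allI impI) (rule order_le_less_trans[OF diff[OF C]], simp)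
    qed
    thus ?thesis unfolding q_def convergent_LIMSEQ_iff[symmetric] by (rule Cauchy_convergent)
  qed
  have "q \<in> M0A_predual"
    unfolding M0A_predual_def
  proof (rule CollectI, intro exI[of _ f] conjI allI impI ballI)
    fix n
    have "finite {s \<in> UNIV. norm (f n s) \<noteq> 0}"
      by (rule finite_subset[OF _ a(1)[of n]]) (auto simp: f0)
    hence "(\<lambda>s. norm (f n s)) summable_on UNIV" by (rule finite_nonzero_values_imp_summable_on)
    thus "f n \<in> ell1" by (simp add: ell1_def)
  next
    fix e :: real assume e: "0 < e"
    obtain N where N: "\<forall>m\<ge>N. \<forall>n\<ge>N. K * (2 * norm (fourier_poly (a m) - fourier_poly (a n))) < e / 2"
      using Cauchy[OF half_gt_zero[OF e] zero_le_numeral] by blast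
    have "predual_norm (\<lambda>s. f m s - f n s) \<le> e / 2" if mn: "N \<le> m" "N \<le> n" for m n
    proof (rule predual_norm_le)
      fix u :: "'g \<Rightarrow> complex" assume u: "u \<in> M0A" "norm_M0A u \<le> 1"
      \<comment> \<open>The multiplier norm is an infimum, so \<open>1\<close> itself may fail to be a bound; some number below \<open>2\<close> is one.\<close>
      have ne: "{C. cb_multiplier_bound u C} \<noteq> {}" using u(1) by (auto simp: M0A_def)
      have "Inf {C. cb_multiplier_bound u C} < 2" using u(2) by (simp add: norm_M0A_def)
      from cInf_lessD[OF ne this] obtain C where C: "cb_multiplier_bound u C" "C < 2" by auto
      define I where "I = {s. a m s \<noteq> 0} \<union> {s. a n s \<noteq> 0}"
      have I: "finite I" using a(1) by (simp add: I_def)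
      have out: "f m s = 0" "f n s = 0" if "s \<notin> I" for s using that by (auto simp: I_def f0)
      have "pairing (\<lambda>s. f m s - f n s) u = pairing (f m) u - pairing (f n) u"
        using out by (simp add: pairing_finite[OF I] left_diff_distrib sum_subtractf)
      hence "cmod (pairing (\<lambda>s. f m s - f n s) u) \<le> K * (C * norm (fourier_poly (a m) - fourier_poly (a n)))"
        using diff[OF C(1)] by (simp add: pairing_f)
      also have "\<dots> \<le> K * (2 * norm (fourier_poly (a m) - fourier_poly (a n)))"
        using C(2) K by (intro mult_left_mono mult_right_mono) auto
      finally show "cmod (pairing (\<lambda>s. f m s - f n s) u) \<le> e / 2" using N[rule_format, OF mn] by simp
    qed
    moreover have "e / 2 < e" using e by simp
    ultimately have "\<forall>m\<ge>N. \<forall>n\<ge>N. predual_norm (\<lambda>s. f m s - f n s) < e"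
      by (intro allI impI) (rule order_le_less_trans)
    thus "\<exists>N. \<forall>m\<ge>N. \<forall>n\<ge>N. predual_norm (\<lambda>s. f m s - f n s) < e" by blast
  qed (simp add: pairing_f q)
  thus ?thesis using q by blast
qed

text \<open>A functional \<open>\<phi>\<close> separating \<open>b\<close> from \<open>R\<close> yields an element \<open>u \<mapsto> \<phi> (u \<cdot> b)\<close> of the predual. At
  finitely supported \<open>u\<close> it is the finite sum of the numbers \<open>u s * \<phi> (\<pi> (c s) \<lambda>\<^sub>s) = 0\<close>.\<close>

lemma fourier_synthesis:
  assumes AP: "approximation_property TYPE('g)" and R: "cstar_subalgebra R"
    and a: "\<And>n :: nat. finite {s. a n s \<noteq> 0}" "(\<lambda>n. fourier_poly (a n)) \<longlonglongrightarrow> b"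
    and c: "\<And>s. (\<lambda>n. a n s) \<longlonglongrightarrow> c s" and cR: "\<And>s. \<pi> (c s) * U s \<in> R"
  shows "b \<in> R"
proof (rule ccontr)
  assume b: "b \<notin> R"
  obtain \<phi> K where \<phi>: "\<And>x y. \<phi> (x + y) = \<phi> x + \<phi> y" "\<And>c x. \<phi> (c *\<^sub>C x) = c * \<phi> x"
      "\<And>x. cmod (\<phi> x) \<le> K * norm x" "\<And>x. x \<in> R \<Longrightarrow> \<phi> x = 0" "\<phi> b \<noteq> 0"
    by (rule complex_functional_separation[OF R b]) (rule that)
  have "bounded_linear \<phi>"
    by (rule bounded_linear_intro[where K = K])
      (simp_all add: \<phi> scaleR_scaleC scaleR_conv_of_real scaleC_complex_def mult.commute)
  note tendsto_\<phi> = bounded_linear.tendsto[OF this]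
  obtain q where q: "q \<in> M0A_predual"
    and lim: "\<And>u. u \<in> M0A \<Longrightarrow> (\<lambda>n. \<phi> (fourier_poly (\<lambda>s. u s *\<^sub>C a n s))) \<longlonglongrightarrow> q u"
    using slice_in_predual[OF \<phi>(1-3) a] by blast
  have zero: "q u = 0" if u: "u \<in> M0A" "finite {s. u s \<noteq> 0}" for u
  proof (rule LIMSEQ_unique[OF lim[OF u(1)]])
    have "fourier_poly (\<lambda>s. u s *\<^sub>C a n s) = (\<Sum>s | u s \<noteq> 0. \<pi> (u s *\<^sub>C a n s) * U s)" for n
      by (rule fourier_poly_eq[OF u(2)]) auto
    hence eq: "fourier_poly (\<lambda>s. u s *\<^sub>C a n s) = (\<Sum>s | u s \<noteq> 0. u s *\<^sub>C (\<pi> (a n s) * U s))" for n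
      by (simp add: \<pi>_simps mult_scaleC_left)
    have \<phi>_sum: "\<phi> (\<Sum>s\<in>I. g s) = (\<Sum>s\<in>I. \<phi> (g s))" for I :: "'g set" and g
      using \<phi>(2)[of 0 0] by (induction I rule: infinite_finite_induct) (simp_all add: \<phi>(1))
    have "(\<lambda>n. \<Sum>s | u s \<noteq> 0. u s * \<phi> (\<pi> (a n s) * U s)) \<longlonglongrightarrow> (\<Sum>s | u s \<noteq> 0. u s * \<phi> (\<pi> (c s) * U s))"
      by (intro tendsto_sum tendsto_mult tendsto_const tendsto_\<phi> tendsto_\<pi> c)
    thus "(\<lambda>n. \<phi> (fourier_poly (\<lambda>s. u s *\<^sub>C a n s))) \<longlonglongrightarrow> 0"
      by (simp add: eq \<phi>_sum \<phi>(2) \<phi>(4)[OF cR])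
  qed
  note one = approximation_property_finite_support[OF AP q zero]
  have "(\<lambda>n. \<phi> (fourier_poly (a n))) \<longlonglongrightarrow> 0"
    using lim[OF one(1)] one(2) by simp
  hence "\<phi> b = 0" using tendsto_\<phi>[OF a(2)] LIMSEQ_unique by blast
  thus False using \<phi>(5) by simp
qed

end

section \<open>Intermediate subalgebras\<close>

theorem theorem1p1:
  fixes \<alpha> :: "'g::group_add \<Rightarrow> 'a::cstar_algebra \<Rightarrow> 'a"
    and \<rho> :: "'a \<Rightarrow> 'h::complex_hilbert_space bop"
    and \<Lambda> :: "'g set"
    and B :: "('g, 'h) ell2 bop set"
  assumes "approximation_property TYPE('g)"
    and "cstar_action \<alpha>"
    and "faithful_rep \<rho>"
    and "plump \<Lambda>" and "\<Lambda> \<subseteq> action_kernel \<alpha>"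
    and "cstar_subalgebra B"
    and "reduced_group_algebra \<subseteq> B" and "B \<subseteq> reduced_crossed_product \<rho> \<alpha> UNIV"
  shows "\<exists>A\<^sub>1. cstar_subalgebra A\<^sub>1 \<and> 1 \<in> A\<^sub>1 \<and> (\<forall>s. \<alpha> s ` A\<^sub>1 \<subseteq> A\<^sub>1) \<and>
    B = reduced_crossed_product \<rho> \<alpha> A\<^sub>1"
proof -
  interpret covariant_system \<alpha> \<rho> by unfold_locales (fact assms)+
  have U: "range U \<subseteq> B"
    using regular_unitary_in_group_algebra assms(7) by blast
  define A\<^sub>1 where "A\<^sub>1 = {a. \<pi> a \<in> B}"
  define R where "R = reduced_crossed_product \<rho> \<alpha> A\<^sub>1"
  have R: "cstar_subalgebra R" and gen: "\<pi> ` A\<^sub>1 \<union> range U \<subseteq> R"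
    unfolding R_def reduced_crossed_product_def by (rule cstar_subalgebra_hull, rule hull_subset)
  have "R \<subseteq> B"
    unfolding R_def reduced_crossed_product_def
    by (rule hull_minimal) (use U assms(6) in \<open>auto simp: A\<^sub>1_def\<close>)
  moreover have "B \<subseteq> R"
  proof
    fix b assume b: "b \<in> B"
    obtain a where a: "\<And>n :: nat. finite {s. a n s \<noteq> 0}" "(\<lambda>n. fourier_poly (a n)) \<longlonglongrightarrow> b"
      using fourier_approximation assms(8) b by blast
    define c where "c s = lim (\<lambda>n. a n s)" for s
    have c: "(\<lambda>n. a n s) \<longlonglongrightarrow> c s" for s
      unfolding c_def using fourier_coeff_convergent[OF a] by (simp add: convergent_LIMSEQ_iff)
    have "c s \<in> A\<^sub>1" for s
      unfolding A\<^sub>1_def using fourier_coeff_in_subalgebra[OF assms(4,5,6) U b a c] by simp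
    hence "\<pi> (c s) * U s \<in> R" for s
      using gen R unfolding cstar_subalgebra_def by blast
    thus "b \<in> R" by (rule fourier_synthesis[OF assms(1) R a c])
  qed
  ultimately have "B = R" by blast
  thus ?thesis
    unfolding R_def using coefficient_algebra[OF assms(6) U] by (intro exI[of _ A\<^sub>1]) (simp add: A\<^sub>1_def)
qed

end
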